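(* Let $(X_i)_{i\ge 1}$ be i.i.d. real random variables with $\mathbb E X_1=0$, $\mathbb E X_1^2=\sigma^2\in(0,\infty)$ and $\mathbb E|X_1|^{2+\delta}<\infty$ for some $\delta>0$. Then there exists $\varepsilon_0>0$ such that for any $\varepsilon\in(0,\varepsilon_0)$ there is a constant $c_\varepsilon>0$ such that for all $n\ge1$, $t\in\mathbb R_+$ and $x\in[0,n^{1/2-\varepsilon}]$, $$\left|\mathbb P\Big(\frac{x+S_n}{\sigma\sqrt n}\le t,\ \tau_x>n\Big)-\frac{2V(x)}{\sigma\sqrt{2\pi n}}\,\Phi^+(t)\right|\le c_\varepsilon\,\frac{1+x}{n^{1/2+\varepsilon}}.$$ In particular, for all $n\ge1$ and $x\in[0,n^{1/2-\varepsilon}]$, $$\left|\mathbb P(\tau_x>n)-\frac{2V(x)}{\sigma\sqrt{2\pi n}}\right|\le c_\varepsilon\,\frac{1+x}{n^{1/2+\varepsilon}}.$$ Moreover, there exists a constant $c$ such that for any $x\ge0$ and $n\ge1$, $$\mathbb P(\tau_x>n)\le c\,\frac{1+x}{\sqrt n}.$$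
   Context: Notation: $\mathbb R_+=[0,\infty)$; $S_n=\sum_{i=1}^n X_i$; for $x\ge0$, $\tau_x=\inf\{k\ge1:\ x+S_k<0\}$; $V(x)=-\mathbb E S_{\tau_x}$ for $x\ge0$ (well defined under the stated assumptions); $\Phi^+(t)=(1-e^{-t^2/2})\mathbf 1_{\{t\ge0\}}$ is the Rayleigh distribution function. *)

theory Defs
  imports "HOL-Probability.Probability" "HOL-Library.Extended_Nat"
begin

text \<open>
  The increments are \<open>X 1, X 2, \<dots>\<close>; the value \<open>X 0\<close> is never used.
\<close>

definition walk :: "(nat \<Rightarrow> 'a \<Rightarrow> real) \<Rightarrow> nat \<Rightarrow> 'a \<Rightarrow> real" where
  "walk X n \<omega> = (\<Sum>i = 1..n. X i \<omega>)"

text \<open>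
  The infimum is taken in \<^typ>\<open>enat\<close>, so the exit time is \<open>\<infinity>\<close> if the walk never exits.
\<close>

definition exit_time :: "(nat \<Rightarrow> 'a \<Rightarrow> real) \<Rightarrow> real \<Rightarrow> 'a \<Rightarrow> enat" where
  "exit_time X x \<omega> = Inf {enat k |k. k \<ge> 1 \<and> x + walk X k \<omega> < 0}"

text \<open>
  The walk stopped at the exit time, with the conventional value \<open>0\<close> where the exit time
  is infinite (a null event for a centred walk with finite positive variance).
\<close>

definition exit_position :: "(nat \<Rightarrow> 'a \<Rightarrow> real) \<Rightarrow> real \<Rightarrow> 'a \<Rightarrow> real" where
  "exit_position X x \<omega> = (case exit_time X x \<omega> of enat k \<Rightarrow> walk X k \<omega> | \<infinity> \<Rightarrow> 0)"

definition harmonic_V :: "'a measure \<Rightarrow> (nat \<Rightarrow> 'a \<Rightarrow> real) \<Rightarrow> real \<Rightarrow> real" where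
  "harmonic_V M X x = - (\<integral>\<omega>. exit_position X x \<omega> \<partial>M)"

definition rayleigh_cdf :: "real \<Rightarrow> real" where
  "rayleigh_cdf t = (1 - exp (- t\<^sup>2 / 2)) * indicator {0..} t"

end

theory Submission
  imports Defs "HOL-Real_Asymp.Real_Asymp"
begin

text \<open>
The proof is Lindeberg's replacement method, run up to the exit time; no Brownian motion is
constructed. Write \<open>v = \<sigma>\<^sup>2\<close>, let \<open>T = t \<sigma> sqrt n\<close>, and let \<open>u s\<close> be the solution at time \<open>s\<close> of the
heat equation whose initial value is the odd extension of the indicator of \<open>[0, T]\<close> (the function
\<open>strip T s\<close> below). Restricted to the positive half-line it is the sub-probability that a Brownian
motion killed at \<open>0\<close> ends in \<open>[0, T]\<close>, but being odd it is smooth on the whole line. Hence replacing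
one time step of length \<open>v\<close> by one step of the walk costs only \<open>O(s powr (- 1 - \<delta> / 2))\<close>, whether or
not that step leaves the half-line (\<open>strip_step\<close>). With \<open>s\<^sub>j = h + v (n - j)\<close>, summation along the
walk up to its exit time \<open>\<tau>\<close> (\<open>strip_telescope\<close>) gives
  \<open>E[u h (x + S\<^sub>n); \<tau> > n] = u s\<^sub>0 x - E[u s\<^sub>\<tau> (x + S\<^sub>\<tau>); \<tau> \<le> n] + error\<close>.
Near the boundary \<open>u s y\<close> is close to \<open>d y\<close>, where \<open>d = 2 / (\<sigma> sqrt (2 \<pi> n)) \<Phi>\<^sup>+(t)\<close> is the slope at \<open>0\<close>
at time \<open>v n\<close>, so the right-hand side is close to \<open>d (x - E (x + S\<^sub>\<tau>)) = d V(x)\<close>.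

Three ingredients control the errors. A concave power \<open>y powr (1 - \<delta> / 2)\<close>, extended suitably to
negative arguments, is superharmonic on the half-line and bounds the overshoot \<open>\<bar>x + S\<^sub>\<tau>\<bar>\<close>, its moment
of order \<open>1 + \<delta> / 2\<close> and its tail in \<open>\<tau>\<close> (\<open>barrier_supermartingale\<close>, \<open>overshoot_total\<close>,
\<open>overshoot_tail\<close>). The replacement method without boundary bounds the concentration of the walk in
intervals (\<open>concentration\<close>). Together they give \<open>P(\<tau> > n) = O((1 + x) / sqrt n)\<close>
(\<open>survival_bound\<close>), by comparing times \<open>n\<close> and \<open>n / 2\<close>. The smoothing time \<open>h\<close>, a power of \<open>n\<close> slightly
below \<open>n\<close>, keeps the accumulated error of the replacement small; it is removed at the end, since by
\<open>concentration\<close> the walk is unlikely to be near the two discontinuities \<open>0\<close> and \<open>T\<close>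
(\<open>smoothing_error\<close>).
\<close>

section \<open>The Gaussian primitive\<close>

text \<open>
The standard normal distribution function, shifted to be odd.
\<close>

definition gauss_int :: "real \<Rightarrow> real" where
  "gauss_int x = cdf std_normal_distribution x - 1 / 2"

abbreviation gauss :: "real \<Rightarrow> real" where
  "gauss \<equiv> std_normal_density"

lemma gauss_nonneg [simp]: "0 \<le> gauss q"
  by (rule normal_density_nonneg)

lemma gauss_minus [simp]: "gauss (- q) = gauss q"
  by (simp add: std_normal_density_def)

lemma gauss_le:
  "gauss q \<le> 1 / (1 + q\<^sup>2 / 4)\<^sup>2"
proof -
  have "1 + q\<^sup>2 / 4 \<le> exp (q\<^sup>2 / 4)"
    by (rule exp_ge_add_one_self)
  then have "(1 + q\<^sup>2 / 4)\<^sup>2 \<le> (exp (q\<^sup>2 / 4))\<^sup>2"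
    by (intro power_mono) (auto intro: add_nonneg_nonneg)
  also have "(exp (q\<^sup>2 / 4))\<^sup>2 = exp (q\<^sup>2 / 2)"
    by (simp add: power2_eq_square flip: exp_add)
  finally have A: "(1 + q\<^sup>2 / 4)\<^sup>2 \<le> exp (q\<^sup>2 / 2)" .
  have pos: "0 < (1 + q\<^sup>2 / 4)\<^sup>2"
    by (intro zero_less_power add_pos_nonneg) auto
  have "sqrt (2 * pi) \<ge> 1"
    using pi_ge_two by (simp add: real_le_rsqrt)
  then have "gauss q \<le> exp (- (q\<^sup>2) / 2)"
    unfolding std_normal_density_def by (auto simp: divide_le_eq mult_le_cancel_right1)
  also have "\<dots> = 1 / exp (q\<^sup>2 / 2)"
    by (simp add: exp_minus field_simps)
  also have "\<dots> \<le> 1 / (1 + q\<^sup>2 / 4)\<^sup>2"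
    using A pos by (intro divide_left_mono) auto
  finally show ?thesis .
qed

lemma poly_gauss_le:
  assumes "\<bar>p\<bar> \<le> c * (1 + q\<^sup>2 / 4)\<^sup>2"
  shows "\<bar>p * gauss q\<bar> \<le> c"
proof -
  have pos: "0 < (1 + q\<^sup>2 / 4)\<^sup>2"
    by (intro zero_less_power add_pos_nonneg) auto
  have c: "0 \<le> c"
    using order_trans[OF abs_ge_zero assms] pos by (simp add: zero_le_mult_iff)
  have "\<bar>p * gauss q\<bar> = \<bar>p\<bar> * gauss q"
    by (simp add: abs_mult)
  also have "\<dots> \<le> (c * (1 + q\<^sup>2 / 4)\<^sup>2) * (1 / (1 + q\<^sup>2 / 4)\<^sup>2)"
    using c by (intro mult_mono assms gauss_le) auto
  also have "\<dots> = c" using pos by auto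
  finally show ?thesis .
qed

lemma gauss_le_1: "gauss q \<le> 1"
proof -
  have "1 \<le> (1 + q\<^sup>2 / 4)\<^sup>2" by (intro one_le_power) auto
  then show ?thesis using poly_gauss_le[of 1 1 q] by auto
qed

lemma gauss_le_0: "gauss q \<le> gauss 0"
  unfolding std_normal_density_def by (auto intro!: divide_right_mono)

lemma gauss_first_deriv_le: "\<bar>q * gauss q\<bar> \<le> 1"
proof (rule poly_gauss_le)
  have "0 \<le> (\<bar>q\<bar> / 2 - 1)\<^sup>2 + q^4 / 16 + q\<^sup>2/4" by auto
  also have "\<dots> = (1 + q\<^sup>2 / 4)\<^sup>2 - \<bar>q\<bar>"
    by (simp add: power2_eq_square power4_eq_xxxx algebra_simps abs_if)
  finally show "\<bar>q\<bar> \<le> 1 * (1 + q\<^sup>2 / 4)\<^sup>2" by simp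
qed

lemma gauss_second_deriv_le: "\<bar>(q\<^sup>2 - 1) * gauss q\<bar> \<le> 4"
proof (rule poly_gauss_le)
  have "\<bar>q\<^sup>2 - 1\<bar> \<le> q\<^sup>2 + 1" by (auto simp: abs_if)
  also have "\<dots> \<le> 4 * (1 + q\<^sup>2 / 4)\<^sup>2"
  proof -
    have "4 * (1 + q\<^sup>2 / 4)\<^sup>2 = 4 + 2 * q\<^sup>2 + (q\<^sup>2)\<^sup>2 / 4"
      by (simp add: power2_eq_square field_simps)
    moreover have "0 \<le> q\<^sup>2" "0 \<le> (q\<^sup>2)\<^sup>2" by auto
    ultimately show ?thesis by linarith
  qed
  finally show "\<bar>q\<^sup>2 - 1\<bar> \<le> 4 * (1 + q\<^sup>2 / 4)\<^sup>2" .
qed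

lemma gauss_square_le: "q\<^sup>2 * gauss q \<le> 2"
proof -
  have "q\<^sup>2 \<le> 2 * (1 + q\<^sup>2 / 4)\<^sup>2"
  proof -
    have "2 * (1 + q\<^sup>2 / 4)\<^sup>2 = 2 + q\<^sup>2 + q^4/8"
      by (simp add: power2_eq_square power4_eq_xxxx algebra_simps)
    then show ?thesis by simp
  qed
  then have "\<bar>q\<^sup>2 * gauss q\<bar> \<le> 2"
    by (intro poly_gauss_le) auto
  then show ?thesis by auto
qed

text \<open>
With \<open>q = y / sqrt s\<close> this bounds the second time derivative of \<open>gauss_int (y / sqrt s)\<close>,
up to the factor \<open>1 / s\<^sup>2\<close>.
\<close>

lemma gauss_time_deriv_le: "\<bar>(3 * q - q ^ 3) / 4 * gauss q\<bar> \<le> 4"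
proof (rule poly_gauss_le)
  define p where "p = \<bar>q\<bar>"
  have p: "0 \<le> p" "q\<^sup>2 = p\<^sup>2" by (auto simp: p_def)
  have "\<bar>(3 * q - q ^ 3) / 4\<bar> \<le> (\<bar>3 * q\<bar> + \<bar>q ^ 3\<bar>) / 4"
    by (simp add: abs_triangle_ineq4 divide_right_mono)
  also have "\<dots> = (3 * p + p ^ 3) / 4"
    by (simp add: p_def abs_mult power_abs)
  also have "\<dots> \<le> 4 * (1 + p\<^sup>2 / 4)\<^sup>2"
  proof -
    have "0 \<le> (p / 2 - 1)\<^sup>2" "0 \<le> p\<^sup>2 * (p / 2 - 1)\<^sup>2" by auto
    moreover have "4 * (1 + p\<^sup>2 / 4)\<^sup>2 - (3 * p + p ^ 3) / 4 = 
      p\<^sup>2 * (p / 2 - 1)\<^sup>2 / 4 + (p / 2 - 1)\<^sup>2 * 3/4 + 13/4 + 25/16 * p\<^sup>2 + p^4/4 - p^4/16"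
      by (simp add: power2_eq_square power3_eq_cube power4_eq_xxxx field_simps)
    moreover have "p^4 \<ge> 0" "p\<^sup>2 \<ge> 0" by auto
    ultimately show ?thesis by linarith
  qed
  finally show "\<bar>(3 * q - q ^ 3) / 4\<bar> \<le> 4 * (1 + q\<^sup>2 / 4)\<^sup>2" using p by simp
qed

lemma DERIV_gauss [derivative_intros]:
  assumes "(f has_real_derivative d) (at x within A)"
  shows "((\<lambda>x. gauss (f x)) has_real_derivative - f x * gauss (f x) * d) (at x within A)"
proof -
  define c where "c = 1 / sqrt (2 * pi)"
  have "((\<lambda>x. c * exp (- x\<^sup>2 / 2)) has_real_derivative - q * (c * exp (- q\<^sup>2 / 2))) (at q)" for q
    by (auto intro!: derivative_eq_intros simp: power2_eq_square)
  moreover have "gauss = (\<lambda>x. c * exp (- x\<^sup>2 / 2))"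
    unfolding std_normal_density_def c_def by (rule refl)
  ultimately have "(gauss has_real_derivative - q * gauss q) (at q)" for q
    by simp
  from DERIV_chain2[OF this assms] show ?thesis .
qed

lemma DERIV_gauss_int [derivative_intros]:
  assumes "(f has_real_derivative d) (at x within A)"
  shows "((\<lambda>x. gauss_int (f x)) has_real_derivative gauss (f x) * d) (at x within A)"
proof -
  interpret N: real_distribution std_normal_distribution
    by (rule real_dist_normal_dist)
  have "isCont gauss x" for x
    unfolding std_normal_density_def by (intro continuous_intros) auto
  \<comment> \<open>The distribution function differs from any antiderivative of the density by a constant.\<close>
  then obtain F where F: "\<And>x. (F has_vector_derivative gauss x) (at x)"
    using einterval_antiderivative[of "-\<infinity>" "\<infinity>" gauss] by auto
  have *: "cdf std_normal_distribution b - cdf std_normal_distribution a = F b - F a" if "a < b" for a b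
  proof -
    have cont: "continuous_on {a..b} gauss"
      unfolding std_normal_density_def by (intro continuous_intros) auto
    have "emeasure std_normal_distribution {a<..b} = 
            (\<integral>\<^sup>+x. ennreal (gauss x) * indicator {a<..b} x \<partial>lborel)"
      by (subst emeasure_density) auto
    also have "\<dots> = (\<integral>\<^sup>+x. ennreal (gauss x) * indicator {a..b} x \<partial>lborel)"
      by (intro nn_integral_cong_AE AE_I[where N="{a}"]) (auto simp: indicator_def)
    also have "\<dots> = F b - F a"
      using that F[unfolded has_real_derivative_iff_has_vector_derivative[symmetric]]
      by (intro nn_integral_FTC_Icc) (auto intro: DERIV_subset has_field_derivative_at_within)
    finally have "emeasure std_normal_distribution {a<..b} = F b - F a" .
    moreover have "F a \<le> F b"
      using that F[unfolded has_real_derivative_iff_has_vector_derivative[symmetric]]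
      by (intro DERIV_nonneg_imp_nondecreasing[of a b F]) (auto intro!: exI[of _ "gauss _"])
    ultimately have "measure std_normal_distribution {a<..b} = F b - F a"
      by (simp add: measure_def)
    then show ?thesis using N.cdf_diff_eq[OF that] by simp
  qed
  have "gauss_int = (\<lambda>x. F x - F 0 + gauss_int 0)"
  proof
    fix x show "gauss_int x = F x - F 0 + gauss_int 0"
      using *[of 0 x] *[of x 0] unfolding gauss_int_def
      by (cases x "0::real" rule: linorder_cases) auto
  qed
  moreover have "((\<lambda>x. F x - F 0 + gauss_int 0) has_real_derivative gauss q) (at q)" for q
    using F[of q] unfolding has_real_derivative_iff_has_vector_derivative[symmetric]
    by (auto intro!: derivative_eq_intros)
  ultimately have "(gauss_int has_real_derivative gauss q) (at q)" for q
    by metis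
  from DERIV_chain2[OF this assms] show ?thesis .
qed

lemma isCont_gauss_int: "isCont gauss_int x"
  using DERIV_gauss_int[OF DERIV_ident, of x UNIV] DERIV_isCont by blast

lemma borel_measurable_gauss_int [measurable]: "gauss_int \<in> borel_measurable borel"
  by (intro borel_measurable_continuous_onI continuous_at_imp_continuous_on ballI isCont_gauss_int)

lemma gauss_int_lim: "(gauss_int \<longlongrightarrow> 1 / 2) at_top" "(gauss_int \<longlongrightarrow> - 1 / 2) at_bot"
proof -
  interpret N: real_distribution std_normal_distribution
    by (rule real_dist_normal_dist)
  show "(gauss_int \<longlongrightarrow> 1 / 2) at_top"
    unfolding gauss_int_def[abs_def]
    by (rule tendsto_eq_rhs[OF tendsto_diff[OF N.cdf_lim_at_top_prob tendsto_const]]) auto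
  show "(gauss_int \<longlongrightarrow> - 1 / 2) at_bot"
    unfolding gauss_int_def[abs_def]
    by (rule tendsto_eq_rhs[OF tendsto_diff[OF N.cdf_lim_at_bot tendsto_const]]) auto
qed

lemma gauss_int_minus: "gauss_int (- x) = - gauss_int x"
proof -
  let ?g = "\<lambda>x. gauss_int x + gauss_int (- x)"
  have "DERIV ?g x :> 0" for x
    by (auto intro!: derivative_eq_intros)
  then have c: "?g x = ?g 0" for x by (metis DERIV_isconst_all)
  have "((\<lambda>x. gauss_int (- x)) \<longlongrightarrow> - 1 / 2) at_top"
    using gauss_int_lim(2) by (simp add: filterlim_at_bot_mirror)
  from tendsto_add[OF gauss_int_lim(1) this] have "(?g \<longlongrightarrow> 0) at_top"
    by simp
  moreover have "(?g \<longlongrightarrow> ?g 0) at_top"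
    by (subst c) auto
  ultimately have "?g 0 = 0"
    using tendsto_unique trivial_limit_at_top_linorder by blast
  with c[of x] show ?thesis by simp
qed

lemma gauss_int_0 [simp]: "gauss_int 0 = 0"
  using gauss_int_minus[of 0] by simp

lemma gauss_int_abs_le: "\<bar>gauss_int x\<bar> \<le> 1 / 2"
proof -
  interpret N: real_distribution std_normal_distribution
    by (rule real_dist_normal_dist)
  show ?thesis unfolding gauss_int_def
    using N.cdf_bounded_prob[of x] N.cdf_nonneg[of x] by (auto simp: abs_if)
qed

lemma gauss_int_tail:
  assumes "q > 0"
  shows "\<bar>gauss_int q - 1 / 2\<bar> \<le> 2 / q"
proof -
  \<comment> \<open>The function \<open>x \<mapsto> gauss_int x + 2 / x\<close> decreases to \<open>1 / 2\<close>.\<close>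
  have "gauss_int x + 2 / x \<le> gauss_int q + 2 / q" if "q \<le> x" for x
  proof (rule DERIV_nonpos_imp_nonincreasing[OF that])
    fix y assume y: "q \<le> y" "y \<le> x"
    have "((\<lambda>y. gauss_int y + 2 / y) has_real_derivative gauss y - 2 / y\<^sup>2) (at y)"
      using y assms by (auto intro!: derivative_eq_intros simp: power2_eq_square)
    moreover have "gauss y - 2 / y\<^sup>2 \<le> 0"
      using gauss_square_le[of y] y assms by (simp add: field_simps)
    ultimately show "\<exists>d. ((\<lambda>y. gauss_int y + 2 / y) has_real_derivative d) (at y) \<and> d \<le> 0"
      by blast
  qed
  then have ev: "eventually (\<lambda>x. gauss_int x + 2 / x \<le> gauss_int q + 2 / q) at_top"
    by (rule eventually_mono[OF eventually_ge_at_top[of q]])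
  have "((\<lambda>x. gauss_int x + 2 / x) \<longlongrightarrow> 1 / 2 + 0) at_top"
    by (intro tendsto_add gauss_int_lim real_tendsto_divide_at_top[OF tendsto_const filterlim_ident])
  from tendsto_upperbound[OF this ev] have "1 / 2 \<le> gauss_int q + 2 / q" by simp
  moreover have "gauss_int q \<le> 1 / 2" using gauss_int_abs_le[of q] by auto
  ultimately show ?thesis by auto
qed

lemma gauss_int_lipschitz: "\<bar>gauss_int x - gauss_int y\<bar> \<le> \<bar>x - y\<bar>"
proof -
  have "norm (gauss_int x - gauss_int y) \<le> 1 * norm (x - y)"
    by (rule field_differentiable_bound[where S=UNIV and f'=gauss])
       (auto intro!: derivative_eq_intros gauss_le_1)
  then show ?thesis by simp
qed

lemma gauss_int_mono: "x \<le> y \<Longrightarrow> gauss_int x \<le> gauss_int y"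
  by (rule DERIV_nonneg_imp_nondecreasing[where f=gauss_int])
     (auto intro!: derivative_eq_intros exI[of _ "gauss _"])

lemma gauss_int_1_pos: "0 < gauss_int 1"
proof -
  have "gauss_int 0 < gauss_int 1"
  proof (rule DERIV_pos_imp_increasing[where f=gauss_int])
    fix x :: real assume "0 \<le> x" "x \<le> 1"
    have "0 < gauss x" by (simp add: normal_density_pos)
    then show "\<exists>y. (gauss_int has_real_derivative y) (at x) \<and> 0 < y"
      by (auto intro!: derivative_eq_intros exI[of _ "gauss x"])
  qed simp
  then show ?thesis by simp
qed

lemma gauss_taylor2: "\<bar>gauss_int (q + z) - gauss_int q - z * gauss q\<bar> \<le> z\<^sup>2"
proof -
  let ?f = "\<lambda>i q. case i of 0 \<Rightarrow> gauss_int q | Suc 0 \<Rightarrow> gauss q 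
    | _ \<Rightarrow> - q * gauss q"
  have "norm (?f 0 (q + z) - (\<Sum>i\<le>1. ?f i q * (q + z - q) ^ i / fact i))
     \<le> 1 * norm (q + z - q) ^ Suc 1 / fact 1"
  proof (rule field_Taylor)
    fix i x assume "i \<le> (1::nat)"
    then consider "i = 0" | "i = 1" by linarith
    then show "(?f i has_real_derivative ?f (Suc i) x) (at x within UNIV)"
      by cases (auto intro!: derivative_eq_intros)
  qed (use gauss_first_deriv_le in auto)
  then show ?thesis by (simp add: power2_eq_square algebra_simps)
qed

lemma gauss_taylor3: 
  "\<bar>gauss_int (q + z) - gauss_int q - z * gauss q + z\<^sup>2 / 2 * (q * gauss q)\<bar> \<le> 2 * \<bar>z\<bar> ^ 3"
proof -
  let ?f = "\<lambda>i q. case i of 0 \<Rightarrow> gauss_int q | Suc 0 \<Rightarrow> gauss q 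
    | Suc (Suc 0) \<Rightarrow> - q * gauss q | _ \<Rightarrow> (q\<^sup>2 - 1) * gauss q"
  have "norm (?f 0 (q + z) - (\<Sum>i\<le>2. ?f i q * (q + z - q) ^ i / fact i))
     \<le> 4 * norm (q + z - q) ^ Suc 2 / fact 2"
  proof (rule field_Taylor)
    fix i x assume "i \<le> (2::nat)"
    then consider "i = 0" | "i = 1" | "i = 2" by linarith
    then show "(?f i has_real_derivative ?f (Suc i) x) (at x within UNIV)"
      by cases (auto intro!: derivative_eq_intros simp: numeral_2_eq_2 algebra_simps power2_eq_square)
  qed (use gauss_second_deriv_le in \<open>auto simp: numeral_2_eq_2\<close>)
  then show ?thesis by (simp add: numeral_2_eq_2 power3_eq_cube power_abs algebra_simps)
qed

section \<open>Heat flow on the line\<close>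

text \<open>
The solution of \<open>\<partial>\<^sub>s u = \<partial>\<^sub>y\<^sub>y u / 2\<close> that starts from half the sign function.
\<close>

definition heat :: "real \<Rightarrow> real \<Rightarrow> real" where
  "heat s y = gauss_int (y / sqrt s)"

lemma heat_abs_le: "\<bar>heat s y\<bar> \<le> 1 / 2"
  unfolding heat_def by (rule gauss_int_abs_le)

lemma borel_measurable_heat [measurable]: "heat s \<in> borel_measurable borel"
  unfolding heat_def[abs_def] by measurable

lemma heat_lipschitz:
  assumes "0 < s" shows "\<bar>heat s x - heat s y\<bar> \<le> \<bar>x - y\<bar> / sqrt s"
proof -
  have "\<bar>x / sqrt s - y / sqrt s\<bar> = \<bar>x - y\<bar> / sqrt s"
    using assms by (simp flip: diff_divide_distrib)
  then show ?thesis using gauss_int_lipschitz[of "x / sqrt s" "y / sqrt s"] unfolding heat_def by simp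
qed

lemma heat_mono: "0 < s \<Longrightarrow> x \<le> y \<Longrightarrow> heat s x \<le> heat s y"
  unfolding heat_def by (intro gauss_int_mono divide_right_mono) auto

lemma heat_bump_ge:
  assumes "0 < a" "\<bar>y\<bar> \<le> a"
  shows "gauss_int 1 \<le> heat (a\<^sup>2) (y + a) - heat (a\<^sup>2) (y - a)"
proof -
  define q where "q = y / a"
  have eq: "heat (a\<^sup>2) (y + a) - heat (a\<^sup>2) (y - a) = gauss_int (q + 1) - gauss_int (q - 1)"
    using assms by (simp add: heat_def q_def add_divide_distrib diff_divide_distrib)
  have q: "-1 \<le> q" "q \<le> 1" using assms by (auto simp: q_def field_simps abs_le_iff)
  show ?thesis
  proof (cases "0 \<le> q")
    case True
    then have "gauss_int 1 \<le> gauss_int (q + 1)" "gauss_int (q - 1) \<le> gauss_int 0"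
      using q by (intro gauss_int_mono; simp)+
    then show ?thesis unfolding eq by simp
  next
    case False
    then have "gauss_int 0 \<le> gauss_int (q + 1)" "gauss_int (q - 1) \<le> gauss_int (- 1)"
      using q by (intro gauss_int_mono; simp)+
    then show ?thesis unfolding eq by (simp add: gauss_int_minus)
  qed
qed

lemma heat_time_taylor:
  assumes "0 < s" "s \<le> t"
  shows "\<bar>heat t y - heat s y + (t - s) / (2 * s) * (y / sqrt s * gauss (y / sqrt s))\<bar>
           \<le> 4 * (t - s)\<^sup>2 / s\<^sup>2"
proof -
  let ?q = "\<lambda>t. y / sqrt t"
  let ?f = "\<lambda>i t. case i of 0 \<Rightarrow> gauss_int (?q t) | Suc 0 \<Rightarrow> - (?q t) * gauss (?q t) / (2 * t)
    | _ \<Rightarrow> (3 * ?q t - ?q t ^ 3) / 4 * gauss (?q t) / t\<^sup>2"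
  have dq: "(?q has_real_derivative - ?q t / (2 * t)) (at t within A)" if "0 < t" for t A
    using that by (auto intro!: derivative_eq_intros simp: field_simps)
  have "norm (?f 0 t - (\<Sum>i\<le>1. ?f i s * (t - s) ^ i / fact i)) \<le> (4 / s\<^sup>2) * norm (t - s) ^ Suc 1 / fact 1"
  proof (rule field_Taylor[where S="{s..t}"])
    fix i x assume x: "x \<in> {s..t}" and "i \<le> (1::nat)"
    then consider "i = 0" | "i = 1" by linarith
    then show "(?f i has_real_derivative ?f (Suc i) x) (at x within {s..t})"
    proof cases
      case 1
      then show ?thesis using x assms by (auto intro!: derivative_eq_intros dq simp: field_simps)
    next
      case 2
      define Q where "Q = ?q"
      define q where "q = Q x"
      have dQ: "(Q has_real_derivative - q / (2 * x)) (at x within {s..t})"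
        unfolding Q_def q_def using x assms by (intro dq) auto
      have "((\<lambda>t. - Q t * gauss (Q t) / (2 * t)) has_real_derivative
         (((q / (2 * x)) * gauss q + (- q) * (- q * gauss q * (- q / (2 * x)))) * (2 * x)
            - (- q * gauss q) * 2) / ((2 * x) * (2 * x))) (at x within {s..t})"
        using x assms by (auto intro!: derivative_eq_intros dQ simp: field_simps simp flip: q_def)
      also have "(((q / (2 * x)) * gauss q + (- q) * (- q * gauss q * (- q / (2 * x)))) * (2 * x)
            - (- q * gauss q) * 2) / ((2 * x) * (2 * x)) = (3 * q - q ^ 3) / 4 * gauss q / x\<^sup>2"
        using x assms by (simp add: field_simps power2_eq_square power3_eq_cube)
      finally show ?thesis using 2 by (simp add: q_def Q_def)
    qed
  next
    fix x assume x: "x \<in> {s..t}"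
    have "norm (?f (Suc 1) x) = \<bar>(3 * ?q x - ?q x ^ 3) / 4 * gauss (?q x)\<bar> / x\<^sup>2"
      by (simp add: abs_mult)
    also have "\<dots> \<le> 4 / x\<^sup>2"
      by (intro divide_right_mono gauss_time_deriv_le) auto
    also have "\<dots> \<le> 4 / s\<^sup>2"
      using x assms by (intro divide_left_mono power_mono) auto
    finally show "norm (?f (Suc 1) x) \<le> 4 / s\<^sup>2" .
  qed (use assms in auto)
  then have "\<bar>heat t y - heat s y - (- (?q s) * gauss (?q s) / (2 * s)) * (t - s)\<bar> \<le> 4 / s\<^sup>2 * (t - s)\<^sup>2"
    by (simp add: heat_def power2_eq_square diff_diff_eq2[symmetric] diff_diff_eq)
  moreover have "- (- (?q s) * gauss (?q s) / (2 * s)) * (t - s) = 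
      (t - s) / (2 * s) * (?q s * gauss (?q s))"
    by (simp add: ac_simps)
  ultimately show ?thesis by (simp add: mult.commute)
qed

lemma powr_interpolate:
  fixes q a b p R c :: real
  assumes "0 \<le> q" "0 \<le> c" "a \<le> p" "p \<le> b" "R \<le> c * q powr a" "R \<le> c * q powr b"
  shows "R \<le> c * q powr p"
proof (cases "1 \<le> q")
  case True
  then have "c * q powr a \<le> c * q powr p" using assms by (intro mult_left_mono powr_mono) auto
  with assms show ?thesis by linarith
next
  case False
  then have "c * q powr b \<le> c * q powr p" using assms by (intro mult_left_mono powr_mono') auto
  with assms show ?thesis by linarith
qed

lemma heat_space_taylor:
  assumes "0 < s" "0 < \<delta>" "\<delta> \<le> 1"
  shows "\<bar>heat s (y + \<xi>) - heat s y - \<xi> / sqrt s * gauss (y / sqrt s)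
           + \<xi>\<^sup>2 / (2 * s) * (y / sqrt s * gauss (y / sqrt s))\<bar>
           \<le> 2 * \<bar>\<xi>\<bar> powr (2 + \<delta>) * s powr (- 1 - \<delta> / 2)"
proof -
  define q z where "q = y / sqrt s" and "z = \<xi> / sqrt s"
  define R where "R = gauss_int (q + z) - gauss_int q - z * gauss q + z\<^sup>2 / 2 * (q * gauss q)"
  \<comment> \<open>The second- and third-order Taylor bounds are interpolated, so that only \<open>2 + \<delta>\<close> moments are needed.\<close>
  have R3: "\<bar>R\<bar> \<le> 2 * \<bar>z\<bar> ^ 3" unfolding R_def by (rule gauss_taylor3)
  have "\<bar>R\<bar> \<le> \<bar>gauss_int (q + z) - gauss_int q - z * gauss q\<bar> + \<bar>z\<^sup>2 / 2 * (q * gauss q)\<bar>"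
    unfolding R_def by (rule abs_triangle_ineq)
  also have "\<bar>z\<^sup>2 / 2 * (q * gauss q)\<bar> \<le> z\<^sup>2 / 2 * 1"
    unfolding abs_mult[of "z\<^sup>2 / 2"] by (intro mult_mono gauss_first_deriv_le) auto
  finally have R2: "\<bar>R\<bar> \<le> 2 * \<bar>z\<bar> ^ 2" using gauss_taylor2[of q z] zero_le_power2[of z] by simp
  have "\<bar>R\<bar> \<le> 2 * \<bar>z\<bar> powr (2 + \<delta>)"
    by (rule powr_interpolate[where a=2 and b=3]) (use R2 R3 assms in auto)
  also have "\<bar>z\<bar> powr (2 + \<delta>) = \<bar>\<xi>\<bar> powr (2 + \<delta>) * s powr (- 1 - \<delta> / 2)"
  proof -
    have "\<bar>z\<bar> = \<bar>\<xi>\<bar> * s powr (- 1 / 2)"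
      using assms by (simp add: z_def powr_minus_divide powr_half_sqrt)
    then have "\<bar>z\<bar> powr (2 + \<delta>) = \<bar>\<xi>\<bar> powr (2 + \<delta>) * (s powr (- 1 / 2)) powr (2 + \<delta>)"
      by (simp add: powr_mult)
    also have "(s powr (- 1 / 2)) powr (2 + \<delta>) = s powr (- 1 - \<delta> / 2)"
      unfolding powr_powr by (rule arg_cong[where f="(powr) s"]) (simp add: field_simps)
    finally show ?thesis .
  qed
  finally show ?thesis
    using assms unfolding R_def q_def z_def heat_def by (simp add: add_divide_distrib power_divide)
qed

text \<open>
Moving by \<open>\<xi>\<close> in space agrees with moving by \<open>v\<close> in time, up to a term linear in \<open>\<xi>\<close>, a multiple of
\<open>\<xi>\<^sup>2 - v\<close>, and a remainder that is summable in \<open>s\<close>.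
\<close>

lemma heat_step_pointwise:
  assumes "1 \<le> s" "0 < \<delta>" "\<delta> \<le> 1" "0 < v"
  shows "\<bar>heat s (y + \<xi>) - heat (s + v) y - \<xi> / sqrt s * gauss (y / sqrt s)
           + (\<xi>\<^sup>2 - v) / (2 * s) * (y / sqrt s * gauss (y / sqrt s))\<bar>
           \<le> (2 * \<bar>\<xi>\<bar> powr (2 + \<delta>) + 4 * v\<^sup>2) * s powr (- 1 - \<delta> / 2)"
proof -
  define g where "g = y / sqrt s * gauss (y / sqrt s)"
  have "4 * v\<^sup>2 / s\<^sup>2 = 4 * v\<^sup>2 * s powr (- 2)"
    using assms by (simp add: powr_minus_divide powr_numeral)
  also have "\<dots> \<le> 4 * v\<^sup>2 * s powr (- 1 - \<delta> / 2)"
    using assms by (intro mult_left_mono powr_mono) auto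
  finally have *: "4 * v\<^sup>2 / s\<^sup>2 \<le> 4 * v\<^sup>2 * s powr (- 1 - \<delta> / 2)" .
  have "\<bar>heat (s + v) y - heat s y + v / (2 * s) * g\<bar> \<le> 4 * v\<^sup>2 * s powr (- 1 - \<delta> / 2)"
    using heat_time_taylor[of s "s + v" y] * assms unfolding g_def by simp
  moreover have "\<bar>heat s (y + \<xi>) - heat s y - \<xi> / sqrt s * gauss (y / sqrt s)
           + \<xi>\<^sup>2 / (2 * s) * g\<bar> \<le> 2 * \<bar>\<xi>\<bar> powr (2 + \<delta>) * s powr (- 1 - \<delta> / 2)"
    unfolding g_def using assms by (intro heat_space_taylor) auto
  moreover have "(\<xi>\<^sup>2 - v) / (2 * s) * g = \<xi>\<^sup>2 / (2 * s) * g - v / (2 * s) * g"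
    by (simp add: diff_divide_distrib algebra_simps)
  ultimately show ?thesis
    unfolding distrib_right g_def[symmetric] by linarith
qed

section \<open>Heat flow on the half-line\<close>

text \<open>
The solution of the heat equation that starts from the odd extension of the indicator of \<open>[0, T]\<close>,
and its space derivative at \<open>0\<close>.
\<close>

definition strip :: "real \<Rightarrow> real \<Rightarrow> real \<Rightarrow> real" where
  "strip T s y = 2 * heat s y - heat s (y - T) - heat s (y + T)"

definition strip_slope :: "real \<Rightarrow> real \<Rightarrow> real" where
  "strip_slope T s = 2 * (gauss 0 - gauss (T / sqrt s)) / sqrt s"

lemma strip_abs_le: "\<bar>strip T s y\<bar> \<le> 2"
  using heat_abs_le[of s y] heat_abs_le[of s "y - T"] heat_abs_le[of s "y + T"]
  unfolding strip_def by linarith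

lemma borel_measurable_strip [measurable]: "strip T s \<in> borel_measurable borel"
  unfolding strip_def[abs_def] by measurable

lemma strip_slope_bounds:
  assumes "0 < s"
  shows "0 \<le> strip_slope T s" "strip_slope T s \<le> 2 / sqrt s"
proof -
  have "0 \<le> gauss 0 - gauss (T / sqrt s)"
    using gauss_le_0 by simp
  moreover have "gauss 0 - gauss (T / sqrt s) \<le> 1"
    using gauss_le_1[of 0] gauss_nonneg[of "T / sqrt s"] by linarith
  ultimately show "0 \<le> strip_slope T s" "strip_slope T s \<le> 2 / sqrt s"
    unfolding strip_slope_def using assms by (auto intro!: divide_right_mono)
qed

lemma strip_lipschitz:
  assumes "0 < s"
  shows "\<bar>strip T s y\<bar> \<le> 4 * \<bar>y\<bar> / sqrt s"
proof -
  define q \<theta> where "q = y / sqrt s" and "\<theta> = T / sqrt s"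
  have eq: "strip T s y = 2 * (gauss_int q - gauss_int 0) - (gauss_int (q - \<theta>) - gauss_int (- \<theta>))
      - (gauss_int (q + \<theta>) - gauss_int \<theta>)"
    by (simp add: strip_def heat_def q_def \<theta>_def add_divide_distrib diff_divide_distrib gauss_int_minus)
  have "\<bar>strip T s y\<bar> \<le> 4 * \<bar>q\<bar>"
    unfolding eq using gauss_int_lipschitz[of q 0] gauss_int_lipschitz[of "q - \<theta>" "- \<theta>"]
      gauss_int_lipschitz[of "q + \<theta>" \<theta>] by (simp add: abs_if split: if_splits)
  then show ?thesis using assms by (simp add: q_def)
qed

lemma strip_cubic:
  assumes "0 < s"
  shows "\<bar>strip T s y - y * strip_slope T s\<bar> \<le> 8 * (\<bar>y\<bar> / sqrt s) ^ 3"
proof -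
  define q \<theta> where "q = y / sqrt s" and "\<theta> = T / sqrt s"
  \<comment> \<open>The second-order terms cancel because the function is odd.\<close>
  have eq: "strip T s y - y * strip_slope T s = 
      2 * (gauss_int q - q * gauss 0) 
      - (gauss_int (q - \<theta>) - gauss_int (- \<theta>) - q * gauss \<theta> - q\<^sup>2 / 2 * (\<theta> * gauss \<theta>))
      - (gauss_int (q + \<theta>) - gauss_int \<theta> - q * gauss \<theta> + q\<^sup>2 / 2 * (\<theta> * gauss \<theta>))"
    by (simp add: strip_def strip_slope_def heat_def q_def \<theta>_def add_divide_distrib diff_divide_distrib 
        gauss_int_minus algebra_simps)
  have "\<bar>gauss_int q - q * gauss 0\<bar> \<le> 2 * \<bar>q\<bar> ^ 3"
    using gauss_taylor3[of 0 q] by simp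
  moreover have "\<bar>gauss_int (q - \<theta>) - gauss_int (- \<theta>) - q * gauss \<theta> - q\<^sup>2 / 2 * (\<theta> * gauss \<theta>)\<bar> \<le> 2 * \<bar>q\<bar> ^ 3"
    using gauss_taylor3[of "- \<theta>" q] by simp
  moreover have "\<bar>gauss_int (q + \<theta>) - gauss_int \<theta> - q * gauss \<theta> + q\<^sup>2 / 2 * (\<theta> * gauss \<theta>)\<bar> \<le> 2 * \<bar>q\<bar> ^ 3"
    using gauss_taylor3[of \<theta> q] by (simp add: add.commute)
  moreover have "\<bar>2 * A - B - C\<bar> \<le> 8 * k" if "\<bar>A\<bar> \<le> 2 * k" "\<bar>B\<bar> \<le> 2 * k" "\<bar>C\<bar> \<le> 2 * k" for A B C k :: real
    using that by linarith
  ultimately have "\<bar>strip T s y - y * strip_slope T s\<bar> \<le> 8 * \<bar>q\<bar> ^ 3"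
    unfolding eq by blast
  then show ?thesis using assms by (simp add: q_def)
qed

text \<open>
The exponent \<open>1 + \<beta>\<close> is chosen later to match the available moment of the overshoot.
\<close>

lemma strip_linearization:
  assumes s: "0 < s" and \<beta>: "0 \<le> \<beta>" "\<beta> \<le> 2"
  shows "\<bar>strip T s y - y * strip_slope T s\<bar> \<le> 8 * \<bar>y\<bar> powr (1 + \<beta>) * s powr (- ((1 + \<beta>) / 2))"
proof -
  define q where "q = \<bar>y\<bar> / sqrt s"
  let ?R = "\<bar>strip T s y - y * strip_slope T s\<bar>"
  have q: "0 \<le> q" using s by (simp add: q_def)
  \<comment> \<open>Near \<open>0\<close> the cubic bound is better, far away the Lipschitz bound is.\<close>
  have R3: "?R \<le> 8 * q ^ 3" unfolding q_def by (rule strip_cubic[OF s])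
  have "\<bar>y * strip_slope T s\<bar> \<le> \<bar>y\<bar> * (2 / sqrt s)"
    unfolding abs_mult using strip_slope_bounds[OF s, of T] by (intro mult_left_mono) auto
  then have "\<bar>y * strip_slope T s\<bar> \<le> 2 * q" unfolding q_def by (simp add: mult.commute)
  moreover have "\<bar>strip T s y\<bar> \<le> 4 * q"
    using strip_lipschitz[OF s, of T y] unfolding q_def by simp
  ultimately have R1: "?R \<le> 8 * q" using q by linarith
  have "?R \<le> 8 * q powr (1 + \<beta>)"
    by (rule powr_interpolate[where a=1 and b=3]) (use R1 R3 q \<beta> in auto)
  also have "q = \<bar>y\<bar> * s powr (- 1 / 2)"
    using s by (simp add: q_def powr_minus_divide powr_half_sqrt)
  finally show ?thesis by (simp add: powr_mult powr_powr)
qed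

lemma strip_slope_diff:
  assumes "0 < s" "s \<le> t"
  shows "\<bar>strip_slope T t - strip_slope T s\<bar> \<le> 3 * (t - s) / (s * sqrt s)"
proof -
  let ?f' = "\<lambda>u. - (gauss 0 - gauss (T / sqrt u) + (T / sqrt u)\<^sup>2 * gauss (T / sqrt u)) / (u * sqrt u)"
  have "norm (strip_slope T t - strip_slope T s) \<le> 3 / (s * sqrt s) * norm (t - s)"
  proof (rule field_differentiable_bound[where S="{s..t}" and f'="?f'"])
    fix u assume u: "u \<in> {s..t}"
    then have u0: "0 < u" using assms by auto
    define \<theta> where "\<theta> = T / sqrt u"
    have dq: "((\<lambda>t. T / sqrt t) has_real_derivative - \<theta> / (2 * u)) (at u within {s..t})"
      unfolding \<theta>_def using u0 by (auto intro!: derivative_eq_intros simp: field_simps)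
    have "((\<lambda>t. 2 * (gauss 0 - gauss (T / sqrt t)) / sqrt t) has_real_derivative
        (2 * (- (- \<theta> * gauss \<theta> * (- \<theta> / (2 * u)))) * sqrt u - 2 * (gauss 0 - gauss \<theta>) * (inverse (sqrt u) / 2)) / (sqrt u * sqrt u)) (at u within {s..t})"
      unfolding \<theta>_def using u0 by (auto intro!: derivative_eq_intros dq[unfolded \<theta>_def] simp: field_simps)
    also have "(2 * (- (- \<theta> * gauss \<theta> * (- \<theta> / (2 * u)))) * sqrt u - 2 * (gauss 0 - gauss \<theta>) * (inverse (sqrt u) / 2)) / (sqrt u * sqrt u)
       = - (gauss 0 - gauss \<theta> + \<theta>\<^sup>2 * gauss \<theta>) / (u * sqrt u)"
    proof -
      define r where "r = sqrt u"
      have r: "r > 0" "u = r * r" using u0 by (auto simp: r_def)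
      show ?thesis using r(1) unfolding r_def[symmetric] r(2)
        by (simp add: field_simps power2_eq_square)
    qed
    finally show "(strip_slope T has_real_derivative ?f' u) (at u within {s..t})"
      unfolding strip_slope_def[abs_def] \<theta>_def .
    have "0 \<le> \<theta>\<^sup>2 * gauss \<theta>" by simp
    then have "\<bar>- (gauss 0 - gauss \<theta> + \<theta>\<^sup>2 * gauss \<theta>)\<bar> \<le> 3"
      using gauss_square_le[of \<theta>] gauss_le_1[of 0] gauss_nonneg[of \<theta>] gauss_le_0[of \<theta>]
      unfolding abs_le_iff by linarith
    moreover have "s * sqrt s \<le> u * sqrt u"
      using u assms by (intro mult_mono) auto
    ultimately have "\<bar>- (gauss 0 - gauss \<theta> + \<theta>\<^sup>2 * gauss \<theta>)\<bar> / (u * sqrt u) \<le> 3 / (s * sqrt s)"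
      using assms by (intro frac_le) auto
    then show "norm (?f' u) \<le> 3 / (s * sqrt s)"
      unfolding \<theta>_def[symmetric] using u0 by (simp only: real_norm_def abs_divide abs_mult abs_of_pos real_sqrt_gt_zero)
  qed (use assms in auto)
  then show ?thesis using assms by simp
qed

lemma strip_slope_lipschitz:
  assumes "0 < b" "b \<le> s" "b \<le> t"
  shows "\<bar>strip_slope T s - strip_slope T t\<bar> \<le> 3 * \<bar>s - t\<bar> / (b * sqrt b)"
proof -
  have *: "\<bar>strip_slope T s - strip_slope T t\<bar> \<le> 3 * \<bar>s - t\<bar> / (b * sqrt b)" if "b \<le> s" "s \<le> t" for s t
  proof -
    have "\<bar>strip_slope T s - strip_slope T t\<bar> \<le> 3 * (t - s) / (s * sqrt s)"
      using strip_slope_diff[of s t T] that assms by (simp add: abs_minus_commute)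
    also have "\<dots> \<le> 3 * (t - s) / (b * sqrt b)"
      using that assms by (intro divide_left_mono mult_mono mult_pos_pos) auto
    finally show ?thesis using that by simp
  qed
  show ?thesis
  proof (cases "s \<le> t")
    case True then show ?thesis using * assms by simp
  next
    case False then show ?thesis using *[of t s] assms by (simp add: abs_minus_commute)
  qed
qed

lemma strip_near_indicator:
  assumes "0 < s" "0 < a" "0 \<le> T" "a \<le> y" "a \<le> \<bar>y - T\<bar>"
  shows "\<bar>strip T s y - indicator {..T} y\<bar> \<le> 8 * sqrt s / a"
proof -
  have tail: "\<bar>heat s z - 1 / 2\<bar> \<le> 2 * sqrt s / a" if "a \<le> z" for z
  proof -
    have "\<bar>heat s z - 1 / 2\<bar> \<le> 2 / (z / sqrt s)"
      unfolding heat_def using that assms by (intro gauss_int_tail) auto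
    also have "\<dots> = 2 * sqrt s / z" by simp
    also have "\<dots> \<le> 2 * sqrt s / a" using that assms by (intro divide_left_mono) auto
    finally show ?thesis .
  qed
  have odd: "heat s (- z) = - heat s z" for z
    by (simp add: heat_def gauss_int_minus)
  have 1: "\<bar>heat s y - 1 / 2\<bar> \<le> 2 * sqrt s / a" "\<bar>heat s (y + T) - 1 / 2\<bar> \<le> 2 * sqrt s / a"
    using assms by (auto intro!: tail)
  have b: "c * sqrt s / a = c * (sqrt s / a)" for c by simp
  show ?thesis
  proof (cases "y \<le> T")
    case True
    then have "\<bar>heat s (T - y) - 1 / 2\<bar> \<le> 2 * sqrt s / a" using assms by (intro tail) auto
    then have "\<bar>heat s (y - T) + 1 / 2\<bar> \<le> 2 * sqrt s / a" using odd[of "T - y"] by simp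
    then show ?thesis using 1 True unfolding strip_def b abs_le_iff by (simp del: times_divide_eq_right)
  next
    case False
    then have "\<bar>heat s (y - T) - 1 / 2\<bar> \<le> 2 * sqrt s / a" using assms by (intro tail) auto
    then show ?thesis using 1 False unfolding strip_def b abs_le_iff by (simp del: times_divide_eq_right)
  qed
qed

text \<open>
At time \<open>\<sigma>\<^sup>2 n\<close> the boundary slope is the normalising factor in front of \<open>V\<close> in the limit theorem.
\<close>

lemma strip_slope_rayleigh:
  assumes "0 < \<sigma>" "0 \<le> t" "1 \<le> n"
  shows "strip_slope (t * (\<sigma> * sqrt (real n))) (\<sigma>\<^sup>2 * real n) = 2 / (\<sigma> * sqrt (2 * pi * real n)) * rayleigh_cdf t"
proof -
  have s: "sqrt (\<sigma>\<^sup>2 * real n) = \<sigma> * sqrt (real n)" "0 < \<sigma> * sqrt (real n)"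
    using assms by (auto simp: real_sqrt_mult)
  then have "t * (\<sigma> * sqrt (real n)) / sqrt (\<sigma>\<^sup>2 * real n) = t" using assms by simp
  moreover have "gauss 0 - gauss t = rayleigh_cdf t / sqrt (2 * pi)"
    using assms by (simp add: std_normal_density_def rayleigh_cdf_def diff_divide_distrib)
  ultimately show ?thesis
    unfolding strip_slope_def s(1) by (simp add: real_sqrt_mult)
qed

section \<open>A concave barrier\<close>

lemma one_plus_powr_le:
  fixes p w :: real
  assumes p: "0 < p" "p < 1" and w: "- (1 / 2) \<le> w"
  shows "(1 + w) powr p \<le> 1 + p * w"
    and "w \<le> 1 / 2 \<Longrightarrow> (1 + w) powr p \<le> 1 + p * w - 2 / 9 * (p * (1 - p)) * w\<^sup>2"
proof -
  have *: "(1 + w) powr p \<le> 1 + p * w \<and> (w \<le> 1 / 2 \<longrightarrow> (1 + w) powr p \<le> 1 + p * w - 2 / 9 * (p * (1 - p)) * w\<^sup>2)"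
  proof (cases "w = 0")
    case True then show ?thesis by simp
  next
    case False
    let ?d = "\<lambda>i t. case i of 0 \<Rightarrow> (1 + t) powr p | Suc 0 \<Rightarrow> p * (1 + t) powr (p - 1) | _ \<Rightarrow> p * (p - 1) * (1 + t) powr (p - 2)"
    have "\<exists>t. (if w < 0 then w < t \<and> t < 0 else 0 < t \<and> t < w) \<and>
       (1 + w) powr p = (\<Sum>m<2. ?d m 0 / fact m * (w - 0) ^ m) + ?d 2 t / fact 2 * (w - 0) ^ 2"
    proof (rule Taylor[where a="- (1 / 2)" and b="max w 0" and diff="?d"])
      show "\<forall>m t. m < 2 \<and> - (1 / 2) \<le> t \<and> t \<le> max w 0 \<longrightarrow> (?d m has_real_derivative ?d (Suc m) t) (at t)"
      proof (intro allI impI)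
        fix m t assume a: "m < (2::nat) \<and> - (1 / 2) \<le> t \<and> t \<le> max w 0"
        then consider "m = 0" | "m = 1" by linarith
        then show "(?d m has_real_derivative ?d (Suc m) t) (at t)"
          using a by cases (auto intro!: derivative_eq_intros simp: add_pos_nonneg algebra_simps)
      qed
    qed (use w False in auto)
    then obtain t where t: "if w < 0 then w < t \<and> t < 0 else 0 < t \<and> t < w"
      and eq: "(1 + w) powr p = 1 + p * w + p * (p - 1) * (1 + t) powr (p - 2) / 2 * w\<^sup>2"
      by (auto simp: numeral_2_eq_2)
    have eq': "(1 + w) powr p = 1 + p * w - (p * (1 - p)) * ((1 + t) powr (p - 2) / 2 * w\<^sup>2)"
      unfolding eq by (simp add: field_simps)
    have "(1 + w) powr p \<le> 1 + p * w" unfolding eq' using p by simp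
    moreover have "(1 + w) powr p \<le> 1 + p * w - 2 / 9 * (p * (1 - p)) * w\<^sup>2" if "w \<le> 1 / 2"
    proof -
      have t': "0 < 1 + t" "1 + t \<le> 3 / 2" using t w that by (auto split: if_splits)
      have "4 / 9 = (3 / 2 :: real) powr (- 2)" by (simp add: powr_minus_divide powr_numeral power2_eq_square)
      also have "\<dots> \<le> (3 / 2) powr (p - 2)" using p by (intro powr_mono) auto
      also have "\<dots> \<le> (1 + t) powr (p - 2)" using t' p by (intro powr_mono2') auto
      finally have "4 / 9 / 2 * w\<^sup>2 \<le> (1 + t) powr (p - 2) / 2 * w\<^sup>2"
        by (intro mult_right_mono divide_right_mono) auto
      then have "(p * (1 - p)) * (4 / 9 / 2 * w\<^sup>2) \<le> (p * (1 - p)) * ((1 + t) powr (p - 2) / 2 * w\<^sup>2)"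
        using p by (intro mult_left_mono) auto
      then show ?thesis unfolding eq' by simp
    qed
    ultimately show ?thesis by blast
  qed
  then show "(1 + w) powr p \<le> 1 + p * w" by simp
  show "w \<le> 1 / 2 \<Longrightarrow> (1 + w) powr p \<le> 1 + p * w - 2 / 9 * (p * (1 - p)) * w\<^sup>2" using * by simp
qed

text \<open>
On \<open>[- r, \<infinity>)\<close> a concave power, centred at \<open>- 2 r\<close> so that it is positive and smooth there, and far
below zero the power of the overshoot that is to be controlled. The factor \<open>r powr \<delta>\<close> makes the
function dominate that power on \<open>[- r, 0]\<close> as well, and makes the gain from concavity exceed the loss
from large jumps when \<open>r\<close> is large.
\<close>

definition barrier :: "real \<Rightarrow> real \<Rightarrow> real \<Rightarrow> real" where
  "barrier \<delta> r y = (if - r \<le> y then r powr \<delta> * (y + 2 * r) powr (1 - \<delta> / 2) else \<bar>y\<bar> powr (1 + \<delta> / 2))"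

lemma barrier_nonneg: "0 \<le> barrier \<delta> r y"
  by (simp add: barrier_def)

lemma borel_measurable_barrier [measurable]: "barrier \<delta> r \<in> borel_measurable borel"
  unfolding barrier_def[abs_def] by measurable

lemma barrier_ge_negative:
  assumes "1 \<le> r" "0 < \<delta>" "\<delta> \<le> 1" "y < 0"
  shows "\<bar>y\<bar> powr (1 + \<delta> / 2) \<le> barrier \<delta> r y" "\<bar>y\<bar> \<le> barrier \<delta> r y"
proof -
  have *: "\<bar>y\<bar> powr (1 + \<delta> / 2) \<le> barrier \<delta> r y \<and> \<bar>y\<bar> \<le> barrier \<delta> r y"
  proof (cases "- r \<le> y")
    case True
    have "r powr (1 + \<delta> / 2) = r powr \<delta> * r powr (1 - \<delta> / 2)"
      by (simp add: add.commute flip: powr_add)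
    also have "\<dots> \<le> r powr \<delta> * (y + 2 * r) powr (1 - \<delta> / 2)"
      using assms True by (intro mult_left_mono powr_mono2) auto
    finally have 1: "r powr (1 + \<delta> / 2) \<le> barrier \<delta> r y" using True by (simp add: barrier_def)
    have "\<bar>y\<bar> powr (1 + \<delta> / 2) \<le> r powr (1 + \<delta> / 2)"
      using assms True by (intro powr_mono2) auto
    moreover have "\<bar>y\<bar> \<le> r powr 1" using assms True by auto
    moreover have "r powr 1 \<le> r powr (1 + \<delta> / 2)" using assms by (intro powr_mono) auto
    ultimately show ?thesis using 1 by auto
  next
    case False
    have "\<bar>y\<bar> = \<bar>y\<bar> powr 1" using assms by simp
    also have "\<dots> \<le> \<bar>y\<bar> powr (1 + \<delta> / 2)"
      using assms False by (intro powr_mono) auto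
    finally show ?thesis using False by (simp add: barrier_def)
  qed
  then show "\<bar>y\<bar> powr (1 + \<delta> / 2) \<le> barrier \<delta> r y" "\<bar>y\<bar> \<le> barrier \<delta> r y" by auto
qed

lemma barrier_growth:
  assumes "1 \<le> r" "0 < \<delta>" "\<delta> \<le> 1" "0 \<le> y"
  shows "barrier \<delta> r y \<le> 2 * r\<^sup>2 * (1 + y) powr (1 - \<delta> / 2)"
proof -
  have "barrier \<delta> r y = r powr \<delta> * (y + 2 * r) powr (1 - \<delta> / 2)"
    using assms by (simp add: barrier_def)
  also have "\<dots> \<le> r powr \<delta> * (2 * r * (1 + y)) powr (1 - \<delta> / 2)"
    using assms mult_right_mono[of 1 "2 * r" y]
    by (intro mult_left_mono powr_mono2) (auto simp: algebra_simps)
  also have "\<dots> = r powr \<delta> * (2 * r) powr (1 - \<delta> / 2) * (1 + y) powr (1 - \<delta> / 2)"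
    using assms by (simp add: powr_mult)
  also have "\<dots> \<le> r powr 1 * (2 * r) powr 1 * (1 + y) powr (1 - \<delta> / 2)"
    using assms by (intro mult_mono powr_mono) auto
  also have "\<dots> = 2 * r\<^sup>2 * (1 + y) powr (1 - \<delta> / 2)"
    using assms by (simp add: power2_eq_square)
  finally show ?thesis .
qed

lemma powr_le_one_plus_square:
  assumes "0 \<le> p" "p \<le> 2" "0 \<le> (x::real)"
  shows "x powr p \<le> 1 + x\<^sup>2"
proof (cases "x \<le> 1")
  case True
  have "x powr p \<le> 1 powr p" using assms True by (intro powr_mono2) auto
  also have "1 powr p \<le> 1 + x\<^sup>2" by simp
  finally show ?thesis .
next
  case False
  have "x powr p \<le> x powr 2" using assms False by (intro powr_mono) auto
  then show ?thesis using False by (simp add: powr_numeral)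
qed

lemma barrier_quadratic:
  assumes "1 \<le> r" "0 < \<delta>" "\<delta> \<le> 1"
  shows "\<bar>barrier \<delta> r y\<bar> \<le> 17 * r ^ 3 * (1 + y\<^sup>2)"
proof -
  have r3: "1 \<le> r ^ 3" "r \<le> r ^ 3" using assms by (auto intro: self_le_power)
  show ?thesis
  proof (cases "- r \<le> y")
    case True
    have "barrier \<delta> r y = r powr \<delta> * (y + 2 * r) powr (1 - \<delta> / 2)"
      using True by (simp add: barrier_def)
    also have "\<dots> \<le> r powr 1 * (1 + (y + 2 * r)\<^sup>2)"
      using True assms by (intro mult_mono powr_mono powr_le_one_plus_square) auto
    also have "\<dots> \<le> r * (r\<^sup>2 * (9 + 8 * y\<^sup>2))"
    proof -
      have "(y + 2 * r)\<^sup>2 \<le> 2 * y\<^sup>2 + 8 * r\<^sup>2"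
        using zero_le_power2[of "y - 2 * r"] by (simp add: power2_eq_square algebra_simps)
      moreover have r2: "1 \<le> r\<^sup>2" using assms by simp
      moreover have "1 * y\<^sup>2 \<le> r\<^sup>2 * y\<^sup>2" using r2 by (intro mult_right_mono) auto
      moreover have "0 \<le> r\<^sup>2 * y\<^sup>2" by simp
      ultimately have "1 + (y + 2 * r)\<^sup>2 \<le> r\<^sup>2 * (9 + 8 * y\<^sup>2)"
        unfolding distrib_left by linarith
      then have "r * (1 + (y + 2 * r)\<^sup>2) \<le> r * (r\<^sup>2 * (9 + 8 * y\<^sup>2))" using assms by (intro mult_left_mono) auto
      then show ?thesis using assms by simp
    qed
    also have "\<dots> = r ^ 3 * (9 + 8 * y\<^sup>2)" by (simp add: power3_eq_cube power2_eq_square)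
    also have "\<dots> \<le> r ^ 3 * (17 * (1 + y\<^sup>2))" using r3(1) assms(1) by (intro mult_left_mono) auto
    finally show ?thesis using barrier_nonneg[of \<delta> r y] by (simp add: algebra_simps)
  next
    case False
    then have "barrier \<delta> r y \<le> 1 * (1 + y\<^sup>2)"
      using assms powr_le_one_plus_square[of "1 + \<delta> / 2" "\<bar>y\<bar>"] by (simp add: barrier_def)
    also have "\<dots> \<le> 17 * r ^ 3 * (1 + y\<^sup>2)"
      using r3(1) by (intro mult_right_mono) auto
    finally show ?thesis using barrier_nonneg[of \<delta> r y] by simp
  qed
qed

lemma barrier_step_pointwise:
  fixes \<delta> r y \<xi> :: real
  assumes r: "1 \<le> r" and \<delta>: "0 < \<delta>" "\<delta> \<le> 1" and y: "0 \<le> y"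
  defines "z \<equiv> y + 2 * r" and "\<kappa> \<equiv> \<delta> * (1 - \<delta> / 2) / 9"
  shows "barrier \<delta> r (y + \<xi>) \<le> barrier \<delta> r y + r powr \<delta> * z powr (- \<delta> / 2) * (1 - \<delta> / 2) * \<xi>
     - \<kappa> * r powr \<delta> * z powr (- 1 - \<delta> / 2) * \<xi>\<^sup>2
     + (\<kappa> + 9) * z powr (- 1 - \<delta> / 2) * \<bar>\<xi>\<bar> powr (2 + \<delta>)"
proof -
  define p where "p = 1 - \<delta> / 2"
  define c where "c = r powr \<delta>"
  define w where "w = \<xi> / z"
  have z: "2 * r \<le> z" "0 < z" using r y by (auto simp: z_def)
  have p: "0 < p" "p < 1" using \<delta> by (auto simp: p_def)
  have c: "0 \<le> c" by (simp add: c_def)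
  have \<kappa>: "\<kappa> = 2 / 9 * (p * (1 - p))" "0 \<le> \<kappa>" using \<delta> by (auto simp: \<kappa>_def p_def)
  have byy: "barrier \<delta> r y = c * z powr p" using r y by (simp add: barrier_def z_def p_def c_def)
  have zp1: "z powr (- \<delta> / 2) = z powr p / z"
    using z unfolding p_def by (simp add: powr_diff powr_minus_divide)
  have zp2: "z powr (- 1 - \<delta> / 2) = z powr p / z\<^sup>2"
  proof -
    have "z powr (- 1 - \<delta> / 2) = z powr (p - 2)" by (simp add: p_def)
    also have "\<dots> = z powr p / z\<^sup>2" using z by (simp add: powr_diff powr_numeral)
    finally show ?thesis .
  qed
  have lin: "c * z powr (- \<delta> / 2) * p * \<xi> = c * z powr p * (p * w)"
    unfolding zp1 w_def using z by simp
  have quad: "\<kappa> * c * z powr (- 1 - \<delta> / 2) * \<xi>\<^sup>2 = c * z powr p * (\<kappa> * w\<^sup>2)"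
    unfolding zp2 w_def using z by (simp add: power_divide)
  let ?last = "(\<kappa> + 9) * z powr (- 1 - \<delta> / 2) * \<bar>\<xi>\<bar> powr (2 + \<delta>)"
  have last0: "0 \<le> ?last" using \<kappa> by simp
  have one_plus: "c * (z + \<xi>) powr p = c * z powr p * (1 + w) powr p" if "- 1 \<le> w"
  proof -
    have "z + \<xi> = z * (1 + w)" using z by (simp add: w_def field_simps)
    then show ?thesis using z that by (simp add: powr_mult)
  qed
  have big: "\<kappa> * c * z powr (- 1 - \<delta> / 2) * \<xi>\<^sup>2 \<le> \<kappa> * z powr (- 1 - \<delta> / 2) * \<bar>\<xi>\<bar> powr (2 + \<delta>)" if "z / 2 < \<bar>\<xi>\<bar>"
  proof -
    have "c \<le> \<bar>\<xi>\<bar> powr \<delta>" unfolding c_def using r z that \<delta> by (intro powr_mono2) auto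
    then have "c * \<xi>\<^sup>2 \<le> \<bar>\<xi>\<bar> powr \<delta> * \<xi>\<^sup>2" by (intro mult_right_mono) auto
    also have "\<dots> = \<bar>\<xi>\<bar> powr (2 + \<delta>)" using that z by (simp add: powr_add powr_numeral)
    finally have "\<kappa> * z powr (- 1 - \<delta> / 2) * (c * \<xi>\<^sup>2) \<le> \<kappa> * z powr (- 1 - \<delta> / 2) * \<bar>\<xi>\<bar> powr (2 + \<delta>)"
      using \<kappa> by (intro mult_left_mono) auto
    then show ?thesis by (simp add: algebra_simps)
  qed
  have main: "barrier \<delta> r (y + \<xi>) \<le> c * z powr p + c * z powr (- \<delta> / 2) * p * \<xi>
     - \<kappa> * c * z powr (- 1 - \<delta> / 2) * \<xi>\<^sup>2 + ?last"
  proof -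
    \<comment> \<open>A moderate jump uses strict concavity; a large one is paid for by the moment of order \<open>2 + \<delta>\<close>.\<close>
    consider "\<bar>\<xi>\<bar> \<le> z / 2" | "z / 2 < \<xi>" | "\<xi> < - (z / 2)" by linarith
    then show ?thesis
    proof cases
      case 1
      then have w: "- (1 / 2) \<le> w" "w \<le> 1 / 2" unfolding w_def using z by (auto simp: field_simps abs_le_iff)
      have "- r \<le> y + \<xi>" using 1 y by (auto simp: z_def field_simps)
      then have "barrier \<delta> r (y + \<xi>) = c * (z + \<xi>) powr p" 
        by (simp add: barrier_def c_def p_def z_def algebra_simps)
      also have "\<dots> = c * z powr p * (1 + w) powr p" using w by (intro one_plus) auto
      also have "\<dots> \<le> c * z powr p * (1 + p * w - \<kappa> * w\<^sup>2)"
        unfolding \<kappa>(1) using one_plus_powr_le(2)[OF p w] c by (intro mult_left_mono) auto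
      finally show ?thesis unfolding lin quad using last0 by (simp add: algebra_simps)
    next
      case 2
      then have w: "- (1 / 2) \<le> w" unfolding w_def using z by (auto simp: field_simps)
      have "- r \<le> y + \<xi>" using 2 z y r by auto
      then have "barrier \<delta> r (y + \<xi>) = c * (z + \<xi>) powr p" 
        by (simp add: barrier_def c_def p_def z_def algebra_simps)
      also have "\<dots> = c * z powr p * (1 + w) powr p" using w by (intro one_plus) auto
      also have "\<dots> \<le> c * z powr p * (1 + p * w)"
        using one_plus_powr_le(1)[OF p w] c by (intro mult_left_mono) auto
      also have "\<dots> = c * z powr p + c * z powr (- \<delta> / 2) * p * \<xi>"
        unfolding lin by (simp add: algebra_simps)
      finally have "barrier \<delta> r (y + \<xi>) \<le> c * z powr p + c * z powr (- \<delta> / 2) * p * \<xi>" .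
      moreover have "0 \<le> 9 * z powr (- 1 - \<delta> / 2) * \<bar>\<xi>\<bar> powr (2 + \<delta>)" by simp
      ultimately show ?thesis using big 2 z unfolding distrib_right by linarith
    next
      case 3
      define x where "x = \<bar>\<xi>\<bar>"
      have x: "z / 2 < x" "0 < x" "\<xi> = - x" "r \<le> x" using 3 z by (auto simp: x_def)
      have "barrier \<delta> r (y + \<xi>) \<le> x powr (1 + \<delta> / 2)"
      proof (cases "- r \<le> y + \<xi>")
        case True
        have "barrier \<delta> r (y + \<xi>) = c * (z + \<xi>) powr p" 
          using True by (simp add: barrier_def c_def p_def z_def algebra_simps)
        also have "\<dots> \<le> x powr \<delta> * x powr p"
          unfolding c_def using True x r p \<delta> by (intro mult_mono powr_mono2) (auto simp: z_def)
        also have "\<dots> = x powr (1 + \<delta> / 2)" by (simp add: p_def diff_add_eq add.commute flip: powr_add)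
        finally show ?thesis .
      next
        case False
        then show ?thesis unfolding barrier_def using x y r \<delta> by (auto intro!: powr_mono2)
      qed
      moreover have "- (c * z powr (- \<delta> / 2) * p * \<xi>) \<le> x powr (1 + \<delta> / 2)"
      proof -
        have "c * z powr (- \<delta> / 2) \<le> x powr (\<delta> / 2)"
        proof -
          have "c * z powr (- \<delta> / 2) = r powr (\<delta> / 2) * (r powr (\<delta> / 2) * z powr (- \<delta> / 2))"
            unfolding c_def mult.assoc[symmetric] by (simp add: add.commute flip: powr_add)
          also have "\<dots> \<le> x powr (\<delta> / 2) * (z powr (\<delta> / 2) * z powr (- \<delta> / 2))"
            using r x z \<delta> by (intro mult_mono[OF powr_mono2 mult_right_mono[OF powr_mono2]]) auto
          also have "z powr (\<delta> / 2) * z powr (- \<delta> / 2) = 1" using z by (simp flip: powr_add)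
          finally show ?thesis by simp
        qed
        then have "c * z powr (- \<delta> / 2) * p * x \<le> x powr (\<delta> / 2) * 1 * x"
          using p x c by (intro mult_mono) auto
        also have "\<dots> = x powr (1 + \<delta> / 2)" using x by (simp add: powr_add mult.commute)
        finally show ?thesis using x by simp
      qed
      moreover have "2 * x powr (1 + \<delta> / 2) \<le> 9 * z powr (- 1 - \<delta> / 2) * \<bar>\<xi>\<bar> powr (2 + \<delta>)"
      proof -
        have "(z / 2) powr (1 + \<delta> / 2) \<le> x powr (1 + \<delta> / 2)"
          using z x \<delta> by (intro powr_mono2) auto
        moreover have "(z / 2) powr (1 + \<delta> / 2) * (z powr (- 1 - \<delta> / 2) * 4) \<ge> 1"
        proof -
          have "(z / 2) powr (1 + \<delta> / 2) * (z powr (- 1 - \<delta> / 2) * 4) = 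
              z powr (1 + \<delta> / 2) * z powr (- 1 - \<delta> / 2) * 4 / 2 powr (1 + \<delta> / 2)"
            using z by (simp add: powr_divide)
          also have "z powr (1 + \<delta> / 2) * z powr (- 1 - \<delta> / 2) = 1"
            using z by (simp add: add.commute flip: powr_add)
          also have "2 powr (1 + \<delta> / 2) \<le> 2 powr (2::real)" using \<delta> by (intro powr_mono) auto
          then have "1 * 4 / 2 powr (1 + \<delta> / 2) \<ge> 1" by (simp add: powr_numeral)
          finally show ?thesis .
        qed
        ultimately have "1 \<le> x powr (1 + \<delta> / 2) * (z powr (- 1 - \<delta> / 2) * 4)"
          by (meson mult_right_mono order_trans powr_ge_zero zero_le_mult_iff zero_le_numeral)
        then have "x powr (1 + \<delta> / 2) * 1 \<le> x powr (1 + \<delta> / 2) * (x powr (1 + \<delta> / 2) * (z powr (- 1 - \<delta> / 2) * 4))"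
          by (intro mult_left_mono) auto
        also have "\<dots> = 4 * z powr (- 1 - \<delta> / 2) * (x powr (1 + \<delta> / 2) * x powr (1 + \<delta> / 2))"
          by (simp add: algebra_simps)
        also have "x powr (1 + \<delta> / 2) * x powr (1 + \<delta> / 2) = x powr (2 + \<delta>)"
          by (simp add: add.commute flip: powr_add)
        finally have "2 * x powr (1 + \<delta> / 2) \<le> 8 * (z powr (- 1 - \<delta> / 2) * x powr (2 + \<delta>))" by (simp add: ac_simps)
        also have "\<dots> \<le> 9 * (z powr (- 1 - \<delta> / 2) * x powr (2 + \<delta>))" by (intro mult_right_mono) auto
        finally show ?thesis unfolding x_def mult.assoc .
      qed
      moreover have "0 \<le> c * z powr p" using c by simp
      ultimately show ?thesis using big 3 z x unfolding distrib_right by linarith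
    qed
  qed
  show ?thesis using main unfolding byy c_def[symmetric] p_def[symmetric] .
qed

section \<open>Sums of powers\<close>

lemma inverse_sqrt_le:
  assumes "0 < c" "0 < b" "c \<le> 4 * b"
  shows "1 / sqrt b \<le> 2 / sqrt c"
proof -
  have "sqrt c \<le> sqrt (4 * b)" using assms by (intro real_sqrt_le_mono)
  then have "sqrt c \<le> 2 * sqrt b" by (simp only: real_sqrt_mult real_sqrt_four)
  then show ?thesis using assms by (simp add: field_simps)
qed

lemma sum_inverse_sqrt: "(\<Sum>j<n. 1 / sqrt (real (j + 1))) \<le> 2 * sqrt (real n)"
proof (induction n)
  case (Suc n)
  have "1 / sqrt (real (n + 1)) \<le> 2 * (sqrt (real (n + 1)) - sqrt (real n))"
  proof -
    define a b where "a = sqrt (real (n + 1))" and "b = sqrt (real n)"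
    have "a\<^sup>2 = b\<^sup>2 + 1" "0 < a" "0 \<le> b" "b \<le> a" by (auto simp: a_def b_def)
    moreover have "0 \<le> (a - b)\<^sup>2" by simp
    ultimately have "1 \<le> 2 * (a - b) * a" by (simp add: power2_eq_square algebra_simps)
    then show ?thesis using \<open>0 < a\<close> unfolding a_def[symmetric] b_def[symmetric] by (simp add: divide_le_eq)
  qed
  then show ?case using Suc by (simp add: algebra_simps)
qed simp

lemma sum_powr_le:
  assumes "1 \<le> h" "0 < v" "0 < p"
  shows "(\<Sum>j<n. (h + real j * v) powr (- 1 - p)) \<le> (1 + v) powr (1 + p) / (p * v) * h powr (- p)"
proof -
  let ?s = "\<lambda>j. h + real j * v"
  have pos: "1 \<le> ?s j" for j using assms by (simp add: add_increasing2)
  \<comment> \<open>Comparison with the telescoping differences of \<open>s powr - p\<close>; the factor \<open>(1 + v) powr (1 + p)\<close> absorbs the shift by one step.\<close>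
  have step: "?s j powr (- 1 - p) \<le> (1 + v) powr (1 + p) / (p * v) * (?s j powr (- p) - ?s (Suc j) powr (- p))" for j
  proof -
    have lt: "?s j < ?s (Suc j)" using assms by (simp add: algebra_simps)
    have "\<exists>\<xi>>?s j. \<xi> < ?s (Suc j) \<and> ?s (Suc j) powr (- p) - ?s j powr (- p) = (?s (Suc j) - ?s j) * ((- p) * \<xi> powr (- p - 1))"
    proof (rule MVT2[OF lt])
      fix x assume "?s j \<le> x"
      then have "0 < x" using pos[of j] by linarith
      then show "((\<lambda>x. x powr (- p)) has_real_derivative (- p) * x powr (- p - 1)) (at x)"
        by (auto intro!: derivative_eq_intros simp: powr_diff)
    qed
    then obtain \<xi> where \<xi>: "?s j < \<xi>" "\<xi> < ?s (Suc j)"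
      and eq: "?s (Suc j) powr (- p) - ?s j powr (- p) = v * ((- p) * \<xi> powr (- p - 1))"
      by (auto simp: algebra_simps)
    have "?s (Suc j) \<le> (1 + v) * ?s j"
      using pos[of j] assms mult_left_mono[of 1 "?s j" v] by (simp add: algebra_simps)
    then have "\<xi> \<le> (1 + v) * ?s j" using \<xi> by linarith
    then have "((1 + v) * ?s j) powr (- 1 - p) \<le> \<xi> powr (- 1 - p)"
      using \<xi> pos[of j] assms by (intro powr_mono2') auto
    also have "((1 + v) * ?s j) powr (- 1 - p) = ?s j powr (- 1 - p) / (1 + v) powr (1 + p)"
    proof -
      have "((1 + v) * ?s j) powr (- 1 - p) = (1 + v) powr (- (1 + p)) * ?s j powr (- 1 - p)"
        using pos[of j] assms by (simp add: powr_mult)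
      then show ?thesis by (simp only: powr_minus_divide) simp
    qed
    finally have "?s j powr (- 1 - p) \<le> (1 + v) powr (1 + p) * \<xi> powr (- 1 - p)"
      using assms by (simp add: divide_le_eq mult.commute)
    also have "\<xi> powr (- 1 - p) = (?s j powr (- p) - ?s (Suc j) powr (- p)) / (p * v)"
    proof -
      have "?s j powr (- p) - ?s (Suc j) powr (- p) = p * v * \<xi> powr (- p - 1)" using eq by (simp only: minus_diff_eq[of "?s (Suc j) powr (- p)", symmetric]) simp
      moreover have "- p - 1 = - 1 - p" by simp
      ultimately show ?thesis using assms by simp
    qed
    finally show ?thesis by simp
  qed
  have "(\<Sum>j<n. ?s j powr (- 1 - p)) \<le> (\<Sum>j<n. (1 + v) powr (1 + p) / (p * v) * (?s j powr (- p) - ?s (Suc j) powr (- p)))"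
    by (intro sum_mono step)
  also have "\<dots> = (1 + v) powr (1 + p) / (p * v) * (\<Sum>j<n. (?s j powr (- p) - ?s (Suc j) powr (- p)))"
    by (rule sum_distrib_left[symmetric])
  also have "(\<Sum>j<n. (?s j powr (- p) - ?s (Suc j) powr (- p))) = ?s 0 powr (- p) - ?s n powr (- p)"
    by (rule sum_lessThan_telescope')
  also have "(1 + v) powr (1 + p) / (p * v) * \<dots> \<le> (1 + v) powr (1 + p) / (p * v) * h powr (- p)"
    using assms by (intro mult_left_mono) auto
  finally show ?thesis .
qed

text \<open>
Here \<open>1 / sqrt (j + 1)\<close> stands for the survival probability and the other factor for the replacement
error at step \<open>j\<close>.
\<close>

lemma sum_sqrt_powr_le:
  assumes v: "0 < v" and p: "0 < p"
  shows "\<exists>C>0. \<forall>n h. 1 \<le> n \<longrightarrow> 1 \<le> h \<longrightarrow> h \<le> real n \<longrightarrow>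
    (\<Sum>j<n. 1 / sqrt (real (j + 1)) * (h + real (n - Suc j) * v) powr (- 1 - p)) \<le> C / sqrt (real n) * h powr (- p)"
proof -
  define c where "c = min 1 v / 2"
  define K where "K = (1 + v) powr (1 + p) / (p * v)"
  define C where "C = 2 * c powr (- 1 - p) + 2 * K"
  have c: "0 < c" "c \<le> 1 / 2" "c \<le> v / 2" using v by (auto simp: c_def)
  have K: "0 < K" using v p by (simp add: K_def)
  have C: "0 < C" using c K by (simp add: C_def add_nonneg_pos)
  have "(\<Sum>j<n. 1 / sqrt (real (j + 1)) * (h + real (n - Suc j) * v) powr (- 1 - p)) \<le> C / sqrt (real n) * h powr (- p)"
    if n: "1 \<le> n" and h: "1 \<le> h" "h \<le> real n" for n :: nat and h :: real
  proof -
    let ?s = "\<lambda>j. (h + real (n - Suc j) * v) powr (- 1 - p)"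
    let ?d = "(c * real n) powr (- 1 - p)"
    have n0: "0 < real n" using n by simp
    \<comment> \<open>For \<open>j < n / 2\<close> the second factor is of order \<open>n powr (- 1 - p)\<close>, for \<open>j \<ge> n / 2\<close> the first is of order \<open>1 / sqrt n\<close>.\<close>
    have tm: "1 / sqrt (real (j + 1)) * ?s j \<le> ?d * (1 / sqrt (real (j + 1))) + 2 / sqrt (real n) * ?s j" if j: "j < n" for j
    proof (cases "2 * j < n")
      case True
      have "2 * real (n - Suc j) = 2 * real n - 2 * real j - 2" using j by (simp add: of_nat_diff)
      moreover have "2 * real j \<le> real n - 1" using True by linarith
      ultimately have "2 * real (n - Suc j) \<ge> real n - 1" by (smt (verit))
      then have "real (n - Suc j) \<ge> (real n - 1) / 2" by simp
      then have "real (n - Suc j) * v \<ge> (real n - 1) / 2 * v" using v by (intro mult_right_mono) auto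
      moreover have "(real n - 1) / 2 * v \<ge> (real n - 1) * c"
        using c n mult_left_mono[of c "v/2" "real n - 1"] by simp
      ultimately have "c * real n \<le> h + real (n - Suc j) * v"
        using h c by (simp add: algebra_simps)
      then have "?s j \<le> ?d" using c n0 p by (intro powr_mono2') auto
      then have "1 / sqrt (real (j + 1)) * ?s j \<le> 1 / sqrt (real (j + 1)) * ?d"
        by (intro mult_left_mono) auto
      moreover have "0 \<le> 2 / sqrt (real n) * ?s j" by simp
      ultimately show ?thesis by (metis add_increasing2 mult.commute)
    next
      case False
      have "n \<le> 4 * (j + 1)" using False by simp
      then have "real n \<le> 4 * real (j + 1)" by (metis of_nat_le_iff of_nat_mult of_nat_numeral)
      then have "1 / sqrt (real (j + 1)) \<le> 2 / sqrt (real n)" using n0 by (intro inverse_sqrt_le) auto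
      then have "1 / sqrt (real (j + 1)) * ?s j \<le> 2 / sqrt (real n) * ?s j"
        by (intro mult_right_mono) auto
      moreover have "0 \<le> ?d * (1 / sqrt (real (j + 1)))" by simp
      ultimately show ?thesis by linarith
    qed
    have "(\<Sum>j<n. 1 / sqrt (real (j + 1)) * ?s j) \<le> (\<Sum>j<n. ?d * (1 / sqrt (real (j + 1))) + 2 / sqrt (real n) * ?s j)"
      by (intro sum_mono tm) auto
    also have "\<dots> = ?d * (\<Sum>j<n. 1 / sqrt (real (j + 1))) + 2 / sqrt (real n) * (\<Sum>j<n. ?s j)"
      by (simp only: sum.distrib sum_distrib_left)
    also have "(\<Sum>j<n. ?s j) = (\<Sum>j<n. (h + real j * v) powr (- 1 - p))"
      by (rule sum.nat_diff_reindex)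
    also have "?d * (\<Sum>j<n. 1 / sqrt (real (j + 1))) + 2 / sqrt (real n) * (\<Sum>j<n. (h + real j * v) powr (- 1 - p))
       \<le> ?d * (2 * sqrt (real n)) + 2 / sqrt (real n) * (K * h powr (- p))"
      unfolding K_def using h v p by (intro add_mono mult_left_mono sum_powr_le sum_inverse_sqrt) auto
    also have "?d * (2 * sqrt (real n)) \<le> 2 * c powr (- 1 - p) / sqrt (real n) * h powr (- p)"
    proof -
      have "?d = c powr (- 1 - p) * (real n powr (- p) / real n)"
        using c n0 by (simp add: powr_mult powr_diff powr_minus_divide)
      then have "?d * (2 * sqrt (real n)) = 2 * c powr (- 1 - p) * (sqrt (real n) / real n) * real n powr (- p)"
        by (simp add: ac_simps)
      also have "sqrt (real n) / real n = 1 / sqrt (real n)"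
        using n0 by (simp add: real_div_sqrt field_simps)
      also have "2 * c powr (- 1 - p) * (1 / sqrt (real n)) * real n powr (- p) = 2 * c powr (- 1 - p) / sqrt (real n) * real n powr (- p)"
        by simp
      also have "\<dots> \<le> 2 * c powr (- 1 - p) / sqrt (real n) * h powr (- p)"
        using h p by (intro mult_left_mono powr_mono2') auto
      finally show ?thesis .
    qed
    finally show ?thesis unfolding C_def by (simp add: algebra_simps add_divide_distrib)
  qed
  then show ?thesis using C by blast
qed

section \<open>Functions of at most quadratic growth\<close>

text \<open>
The class of test functions: their composition with a square-integrable walk is integrable.
\<close>

definition quad_growth :: "(real \<Rightarrow> real) \<Rightarrow> bool" where
  "quad_growth f \<longleftrightarrow> f \<in> borel_measurable borel \<and> (\<exists>C. \<forall>y. \<bar>f y\<bar> \<le> C * (1 + y\<^sup>2))"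

lemma quad_growthI:
  assumes "f \<in> borel_measurable borel" "\<And>y. \<bar>f y\<bar> \<le> C * (1 + y\<^sup>2)"
  shows "quad_growth f"
  using assms unfolding quad_growth_def by blast

lemma quad_growth_bounded:
  assumes "f \<in> borel_measurable borel" "\<And>y. \<bar>f y\<bar> \<le> C"
  shows "quad_growth f"
proof (rule quad_growthI[OF assms(1)])
  fix y
  have "0 \<le> C" using order_trans[OF abs_ge_zero assms(2)[of y]] .
  then have "C * 1 \<le> C * (1 + y\<^sup>2)" by (intro mult_left_mono) auto
  with assms(2)[of y] show "\<bar>f y\<bar> \<le> C * (1 + y\<^sup>2)" by simp
qed

lemma quad_growth_const: "quad_growth (\<lambda>_. c)"
  by (rule quad_growth_bounded[where C="\<bar>c\<bar>"]) auto

lemma quad_growth_add [intro]: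
  assumes "quad_growth f" "quad_growth g"
  shows "quad_growth (\<lambda>y. f y + g y)"
proof -
  from assms obtain C D where "\<And>y. \<bar>f y\<bar> \<le> C * (1 + y\<^sup>2)" "\<And>y. \<bar>g y\<bar> \<le> D * (1 + y\<^sup>2)"
    unfolding quad_growth_def by blast
  then have "\<bar>f y + g y\<bar> \<le> (C + D) * (1 + y\<^sup>2)" for y
    by (smt (verit) distrib_right)
  with assms show ?thesis unfolding quad_growth_def by auto
qed

lemma quad_growth_cmult [intro]:
  assumes "quad_growth f"
  shows "quad_growth (\<lambda>y. c * f y)"
proof -
  from assms obtain C where "\<And>y. \<bar>f y\<bar> \<le> C * (1 + y\<^sup>2)"
    unfolding quad_growth_def by blast
  then have "\<bar>c * f y\<bar> \<le> (\<bar>c\<bar> * C) * (1 + y\<^sup>2)" for y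
    unfolding abs_mult mult.assoc by (intro mult_left_mono) auto
  with assms show ?thesis unfolding quad_growth_def by auto
qed

lemma quad_growth_diff:
  "quad_growth f \<Longrightarrow> quad_growth g \<Longrightarrow> quad_growth (\<lambda>y. f y - g y)"
  using quad_growth_add[OF _ quad_growth_cmult[of g "-1"], of f] by simp

lemma quad_growth_ident: "quad_growth (\<lambda>y. y)"
proof (rule quad_growthI[where C=1])
  fix y :: real
  have "0 \<le> (\<bar>y\<bar> - 1)\<^sup>2 + 1 + y\<^sup>2" by (intro add_nonneg_nonneg) auto
  then show "\<bar>y\<bar> \<le> 1 * (1 + y\<^sup>2)" by (simp add: power2_eq_square algebra_simps)
qed simp

lemma quad_growth_abs:
  assumes "quad_growth f" shows "quad_growth (\<lambda>y. \<bar>f y\<bar>)"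
  using assms unfolding quad_growth_def by auto

lemma quad_growth_abs_ident: "quad_growth (\<lambda>y. \<bar>y\<bar>)"
  by (rule quad_growth_abs[OF quad_growth_ident])

lemma quad_growth_powr:
  assumes "0 \<le> p" "p \<le> 2"
  shows "quad_growth (\<lambda>y. \<bar>y\<bar> powr p)" "quad_growth (\<lambda>y. (1 + \<bar>y\<bar>) powr p)"
proof -
  show "quad_growth (\<lambda>y. \<bar>y\<bar> powr p)"
    using powr_le_one_plus_square[OF assms, of "\<bar>_\<bar>"] by (intro quad_growthI[where C=1]) auto
  show "quad_growth (\<lambda>y. (1 + \<bar>y\<bar>) powr p)"
  proof (rule quad_growthI[where C=3])
    fix y :: real
    have "(1 + \<bar>y\<bar>) powr p \<le> 1 + (1 + \<bar>y\<bar>)\<^sup>2"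
      using assms by (intro powr_le_one_plus_square) auto
    also have "\<dots> \<le> 3 * (1 + y\<^sup>2)"
    proof -
      have "0 \<le> (\<bar>y\<bar> - 1)\<^sup>2 + y\<^sup>2" by (intro add_nonneg_nonneg) auto
      then show ?thesis by (simp add: power2_eq_square algebra_simps)
    qed
    finally show "\<bar>(1 + \<bar>y\<bar>) powr p\<bar> \<le> 3 * (1 + y\<^sup>2)" by simp
  qed simp
qed

lemma quad_growth_heat: "quad_growth (heat s)"
  by (rule quad_growth_bounded[OF _ heat_abs_le]) simp

lemma quad_growth_heat_shift: "quad_growth (\<lambda>y. heat s (y + c))"
  by (rule quad_growth_bounded[OF _ heat_abs_le]) simp

lemma quad_growth_strip: "quad_growth (strip T s)"
  by (rule quad_growth_bounded[OF _ strip_abs_le]) simp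

section \<open>The walk before its exit\<close>

text \<open>
The exponent is normalised to \<open>\<delta> \<le> 1\<close>, and \<open>v\<close> is the variance of an increment.
\<close>

locale random_walk = prob_space M for M :: "'a measure" +
  fixes X :: "nat \<Rightarrow> 'a \<Rightarrow> real" and v \<delta> :: real
  assumes indep: "indep_vars (\<lambda>_. borel) X {1..}"
    and same_distr: "\<And>i. i \<ge> 1 \<Longrightarrow> distr M borel (X i) = distr M borel (X 1)"
    and int1: "integrable M (X 1)" and mean: "(\<integral>\<omega>. X 1 \<omega> \<partial>M) = 0"
    and int2: "integrable M (\<lambda>\<omega>. (X 1 \<omega>)\<^sup>2)" and variance: "(\<integral>\<omega>. (X 1 \<omega>)\<^sup>2 \<partial>M) = v" and v_pos: "0 < v"
    and \<delta>: "0 < \<delta>" "\<delta> \<le> 1" and int_moment: "integrable M (\<lambda>\<omega>. \<bar>X 1 \<omega>\<bar> powr (2 + \<delta>))"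

begin

lemma measurable_X [measurable]: "i \<ge> 1 \<Longrightarrow> X i \<in> borel_measurable M"
  using indep unfolding indep_vars_def by auto

lemma measurable_X1 [measurable]: "X (Suc 0) \<in> borel_measurable M" "X 1 \<in> borel_measurable M"
  using measurable_X[of 1] by auto

lemma measurable_walk [measurable]: "walk X n \<in> borel_measurable M"
  unfolding walk_def[abs_def] by (intro borel_measurable_sum measurable_X) auto

lemma walk_Suc: "walk X (Suc k) \<omega> = walk X k \<omega> + X (Suc k) \<omega>"
  by (simp add: walk_def)

lemma walk_0 [simp]: "walk X 0 \<omega> = 0"
  by (simp add: walk_def)

text \<open>
The event that the walk started at \<open>x\<close> is nonnegative at the times \<open>1, \<dots>, j\<close>, that is, \<open>\<tau>\<^sub>x > j\<close>.
\<close>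

definition alive :: "real \<Rightarrow> nat \<Rightarrow> 'a set" where
  "alive x j = {\<omega> \<in> space M. \<forall>i\<in>{1..j}. 0 \<le> x + walk X i \<omega>}"

lemma sets_alive [measurable]: "alive x j \<in> sets M"
  unfolding alive_def by measurable

lemma alive_0: "alive x 0 = space M"
  by (simp add: alive_def)

lemma alive_Suc: "alive x (Suc j) = {\<omega> \<in> alive x j. 0 \<le> x + walk X (Suc j) \<omega>}"
  by (auto simp: alive_def le_Suc_eq)

lemma alive_antimono: "i \<le> j \<Longrightarrow> alive x j \<subseteq> alive x i"
  by (auto simp: alive_def)

lemma alive_nonneg: "0 \<le> x \<Longrightarrow> \<omega> \<in> alive x j \<Longrightarrow> 0 \<le> x + walk X j \<omega>"
  by (cases j) (auto simp: alive_def)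

end

lemma exit_time_gt_iff:
  "enat n < exit_time X x \<omega> \<longleftrightarrow> (\<forall>i\<in>{1..n}. 0 \<le> x + walk X i \<omega>)"
proof -
  let ?S = "{enat k |k. k \<ge> 1 \<and> x + walk X k \<omega> < 0}"
  have "exit_time X x \<omega> \<le> enat n \<longleftrightarrow> (\<exists>i\<in>{1..n}. x + walk X i \<omega> < 0)"
  proof
    assume le: "exit_time X x \<omega> \<le> enat n"
    have "?S \<noteq> {}"
    proof
      assume "?S = {}"
      then have "exit_time X x \<omega> = \<infinity>" unfolding exit_time_def by (simp add: Inf_enat_def)
      with le show False by simp
    qed
    then have "Inf ?S \<in> ?S" unfolding Inf_enat_def by (auto intro: LeastI)
    with le show "\<exists>i\<in>{1..n}. x + walk X i \<omega> < 0" unfolding exit_time_def by auto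
  next
    assume "\<exists>i\<in>{1..n}. x + walk X i \<omega> < 0"
    then obtain i where "i \<in> {1..n}" "x + walk X i \<omega> < 0" by blast
    then have "exit_time X x \<omega> \<le> enat i" unfolding exit_time_def by (intro Inf_lower) auto
    also have "\<dots> \<le> enat n" using \<open>i \<in> {1..n}\<close> by simp
    finally show "exit_time X x \<omega> \<le> enat n" .
  qed
  then show ?thesis by (meson not_le)
qed

context random_walk
begin

lemma alive_eq: "alive x n = {\<omega> \<in> space M. enat n < exit_time X x \<omega>}"
  unfolding alive_def exit_time_gt_iff ..

text \<open>
The transition operator of the walk.
\<close>

definition step :: "(real \<Rightarrow> real) \<Rightarrow> real \<Rightarrow> real" where
  "step f y = (\<integral>\<omega>. f (y + X 1 \<omega>) \<partial>M)"

text \<open>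
The mean of \<open>f (x + S\<^sub>k)\<close> on the event \<open>\<tau>\<^sub>x > j\<close>.
\<close>

definition alive_mean :: "(real \<Rightarrow> real) \<Rightarrow> real \<Rightarrow> nat \<Rightarrow> nat \<Rightarrow> real" where
  "alive_mean f x j k = (\<integral>\<omega>. indicator (alive x j) \<omega> * f (x + walk X k \<omega>) \<partial>M)"

text \<open>
The mean of \<open>f (x + S\<^sub>\<tau>)\<close> on the event \<open>\<tau>\<^sub>x = j + 1\<close>; the index \<open>j\<close> is the last time before the exit.
\<close>

definition exit_mean :: "(real \<Rightarrow> real) \<Rightarrow> real \<Rightarrow> nat \<Rightarrow> real" where
  "exit_mean f x j = (\<integral>\<omega>. indicator (alive x j - alive x (Suc j)) \<omega> * f (x + walk X (Suc j) \<omega>) \<partial>M)"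

lemma integrable_X_square: "i \<ge> 1 \<Longrightarrow> integrable M (\<lambda>\<omega>. (X i \<omega>)\<^sup>2)"
proof -
  assume i: "i \<ge> 1"
  have "integrable (distr M borel (X 1)) (\<lambda>x. x\<^sup>2)"
    using int2 by (subst integrable_distr_eq) auto
  then have "integrable (distr M borel (X i)) (\<lambda>x. x\<^sup>2)"
    using same_distr[OF i] by simp
  then show ?thesis using i by (subst (asm) integrable_distr_eq) auto
qed

lemma integrable_walk_square: "integrable M (\<lambda>\<omega>. (walk X n \<omega>)\<^sup>2)"
proof (induction n)
  case (Suc n)
  show ?case
  proof (rule Bochner_Integration.integrable_bound)
    show "integrable M (\<lambda>\<omega>. 2 * (walk X n \<omega>)\<^sup>2 + 2 * (X (Suc n) \<omega>)\<^sup>2)"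
      using Suc by (intro Bochner_Integration.integrable_add integrable_mult_right integrable_X_square) auto
    show "AE \<omega> in M. norm ((walk X (Suc n) \<omega>)\<^sup>2) \<le> norm (2 * (walk X n \<omega>)\<^sup>2 + 2 * (X (Suc n) \<omega>)\<^sup>2)"
    proof (intro always_eventually allI)
      fix \<omega>
      have "0 \<le> (walk X n \<omega> - X (Suc n) \<omega>)\<^sup>2" by simp
      then show "norm ((walk X (Suc n) \<omega>)\<^sup>2) \<le> norm (2 * (walk X n \<omega>)\<^sup>2 + 2 * (X (Suc n) \<omega>)\<^sup>2)"
        unfolding walk_Suc real_norm_def abs_power2
        by (subst abs_of_nonneg) (auto simp: power2_eq_square algebra_simps)
    qed
  qed measurable
qed simp

lemma integrable_quadratic:
  assumes f: "quad_growth f" and Y: "integrable M (\<lambda>\<omega>. (Y \<omega>)\<^sup>2)" and [measurable]: "Y \<in> borel_measurable M"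
  shows "integrable M (\<lambda>\<omega>. f (y + Y \<omega>))"
proof -
  from f obtain C where C: "\<And>y. \<bar>f y\<bar> \<le> C * (1 + y\<^sup>2)" and [measurable]: "f \<in> borel_measurable borel"
    unfolding quad_growth_def by blast
  have "0 \<le> C" using order_trans[OF abs_ge_zero C[of 0]] by simp
  show ?thesis
  proof (rule Bochner_Integration.integrable_bound)
    show "integrable M (\<lambda>\<omega>. C * (1 + 2 * y\<^sup>2 + 2 * (Y \<omega>)\<^sup>2))"
      using Y by (intro Bochner_Integration.integrable_add integrable_mult_right) auto
    show "AE \<omega> in M. norm (f (y + Y \<omega>)) \<le> norm (C * (1 + 2 * y\<^sup>2 + 2 * (Y \<omega>)\<^sup>2))"
    proof (intro always_eventually allI)
      fix \<omega>
      have "0 \<le> (y - Y \<omega>)\<^sup>2" by simp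
      then have "1 + (y + Y \<omega>)\<^sup>2 \<le> 1 + 2 * y\<^sup>2 + 2 * (Y \<omega>)\<^sup>2"
        by (simp add: power2_eq_square algebra_simps)
      then have "C * (1 + (y + Y \<omega>)\<^sup>2) \<le> C * (1 + 2 * y\<^sup>2 + 2 * (Y \<omega>)\<^sup>2)"
        using \<open>0 \<le> C\<close> by (intro mult_left_mono)
      with C[of "y + Y \<omega>"] show "norm (f (y + Y \<omega>)) \<le> norm (C * (1 + 2 * y\<^sup>2 + 2 * (Y \<omega>)\<^sup>2))" by simp
    qed
  qed measurable
qed

lemma integrable_step: "quad_growth f \<Longrightarrow> integrable M (\<lambda>\<omega>. f (y + X 1 \<omega>))"
  by (rule integrable_quadratic) (use int2 in auto)

lemma integrable_walk: "quad_growth f \<Longrightarrow> integrable M (\<lambda>\<omega>. f (x + walk X k \<omega>))"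
  by (rule integrable_quadratic) (use integrable_walk_square in auto)

lemma integrable_alive:
  assumes "quad_growth f"
  shows "integrable M (\<lambda>\<omega>. indicator (alive x j) \<omega> * f (x + walk X k \<omega>))"
  using integrable_mult_indicator[OF sets_alive integrable_walk[OF assms], of x j x k] by simp

lemma integrable_exit:
  assumes "quad_growth f"
  shows "integrable M (\<lambda>\<omega>. indicator (alive x j - alive x (Suc j)) \<omega> * f (x + walk X k \<omega>))"
  using integrable_mult_indicator[OF _ integrable_walk[OF assms], of "alive x j - alive x (Suc j)" x k] by simp

lemma quad_growth_step:
  assumes f: "quad_growth f"
  shows "quad_growth (step f)"
proof -
  from f obtain C where C: "\<And>y. \<bar>f y\<bar> \<le> C * (1 + y\<^sup>2)" and [measurable]: "f \<in> borel_measurable borel"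
    unfolding quad_growth_def by blast
  have "0 \<le> C" using order_trans[OF abs_ge_zero C[of 0]] by simp
  show ?thesis
  proof (rule quad_growthI)
    show "step f \<in> borel_measurable borel"
      unfolding step_def[abs_def] by measurable
    fix y
    have "\<bar>step f y\<bar> \<le> (\<integral>\<omega>. \<bar>f (y + X 1 \<omega>)\<bar> \<partial>M)"
      unfolding step_def by (rule integral_abs_bound)
    also have "\<dots> \<le> (\<integral>\<omega>. C * (1 + 2 * y\<^sup>2) + 2 * C * (X 1 \<omega>)\<^sup>2 \<partial>M)"
    proof (rule integral_mono)
      show "integrable M (\<lambda>\<omega>. \<bar>f (y + X 1 \<omega>)\<bar>)"
        using integrable_step[OF f] by (rule integrable_abs)
      show "integrable M (\<lambda>\<omega>. C * (1 + 2 * y\<^sup>2) + 2 * C * (X 1 \<omega>)\<^sup>2)"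
        using int2 by (intro Bochner_Integration.integrable_add integrable_mult_right) auto
      fix \<omega>
      have "0 \<le> (y - X 1 \<omega>)\<^sup>2" by simp
      then have "1 + (y + X 1 \<omega>)\<^sup>2 \<le> 1 + 2 * y\<^sup>2 + 2 * (X 1 \<omega>)\<^sup>2"
        by (simp add: power2_eq_square algebra_simps)
      then have "C * (1 + (y + X 1 \<omega>)\<^sup>2) \<le> C * (1 + 2 * y\<^sup>2 + 2 * (X 1 \<omega>)\<^sup>2)"
        using \<open>0 \<le> C\<close> by (intro mult_left_mono)
      with C[of "y + X 1 \<omega>"] show "\<bar>f (y + X 1 \<omega>)\<bar> \<le> C * (1 + 2 * y\<^sup>2) + 2 * C * (X 1 \<omega>)\<^sup>2"
        by (simp add: algebra_simps)
    qed
    also have "\<dots> = C * (1 + 2 * y\<^sup>2) + 2 * C * v"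
      using int2 variance by (subst Bochner_Integration.integral_add) (auto simp: prob_space)
    also have "\<dots> \<le> (C * (2 + 2 * v)) * (1 + y\<^sup>2)"
      using \<open>0 \<le> C\<close> v_pos by (simp add: algebra_simps)
    finally show "\<bar>step f y\<bar> \<le> (C * (2 + 2 * v)) * (1 + y\<^sup>2)" .
  qed
qed

text \<open>
The Markov property for one step. The survival event may refer to an earlier time \<open>j\<close>; with \<open>j\<close> fixed
this iterates to the Markov property at time \<open>j\<close>.
\<close>

lemma alive_mean_Suc:
  assumes f: "quad_growth f" and "j \<le> k"
  shows "alive_mean f x j (Suc k) = alive_mean (step f) x j k"
proof -
  let ?P = "\<Pi>\<^sub>M i\<in>{1..k}. (borel :: real measure)"
  let ?Y = "\<lambda>\<omega>. restrict (\<lambda>i. X i \<omega>) {1..k}"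
  let ?S = "\<lambda>k \<eta>. (\<Sum>i=1..k. \<eta> i :: real)"
  let ?Q = "\<Pi>\<^sub>M i\<in>{Suc k}. (borel :: real measure)"
  let ?Z = "\<lambda>\<omega>. restrict (\<lambda>i. X i \<omega>) {Suc k}"
  have [measurable]: "f \<in> borel_measurable borel" using f by (simp add: quad_growth_def)
  have S_meas: "?S i \<in> borel_measurable ?P" if "i \<le> k" for i
    using that by (intro borel_measurable_sum measurable_component_singleton) auto
  have [measurable]: "?S k \<in> borel_measurable ?P" by (rule S_meas) simp
  define B where "B = {\<eta> \<in> space ?P. \<forall>i\<in>{1..j}. 0 \<le> x + ?S i \<eta>}"
  have [measurable]: "B \<in> sets ?P"
  proof -
    have "{\<eta> \<in> space ?P. 0 \<le> x + ?S i \<eta>} \<in> sets ?P" if "i \<in> {1..j}" for i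
    proof -
      have [measurable]: "?S i \<in> borel_measurable ?P" using S_meas that \<open>j \<le> k\<close> by auto
      show ?thesis by measurable
    qed
    then show ?thesis unfolding B_def by (intro sets.sets_Collect_finite_All) auto
  qed
  have ind: "indep_var ?P ?Y ?Q ?Z"
    using indep by (rule indep_var_restrict) auto
  then have [measurable]: "?Y \<in> measurable M ?P" "?Z \<in> measurable M ?Q"
    and D: "distr M ?P ?Y \<Otimes>\<^sub>M distr M ?Q ?Z = distr M (?P \<Otimes>\<^sub>M ?Q) (\<lambda>\<omega>. (?Y \<omega>, ?Z \<omega>))"
    unfolding indep_var_distribution_eq by auto
  interpret DY: prob_space "distr M ?P ?Y" by (rule prob_space_distr) simp
  interpret DZ: prob_space "distr M ?Q ?Z" by (rule prob_space_distr) simp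
  interpret DD: pair_sigma_finite "distr M ?P ?Y" "distr M ?Q ?Z" ..
  let ?g = "\<lambda>(\<eta>, \<zeta>). indicator B \<eta> * f (x + ?S k \<eta> + \<zeta> (Suc k))"
  have walk_eq: "walk X i \<omega> = ?S i (?Y \<omega>)" if "i \<le> k" for i \<omega>
    using that unfolding walk_def by (intro sum.cong) auto
  have B_eq: "indicator B (?Y \<omega>) = (indicator (alive x j) \<omega> :: real)" if "\<omega> \<in> space M" for \<omega>
    using that \<open>j \<le> k\<close> walk_eq unfolding indicator_def B_def alive_def by (auto simp: space_PiM)
  have g_eq: "?g (?Y \<omega>, ?Z \<omega>) = indicator (alive x j) \<omega> * f (x + walk X (Suc k) \<omega>)" if "\<omega> \<in> space M" for \<omega>
    using B_eq[OF that] walk_eq[of k \<omega>] by (simp add: walk_Suc add.assoc)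
  have g_meas: "?g \<in> borel_measurable (?P \<Otimes>\<^sub>M ?Q)"
    by measurable
  have int: "integrable M (\<lambda>\<omega>. ?g (?Y \<omega>, ?Z \<omega>))"
    by (rule iffD2[OF Bochner_Integration.integrable_cong[OF refl g_eq] integrable_alive[OF f]])
  have intD: "integrable (distr M ?P ?Y \<Otimes>\<^sub>M distr M ?Q ?Z) ?g"
    unfolding D using g_meas int by (subst integrable_distr_eq) auto
  have inner: "(\<integral>\<zeta>. ?g (\<eta>, \<zeta>) \<partial>distr M ?Q ?Z) = indicator B \<eta> * step f (x + ?S k \<eta>)" for \<eta>
  proof -
    have "(\<integral>\<zeta>. f (x + ?S k \<eta> + \<zeta> (Suc k)) \<partial>distr M ?Q ?Z) = (\<integral>\<omega>. f (x + ?S k \<eta> + X (Suc k) \<omega>) \<partial>M)"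
      by (subst integral_distr) auto
    also have "\<dots> = (\<integral>\<zeta>. f (x + ?S k \<eta> + \<zeta>) \<partial>distr M borel (X (Suc k)))"
      by (subst integral_distr) auto
    also have "\<dots> = (\<integral>\<zeta>. f (x + ?S k \<eta> + \<zeta>) \<partial>distr M borel (X 1))"
      using same_distr[of "Suc k"] by simp
    also have "\<dots> = step f (x + ?S k \<eta>)" unfolding step_def by (subst integral_distr) auto
    finally show ?thesis by simp
  qed
  have [measurable]: "step f \<in> borel_measurable borel"
    using quad_growth_step[OF f] by (simp add: quad_growth_def)
  \<comment> \<open>The first \<open>k\<close> increments are independent of the last one; Fubini integrates the latter out.\<close>
  have "alive_mean f x j (Suc k) = (\<integral>\<omega>. ?g (?Y \<omega>, ?Z \<omega>) \<partial>M)"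
    unfolding alive_mean_def using g_eq by (intro Bochner_Integration.integral_cong) auto
  also have "\<dots> = (\<integral>p. ?g p \<partial>distr M (?P \<Otimes>\<^sub>M ?Q) (\<lambda>\<omega>. (?Y \<omega>, ?Z \<omega>)))"
    using g_meas by (subst integral_distr) auto
  also have "\<dots> = (\<integral>p. ?g p \<partial>(distr M ?P ?Y \<Otimes>\<^sub>M distr M ?Q ?Z))" by (simp only: D)
  also have "\<dots> = (\<integral>\<eta>. (\<integral>\<zeta>. ?g (\<eta>, \<zeta>) \<partial>distr M ?Q ?Z) \<partial>distr M ?P ?Y)"
    by (rule DD.integral_fst'[OF intD, symmetric])
  also have "\<dots> = (\<integral>\<eta>. indicator B \<eta> * step f (x + ?S k \<eta>) \<partial>distr M ?P ?Y)"
    by (simp only: inner)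
  also have "\<dots> = (\<integral>\<omega>. indicator B (?Y \<omega>) * step f (x + ?S k (?Y \<omega>)) \<partial>M)"
    by (rule integral_distr) measurable
  also have "\<dots> = alive_mean (step f) x j k"
    unfolding alive_mean_def using B_eq walk_eq[of k] by (intro Bochner_Integration.integral_cong) auto
  finally show ?thesis .
qed

lemma alive_mean_split:
  assumes f: "quad_growth f"
  shows "alive_mean f x j (Suc j) = alive_mean f x (Suc j) (Suc j) + exit_mean f x j"
proof -
  have "alive_mean f x (Suc j) (Suc j) + exit_mean f x j = 
     (\<integral>\<omega>. indicator (alive x (Suc j)) \<omega> * f (x + walk X (Suc j) \<omega>) + 
       indicator (alive x j - alive x (Suc j)) \<omega> * f (x + walk X (Suc j) \<omega>) \<partial>M)"
    unfolding alive_mean_def exit_mean_def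
    by (rule Bochner_Integration.integral_add[symmetric]) (intro integrable_alive integrable_exit f)+
  also have "\<dots> = alive_mean f x j (Suc j)"
    unfolding alive_mean_def
    by (intro Bochner_Integration.integral_cong refl) (use alive_antimono[of j "Suc j" x] in \<open>auto simp: indicator_def\<close>)
  finally show ?thesis ..
qed

lemma alive_mean_mono:
  assumes "quad_growth f" "quad_growth g" "\<And>y. f y \<le> g y"
  shows "alive_mean f x j k \<le> alive_mean g x j k"
  unfolding alive_mean_def
  by (intro integral_mono integrable_alive assms) (auto simp: indicator_def assms(3))

lemma alive_mean_mono_nonneg:
  assumes "quad_growth f" "quad_growth g" "0 \<le> x" "\<And>y. 0 \<le> y \<Longrightarrow> f y \<le> g y"
  shows "alive_mean f x k k \<le> alive_mean g x k k"
  unfolding alive_mean_def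
  by (intro integral_mono integrable_alive assms) (auto simp: indicator_def alive_nonneg[OF \<open>0 \<le> x\<close>] intro: assms(4))

lemma exit_mean_mono:
  assumes "quad_growth f" "quad_growth g" "\<And>y. y < 0 \<Longrightarrow> f y \<le> g y"
  shows "exit_mean f x j \<le> exit_mean g x j"
  unfolding exit_mean_def
  by (intro integral_mono integrable_exit assms) (auto simp: indicator_def alive_Suc intro: assms(3))

lemma exit_mean_cong:
  assumes "\<And>y. y < 0 \<Longrightarrow> f y = g y"
  shows "exit_mean f x j = exit_mean g x j"
  unfolding exit_mean_def
  by (intro Bochner_Integration.integral_cong refl) (use assms in \<open>force simp: indicator_def alive_Suc not_le\<close>)

lemma exit_mean_nonneg: "(\<And>y. y < 0 \<Longrightarrow> 0 \<le> f y) \<Longrightarrow> 0 \<le> exit_mean f x j"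
  unfolding exit_mean_def by (intro integral_nonneg_AE always_eventually allI) (auto simp: indicator_def alive_Suc)

lemma alive_mean_add:
  assumes "quad_growth f" "quad_growth g"
  shows "alive_mean (\<lambda>y. f y + g y) x j k = alive_mean f x j k + alive_mean g x j k"
  unfolding alive_mean_def distrib_left
  by (intro Bochner_Integration.integral_add integrable_alive assms)

lemma exit_mean_add:
  assumes "quad_growth f" "quad_growth g"
  shows "exit_mean (\<lambda>y. f y + g y) x j = exit_mean f x j + exit_mean g x j"
  unfolding exit_mean_def distrib_left
  by (intro Bochner_Integration.integral_add integrable_exit assms)

lemma alive_mean_cmult: "alive_mean (\<lambda>y. c * f y) x j k = c * alive_mean f x j k"
  unfolding alive_mean_def by (simp add: mult.left_commute)

lemma exit_mean_cmult: "exit_mean (\<lambda>y. c * f y) x j = c * exit_mean f x j"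
  unfolding exit_mean_def by (simp add: mult.left_commute)

lemma alive_mean_const: "alive_mean (\<lambda>y. c) x j k = c * prob (alive x j)"
  unfolding alive_mean_def by simp

lemma alive_mean_abs_le:
  assumes f: "quad_growth f" and "\<And>y. \<bar>f y\<bar> \<le> c"
  shows "\<bar>alive_mean f x j k\<bar> \<le> c * prob (alive x j)"
proof -
  have c: "quad_growth (\<lambda>_. c)" for c by (rule quad_growth_bounded[where C="\<bar>c\<bar>"]) auto
  have "alive_mean f x j k \<le> alive_mean (\<lambda>_. c) x j k" "alive_mean (\<lambda>_. - c) x j k \<le> alive_mean f x j k"
    by (intro alive_mean_mono f c; use assms(2) in \<open>auto simp: abs_le_iff minus_le_iff\<close>)+
  then show ?thesis by (simp add: alive_mean_const)
qed

lemma alive_mean_0: "alive_mean f x 0 0 = f x"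
  by (simp add: alive_mean_def alive_0 prob_space)

lemma alive_mean_indicator:
  assumes [measurable]: "B \<in> sets borel"
  shows "alive_mean (indicator B) x j k = prob {\<omega> \<in> alive x j. x + walk X k \<omega> \<in> B}"
proof -
  have [measurable]: "{\<omega> \<in> alive x j. x + walk X k \<omega> \<in> B} \<in> sets M"
    using sets.sets_into_space[OF sets_alive] by measurable
  have "alive_mean (indicator B) x j k = (\<integral>\<omega>. indicator {\<omega> \<in> alive x j. x + walk X k \<omega> \<in> B} \<omega> \<partial>M)"
    unfolding alive_mean_def by (intro Bochner_Integration.integral_cong refl) (simp add: indicator_def)
  then show ?thesis by simp
qed

lemma exit_mean_one: "exit_mean (\<lambda>_. 1) x j = prob (alive x j) - prob (alive x (Suc j))"
  using alive_mean_split[OF quad_growth_const, of 1 x j] by (simp add: alive_mean_const)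

lemma step_shift: "step (\<lambda>y. f (y + c)) y = step f (y + c)"
  by (simp add: step_def ac_simps)

lemma step_diff:
  assumes "quad_growth f" "quad_growth g"
  shows "step (\<lambda>y. f y - g y) y = step f y - step g y"
  unfolding step_def by (intro Bochner_Integration.integral_diff integrable_step assms)

lemma step_cmult: "step (\<lambda>y. c * f y) y = c * step f y"
  unfolding step_def by simp

lemma step_ident: "step (\<lambda>y. y) y = y"
  unfolding step_def using int1 mean by (simp add: prob_space)

section \<open>Replacement on the whole line and concentration\<close>

text \<open>
The absolute moment of order \<open>2 + \<delta>\<close> of an increment.
\<close>

definition moment :: real where
  "moment = (\<integral>\<omega>. \<bar>X 1 \<omega>\<bar> powr (2 + \<delta>) \<partial>M)"

lemma moment_nonneg: "0 \<le> moment"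
  unfolding moment_def by (intro integral_nonneg_AE) auto

text \<open>
The constant in the one-step replacement error.
\<close>

definition heat_const :: real where
  "heat_const = 2 * moment + 4 * v\<^sup>2"

lemma heat_const_pos: "0 < heat_const"
  unfolding heat_const_def using moment_nonneg v_pos by (intro add_nonneg_pos) auto

lemma heat_step:
  assumes "1 \<le> s"
  shows "\<bar>step (heat s) y - heat (s + v) y\<bar> \<le> heat_const * s powr (- 1 - \<delta> / 2)"
proof -
  \<comment> \<open>The linear and the quadratic Taylor terms cancel in the mean: the increment is centred, and its variance is matched by the time step \<open>v\<close>.\<close>
  define b where "b = gauss (y / sqrt s) / sqrt s"
  define g where "g = y / sqrt s * gauss (y / sqrt s) / (2 * s)"
  let ?R = "\<lambda>\<omega>. heat s (y + X 1 \<omega>) - heat (s + v) y - b * X 1 \<omega> + (g * (X 1 \<omega>)\<^sup>2 - g * v)"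
  have i: "integrable M (\<lambda>\<omega>. heat s (y + X 1 \<omega>))" by (rule integrable_step[OF quad_growth_heat])
  have "(\<integral>\<omega>. ?R \<omega> \<partial>M) = step (heat s) y - heat (s + v) y - b * (\<integral>\<omega>. X 1 \<omega> \<partial>M) + (g * (\<integral>\<omega>. (X 1 \<omega>)\<^sup>2 \<partial>M) - g * v)"
    unfolding step_def using i int1 int2 by (simp add: prob_space)
  then have eq: "(\<integral>\<omega>. ?R \<omega> \<partial>M) = step (heat s) y - heat (s + v) y"
    by (simp add: mean[simplified] variance[simplified])
  have "\<bar>\<integral>\<omega>. ?R \<omega> \<partial>M\<bar> \<le> (\<integral>\<omega>. (2 * \<bar>X 1 \<omega>\<bar> powr (2 + \<delta>) + 4 * v\<^sup>2) * s powr (- 1 - \<delta> / 2) \<partial>M)"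
  proof (rule order_trans[OF integral_abs_bound integral_mono])
    show "integrable M (\<lambda>\<omega>. \<bar>?R \<omega>\<bar>)" using i int1 int2 by (intro integrable_abs) simp
    show "integrable M (\<lambda>\<omega>. (2 * \<bar>X 1 \<omega>\<bar> powr (2 + \<delta>) + 4 * v\<^sup>2) * s powr (- 1 - \<delta> / 2))"
      using int_moment by simp
    fix \<omega>
    have "?R \<omega> = heat s (y + X 1 \<omega>) - heat (s + v) y - X 1 \<omega> / sqrt s * gauss (y / sqrt s)
           + ((X 1 \<omega>)\<^sup>2 - v) / (2 * s) * (y / sqrt s * gauss (y / sqrt s))"
      by (simp add: b_def g_def diff_divide_distrib algebra_simps)
    then show "\<bar>?R \<omega>\<bar> \<le> (2 * \<bar>X 1 \<omega>\<bar> powr (2 + \<delta>) + 4 * v\<^sup>2) * s powr (- 1 - \<delta> / 2)"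
      using heat_step_pointwise[OF assms \<delta> v_pos, of y "X 1 \<omega>"] by (simp only:)
  qed
  also have "\<dots> = heat_const * s powr (- 1 - \<delta> / 2)"
    using int_moment by (simp add: heat_const_def moment_def prob_space)
  finally show ?thesis unfolding eq .
qed

text \<open>
Iterated replacement after a fixed time \<open>j\<close>, for any family that satisfies the one-step estimate.
\<close>

lemma alive_mean_iterate:
  assumes G: "\<And>s. quad_growth (G s)"
    and step: "\<And>s y. 1 \<le> s \<Longrightarrow> \<bar>step (G s) y - G (s + v) y\<bar> \<le> D * s powr (- 1 - \<delta> / 2)"
    and "1 \<le> s"
  shows "alive_mean (G s) x j (j + m) \<le> alive_mean (G (s + real m * v)) x j j 
           + D * (\<Sum>i<m. (s + real i * v) powr (- 1 - \<delta> / 2)) * prob (alive x j)"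
  using \<open>1 \<le> s\<close>
proof (induction m arbitrary: s)
  case (Suc m)
  let ?e = "D * s powr (- 1 - \<delta> / 2)"
  have "alive_mean (G s) x j (j + Suc m) = alive_mean (step (G s)) x j (j + m)"
    using alive_mean_Suc[OF G, of j "j + m" s x] by simp
  also have "\<dots> \<le> alive_mean (\<lambda>y. G (s + v) y + ?e) x j (j + m)"
  proof (rule alive_mean_mono)
    show "step (G s) y \<le> G (s + v) y + ?e" for y
      using step[OF Suc.prems, of y] by linarith
  qed (intro quad_growth_step quad_growth_add quad_growth_const G)+
  also have "\<dots> = alive_mean (G (s + v)) x j (j + m) + ?e * prob (alive x j)"
    by (subst alive_mean_add) (auto simp: alive_mean_const intro: G quad_growth_const)
  also have "alive_mean (G (s + v)) x j (j + m) \<le> alive_mean (G (s + v + real m * v)) x j j 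
           + D * (\<Sum>i<m. (s + v + real i * v) powr (- 1 - \<delta> / 2)) * prob (alive x j)"
    using Suc.prems v_pos by (intro Suc.IH) auto
  also have "s + v + real m * v = s + real (Suc m) * v" by (simp add: algebra_simps)
  also have "(\<Sum>i<m. (s + v + real i * v) powr (- 1 - \<delta> / 2)) = (\<Sum>i<m. (s + real (Suc i) * v) powr (- 1 - \<delta> / 2))"
    by (simp add: algebra_simps)
  also have "\<dots> = (\<Sum>i<Suc m. (s + real i * v) powr (- 1 - \<delta> / 2)) - s powr (- 1 - \<delta> / 2)"
    by (subst sum.lessThan_Suc_shift) simp
  finally show ?case by (simp add: algebra_simps)
qed simp

text \<open>
Survival up to time \<open>j\<close>, and distance at most \<open>a\<close> from \<open>z\<close> at time \<open>k\<close>.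
\<close>

abbreviation alive_near :: "real \<Rightarrow> nat \<Rightarrow> nat \<Rightarrow> real \<Rightarrow> real \<Rightarrow> 'a set" where
  "alive_near x j k z a \<equiv> {\<omega> \<in> alive x j. \<bar>x + walk X k \<omega> - z\<bar> \<le> a}"

text \<open>
Given survival up to time \<open>j\<close>, the walk \<open>m\<close> steps later is in a given interval of half-width \<open>a\<close> with
probability \<open>O(a / sqrt m + a powr (- \<delta>))\<close>.
\<close>

lemma concentration:
  "\<exists>C>0. \<forall>a z x j m. 1 \<le> a \<longrightarrow> 1 \<le> m \<longrightarrow>
     prob (alive_near x j (j + m) z a) \<le> C * (a / sqrt (real m) + a powr (- \<delta>)) * prob (alive x j)"
proof -
  define K where "K = (1 + v) powr (1 + \<delta> / 2) / (\<delta> / 2 * v)"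
  define c0 where "c0 = gauss_int 1"
  define C where "C = (2 / sqrt v + 2 * heat_const * K) / c0"
  have c0: "0 < c0" by (simp add: c0_def gauss_int_1_pos)
  have K: "0 < K" using v_pos \<delta> by (simp add: K_def)
  have C: "0 < C" unfolding C_def using c0 K heat_const_pos v_pos by (intro divide_pos_pos add_pos_pos mult_pos_pos) auto
  have "prob (alive_near x j (j + m) z a) \<le> C * (a / sqrt (real m) + a powr (- \<delta>)) * prob (alive x j)"
    if a: "1 \<le> a" and m: "1 \<le> m" for a z x :: real and j m :: nat
  proof -
    \<comment> \<open>A smooth bump of width \<open>a\<close> around \<open>z\<close>, at least \<open>gauss_int 1\<close> on the interval in question.\<close>
    define G where "G s y = heat s (y + (a - z)) - heat s (y + (- a - z))" for s y
    let ?B = "alive_near x j (j + m) z a"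
    have B: "?B \<in> sets M" 
      using sets.sets_into_space[OF sets_alive] by measurable
    have G: "quad_growth (G s)" for s
      unfolding G_def[abs_def] by (intro quad_growth_diff quad_growth_heat_shift)
    have step: "\<bar>step (G s) y - G (s + v) y\<bar> \<le> 2 * heat_const * s powr (- 1 - \<delta> / 2)" if "1 \<le> s" for s y
      unfolding G_def[abs_def] step_diff[OF quad_growth_heat_shift quad_growth_heat_shift] step_shift
      using heat_step[OF that, of "y + (a - z)"] heat_step[OF that, of "y + (- a - z)"] by linarith
    have a2: "1 \<le> a\<^sup>2" "0 < a\<^sup>2" using a by auto
    have "c0 * prob ?B = (\<integral>\<omega>. c0 * indicator ?B \<omega> \<partial>M)" using B by simp
    also have "\<dots> \<le> alive_mean (G (a\<^sup>2)) x j (j + m)"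
      unfolding alive_mean_def
    proof (intro integral_mono integrable_alive G)
      fix \<omega>
      show "c0 * indicator ?B \<omega> \<le> indicator (alive x j) \<omega> * G (a\<^sup>2) (x + walk X (j + m) \<omega>)"
      proof (cases "\<omega> \<in> ?B")
        case True
        then have "c0 \<le> G (a\<^sup>2) (x + walk X (j + m) \<omega>)"
          using heat_bump_ge[of a "x + walk X (j + m) \<omega> - z"] a by (simp add: G_def c0_def algebra_simps)
        with True show ?thesis by simp
      next
        case False
        have "0 \<le> G (a\<^sup>2) y" for y unfolding G_def using a heat_mono[OF a2(2)] by simp
        with False show ?thesis by simp
      qed
    qed (intro integrable_mult_right integrable_real_indicator B emeasure_finite; simp add: less_top[symmetric])
    also have "\<dots> \<le> alive_mean (G (a\<^sup>2 + real m * v)) x j j 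
           + 2 * heat_const * (\<Sum>i<m. (a\<^sup>2 + real i * v) powr (- 1 - \<delta> / 2)) * prob (alive x j)"
      by (rule alive_mean_iterate[OF G step a2(1)])
    also have "\<dots> \<le> 2 * a / sqrt (real m * v) * prob (alive x j) + 2 * heat_const * (K * a powr (- \<delta>)) * prob (alive x j)"
    proof (intro add_mono mult_right_mono mult_left_mono)
      have s: "0 < real m * v" "real m * v \<le> a\<^sup>2 + real m * v" "0 < a\<^sup>2 + real m * v"
        using m v_pos a2 by (auto intro: add_pos_pos)
      have "\<bar>G (a\<^sup>2 + real m * v) y\<bar> \<le> 2 * a / sqrt (real m * v)" for y
      proof -
        have "\<bar>G (a\<^sup>2 + real m * v) y\<bar> \<le> 2 * a / sqrt (a\<^sup>2 + real m * v)"
          unfolding G_def using heat_lipschitz[OF s(3), of "y + (a - z)" "y + (- a - z)"] a by simp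
        also have "\<dots> \<le> 2 * a / sqrt (real m * v)"
          using s a by (intro divide_left_mono) auto
        finally show ?thesis .
      qed
      from alive_mean_abs_le[OF G this, of x j j]
      show "alive_mean (G (a\<^sup>2 + real m * v)) x j j \<le> 2 * a / sqrt (real m * v) * prob (alive x j)" by linarith
      have "(\<Sum>i<m. (a\<^sup>2 + real i * v) powr (- 1 - \<delta> / 2)) \<le> K * (a\<^sup>2) powr (- (\<delta> / 2))"
        unfolding K_def using a2 v_pos \<delta> by (intro sum_powr_le) auto
      also have "(a\<^sup>2) powr (- (\<delta> / 2)) = a powr (- \<delta>)"
        using a by (simp add: powr_powr flip: powr_numeral)
      finally show "(\<Sum>i<m. (a\<^sup>2 + real i * v) powr (- 1 - \<delta> / 2)) \<le> K * a powr (- \<delta>)" .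
    qed (use heat_const_pos in auto)
    also have "\<dots> = (2 / sqrt v * (a / sqrt (real m)) + 2 * heat_const * K * a powr (- \<delta>)) * prob (alive x j)"
      using v_pos m by (simp add: real_sqrt_mult algebra_simps)
    also have "\<dots> \<le> ((2 / sqrt v + 2 * heat_const * K) * (a / sqrt (real m)) + (2 / sqrt v + 2 * heat_const * K) * a powr (- \<delta>)) * prob (alive x j)"
      using v_pos m a K heat_const_pos by (intro mult_right_mono add_mono) auto
    also have "\<dots> = c0 * (C * (a / sqrt (real m) + a powr (- \<delta>)) * prob (alive x j))"
    proof -
      have "2 / sqrt v + 2 * heat_const * K = c0 * C" using c0 by (simp add: C_def)
      then show ?thesis by (simp only:) (simp add: algebra_simps)
    qed
    finally show ?thesis using c0 by (simp only: mult_le_cancel_left_pos)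
  qed
  then show ?thesis using C by blast
qed

section \<open>The overshoot\<close>

lemma barrier_supermartingale:
  "\<exists>r\<ge>1. \<forall>y\<ge>0. step (barrier \<delta> r) y \<le> barrier \<delta> r y"
proof -
  define \<kappa> where "\<kappa> = \<delta> * (1 - \<delta> / 2) / 9"
  have \<kappa>: "0 < \<kappa>" using \<delta> by (simp add: \<kappa>_def)
  define q where "q = 1 + moment * (\<kappa> + 9) / (\<kappa> * v)"
  define r where "r = q powr (1 / \<delta>)"
  have q: "1 \<le> q" using \<kappa> v_pos moment_nonneg by (auto simp: q_def intro!: divide_nonneg_nonneg mult_nonneg_nonneg)
  have r: "1 \<le> r" unfolding r_def using q \<delta> by (intro ge_one_powr_ge_zero) auto
  have rd: "r powr \<delta> = q" using q \<delta> by (simp add: r_def powr_powr)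
  \<comment> \<open>The radius \<open>r\<close> is chosen for this inequality.\<close>
  have key: "(\<kappa> + 9) * moment \<le> \<kappa> * r powr \<delta> * v"
    unfolding rd q_def using \<kappa> v_pos by (simp add: field_simps)
  have "step (barrier \<delta> r) y \<le> barrier \<delta> r y" if y: "0 \<le> y" for y
  proof -
    define z where "z = y + 2 * r"
    define b where "b = r powr \<delta> * z powr (- \<delta> / 2) * (1 - \<delta> / 2)"
    define d where "d = \<kappa> * r powr \<delta> * z powr (- 1 - \<delta> / 2)"
    define e where "e = (\<kappa> + 9) * z powr (- 1 - \<delta> / 2)"
    have "quad_growth (barrier \<delta> r)"
      using barrier_quadratic[OF r \<delta>] by (intro quad_growthI) auto
    then have "step (barrier \<delta> r) y \<le> (\<integral>\<omega>. barrier \<delta> r y + b * X 1 \<omega> - d * (X 1 \<omega>)\<^sup>2 + e * \<bar>X 1 \<omega>\<bar> powr (2 + \<delta>) \<partial>M)"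
      unfolding step_def
      using barrier_step_pointwise[OF r \<delta> y] int1 int2 int_moment
      by (intro integral_mono integrable_step) (auto simp: b_def d_def e_def z_def \<kappa>_def)
    also have "\<dots> = barrier \<delta> r y + b * (\<integral>\<omega>. X 1 \<omega> \<partial>M) - d * (\<integral>\<omega>. (X 1 \<omega>)\<^sup>2 \<partial>M) + e * moment"
      unfolding moment_def using int1 int2 int_moment by (simp add: prob_space)
    also have "\<dots> = barrier \<delta> r y - d * v + e * moment"
      by (simp add: mean[simplified] variance[simplified])
    also have "e * moment \<le> d * v"
      using mult_right_mono[OF key, of "z powr (- 1 - \<delta> / 2)"] by (simp add: d_def e_def algebra_simps)
    finally show ?thesis by simp
  qed
  then show ?thesis using r by blast
qed

text \<open>
Optional stopping for a nonnegative function that is superharmonic on the half-line.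
\<close>

lemma exit_sum_le:
  assumes W: "quad_growth W" "\<And>y. 0 \<le> W y" "\<And>y. 0 \<le> y \<Longrightarrow> step W y \<le> W y"
    and x: "0 \<le> x" and "k \<le> n"
  shows "(\<Sum>j=k..<n. exit_mean W x j) \<le> alive_mean W x k k"
proof -
  have "(\<Sum>j=k..<n. exit_mean W x j) \<le> alive_mean W x k k - alive_mean W x n n"
    using \<open>k \<le> n\<close>
  proof (induction n rule: dec_induct)
    case (step n)
    have "alive_mean W x n (Suc n) = alive_mean (local.step W) x n n"
      by (rule alive_mean_Suc[OF W(1)]) simp
    also have "\<dots> \<le> alive_mean W x n n"
      using W x by (intro alive_mean_mono_nonneg quad_growth_step) auto
    finally show ?case using step alive_mean_split[OF W(1), of x n] by simp
  qed simp
  moreover have "0 \<le> alive_mean W x n n"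
    unfolding alive_mean_def using W(2) by (intro integral_nonneg_AE) auto
  ultimately show ?thesis by simp
qed

text \<open>
The mean distance below zero at the exit, on the event \<open>\<tau>\<^sub>x = j + 1\<close>.
\<close>

definition overshoot :: "real \<Rightarrow> nat \<Rightarrow> real" where
  "overshoot x j = exit_mean (\<lambda>y. \<bar>y\<bar>) x j"

lemma overshoot_nonneg: "0 \<le> overshoot x j"
  unfolding overshoot_def by (rule exit_mean_nonneg) simp

text \<open>
The moment of the overshoot of order \<open>1 + \<delta> / 2\<close> at one exit time, and the mean of a power below one of the
surviving walk, which dominates all later overshoot.
\<close>

abbreviation overshoot_power :: "real \<Rightarrow> nat \<Rightarrow> real" where
  "overshoot_power x j \<equiv> exit_mean (\<lambda>y. \<bar>y\<bar> powr (1 + \<delta> / 2)) x j"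

abbreviation alive_power :: "real \<Rightarrow> nat \<Rightarrow> real" where
  "alive_power x k \<equiv> alive_mean (\<lambda>y. (1 + \<bar>y\<bar>) powr (1 - \<delta> / 2)) x k k"

lemma overshoot_sums:
  "\<exists>C>0. \<forall>x k n. 0 \<le> x \<longrightarrow> k \<le> n \<longrightarrow>
      (\<Sum>j=k..<n. overshoot x j) \<le> C * alive_power x k \<and>
      (\<Sum>j=k..<n. overshoot_power x j) \<le> C * alive_power x k"
proof -
  obtain r where r: "1 \<le> r" and super: "\<And>y. 0 \<le> y \<Longrightarrow> step (barrier \<delta> r) y \<le> barrier \<delta> r y"
    using barrier_supermartingale by blast
  have W: "quad_growth (barrier \<delta> r)"
    using barrier_quadratic[OF r \<delta>] by (intro quad_growthI) auto
  have P: "quad_growth (\<lambda>y. (1 + \<bar>y\<bar>) powr (1 - \<delta> / 2))" "quad_growth (\<lambda>y. \<bar>y\<bar> powr (1 + \<delta> / 2))"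
    using \<delta> by (auto intro: quad_growth_powr)
  have "(\<Sum>j=k..<n. overshoot x j) \<le> (2 * r\<^sup>2) * alive_power x k \<and>
      (\<Sum>j=k..<n. overshoot_power x j) \<le> (2 * r\<^sup>2) * alive_power x k"
    if x: "0 \<le> x" and kn: "k \<le> n" for x k n
  proof -
    have "(\<Sum>j=k..<n. exit_mean (barrier \<delta> r) x j) \<le> alive_mean (barrier \<delta> r) x k k"
      by (rule exit_sum_le[OF W barrier_nonneg super x kn])
    also have "\<dots> \<le> alive_mean (\<lambda>y. (2 * r\<^sup>2) * (1 + \<bar>y\<bar>) powr (1 - \<delta> / 2)) x k k"
      using barrier_growth[OF r \<delta>] by (intro alive_mean_mono_nonneg W quad_growth_cmult P x) auto
    finally have *: "(\<Sum>j=k..<n. exit_mean (barrier \<delta> r) x j) \<le> (2 * r\<^sup>2) * alive_power x k"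
      by (simp only: alive_mean_cmult)
    have "(\<Sum>j=k..<n. overshoot x j) \<le> (\<Sum>j=k..<n. exit_mean (barrier \<delta> r) x j)"
      unfolding overshoot_def
      by (intro sum_mono exit_mean_mono W quad_growth_abs_ident barrier_ge_negative(2)[OF r \<delta>])
    moreover have "(\<Sum>j=k..<n. overshoot_power x j) \<le> (\<Sum>j=k..<n. exit_mean (barrier \<delta> r) x j)"
      by (intro sum_mono exit_mean_mono W P barrier_ge_negative(1)[OF r \<delta>])
    ultimately show ?thesis using * by linarith
  qed
  moreover have "0 < 2 * r\<^sup>2" using r by simp
  ultimately show ?thesis by blast
qed

lemma one_plus_powr_le_self: "0 \<le> x \<Longrightarrow> (1 + x) powr (1 - \<delta> / 2) \<le> 1 + x"
  using powr_mono[of "1 - \<delta> / 2" 1 "1 + x"] \<delta> by simp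

lemma overshoot_total:
  "\<exists>C>0. \<forall>x n. 0 \<le> x \<longrightarrow> (\<Sum>j<n. overshoot x j) \<le> C * (1 + x) \<and>
      (\<Sum>j<n. overshoot_power x j) \<le> C * (1 + x)"
proof -
  from overshoot_sums obtain C where C: "C > 0" and *: "\<And>x k n. 0 \<le> x \<Longrightarrow> k \<le> n \<Longrightarrow>
      (\<Sum>j=k..<n. overshoot x j) \<le> C * alive_power x k \<and>
      (\<Sum>j=k..<n. overshoot_power x j) \<le> C * alive_power x k"
    by blast
  have "(\<Sum>j<n. overshoot x j) \<le> C * (1 + x) \<and>
      (\<Sum>j<n. overshoot_power x j) \<le> C * (1 + x)" if x: "0 \<le> x" for x n
  proof -
    have "C * alive_power x 0 \<le> C * (1 + x)"
      unfolding alive_mean_0 using C x one_plus_powr_le_self[OF x] by (intro mult_left_mono) auto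
    with *[OF x le0, of n] show ?thesis
      unfolding atLeast0LessThan by linarith
  qed
  with C show ?thesis by blast
qed

text \<open>
Since the walk is a martingale, its mean on survival is the starting point plus the overshoot so far.
\<close>

lemma alive_mean_ident: 
  assumes "0 \<le> x"
  shows "alive_mean (\<lambda>y. y) x n n = x + (\<Sum>j<n. overshoot x j)"
proof (induction n)
  case 0 show ?case by (simp add: alive_mean_0)
next
  case (Suc n)
  have "alive_mean (\<lambda>y. y) x n (Suc n) = alive_mean (\<lambda>y. y) x n n"
    by (simp add: alive_mean_Suc quad_growth_ident step_ident[abs_def])
  moreover have "exit_mean (\<lambda>y. y) x n = - overshoot x n"
    using exit_mean_cong[of "\<lambda>y. y" "\<lambda>y. - 1 * \<bar>y\<bar>" x n] unfolding exit_mean_cmult overshoot_def by simp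
  ultimately show ?case
    using alive_mean_split[OF quad_growth_ident, of x n] Suc by simp
qed

lemma alive_mean_ident_le: "\<exists>C>0. \<forall>x n. 0 \<le> x \<longrightarrow> alive_mean (\<lambda>y. y) x n n \<le> C * (1 + x)"
proof -
  from overshoot_total obtain C where C: "C > 0" "\<And>x n. 0 \<le> x \<Longrightarrow> (\<Sum>j<n. overshoot x j) \<le> C * (1 + x)"
    by blast
  then have "alive_mean (\<lambda>y. y) x n n \<le> (C + 1) * (1 + x)" if "0 \<le> x" for x n
    unfolding alive_mean_ident[OF that] distrib_right using C(2)[OF that, of n] by simp
  moreover have "C + 1 > 0" using C by simp
  ultimately show ?thesis by blast
qed

section \<open>The survival probability\<close>

lemma survival_bound:
  "\<exists>C>0. \<forall>x n. 0 \<le> x \<longrightarrow> prob (alive x n) \<le> C * (1 + x) / sqrt (real n + 1)"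
proof -
  obtain C where C: "0 < C" and conc: "\<And>a z x j m. 1 \<le> a \<Longrightarrow> 1 \<le> m \<Longrightarrow>
     prob (alive_near x j (j + m) z a) \<le> C * (a / sqrt (real m) + a powr (- \<delta>)) * prob (alive x j)"
    using concentration by blast
  obtain L where L: "0 < L" and mean_le: "\<And>x n. 0 \<le> x \<Longrightarrow> alive_mean (\<lambda>y. y) x n n \<le> L * (1 + x)"
    using alive_mean_ident_le by blast
  \<comment> \<open>\<open>\<theta>\<close> and \<open>n0\<close> make the concentration bound for an interval of half-width \<open>\<theta> * sqrt n\<close> at most \<open>1 / 4\<close>.\<close>
  define \<theta> where "\<theta> = 1 / (16 * C)"
  have \<theta>: "0 < \<theta>" "C * \<theta> = 1 / 16" using C by (auto simp: \<theta>_def)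
  define a0 where "a0 = max 1 ((8 * C) powr (1 / \<delta>))"
  have a0: "1 \<le> a0" by (simp add: a0_def)
  have small: "C * a powr (- \<delta>) \<le> 1 / 8" if "a0 \<le> a" for a
  proof -
    have "((8 * C) powr (1 / \<delta>)) powr \<delta> \<le> a powr \<delta>"
      using that \<delta> by (intro powr_mono2) (auto simp: a0_def)
    then have "8 * C \<le> a powr \<delta>" using \<delta> C by (simp add: powr_powr)
    then show ?thesis using a0 that by (simp add: powr_minus_divide field_simps)
  qed
  define n0 where "n0 = nat \<lceil>(a0 / \<theta>)\<^sup>2\<rceil> + 1"
  have n0: "a0 \<le> \<theta> * sqrt (real n)" if "n0 \<le> n" for n
  proof -
    have "(a0 / \<theta>)\<^sup>2 \<le> real n" using that unfolding n0_def by linarith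
    then have "a0 / \<theta> \<le> sqrt (real n)" by (rule real_le_rsqrt)
    then show ?thesis using a0 \<theta> by (simp add: field_simps)
  qed
  \<comment> \<open>Either the walk is below \<open>2 a\<close> at time \<open>n\<close>, which has conditional probability at most \<open>1 / 4\<close> given survival up to \<open>n div 2\<close>, or Markov's inequality applies.\<close>
  have rec: "prob (alive x n) \<le> 1 / 4 * prob (alive x (n div 2)) + L * (1 + x) / (2 * \<theta> * sqrt (real n))"
    if n: "n0 \<le> n" and x: "0 \<le> x" for n x
  proof -
    define a where "a = \<theta> * sqrt (real n)"
    define j where "j = n div 2"
    define m where "m = n - j"
    have nj: "n = j + m" and m: "1 \<le> m" and mn: "real n \<le> 4 * real m"
      using n unfolding j_def m_def n0_def by (simp, linarith, linarith)
    have a: "a0 \<le> a" "1 \<le> a" using n0[OF n] a0 by (auto simp: a_def)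
    let ?B = "alive_near x j (j + m) a a"
    have B: "?B \<in> sets M" using sets.sets_into_space[OF sets_alive] by measurable
    have "sqrt (real n) \<le> sqrt (4 * real m)" using mn by (intro real_sqrt_le_mono)
    then have "sqrt (real n) \<le> 2 * sqrt (real m)" by (simp only: real_sqrt_mult real_sqrt_four)
    then have "a / sqrt (real m) \<le> 2 * \<theta>"
      unfolding a_def using \<theta> m by (simp add: divide_le_eq)
    then have "C * (a / sqrt (real m)) \<le> C * (2 * \<theta>)" using C by (intro mult_left_mono) auto
    then have "C * (a / sqrt (real m) + a powr (- \<delta>)) \<le> 1 / 4"
      using small[OF a(1)] \<theta> by (simp add: distrib_left)
    then have "C * (a / sqrt (real m) + a powr (- \<delta>)) * prob (alive x j) \<le> 1 / 4 * prob (alive x j)"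
      by (intro mult_right_mono) auto
    then have B_le: "prob ?B \<le> 1 / 4 * prob (alive x j)"
      using conc[OF a(2) m, of x j a] by linarith
    have "prob (alive x n) = (\<integral>\<omega>. indicator (alive x n) \<omega> \<partial>M)" by simp
    also have "\<dots> \<le> (\<integral>\<omega>. indicator ?B \<omega> + 1 / (2 * a) * (indicator (alive x n) \<omega> * (x + walk X n \<omega>)) \<partial>M)"
    proof (rule integral_mono)
      show "integrable M (\<lambda>\<omega>. indicator ?B \<omega> + 1 / (2 * a) * (indicator (alive x n) \<omega> * (x + walk X n \<omega>)))"
        using B integrable_alive[OF quad_growth_ident]
        by (intro Bochner_Integration.integrable_add integrable_mult_right integrable_real_indicator)
           (auto simp: less_top[symmetric])
      fix \<omega>
      show "indicator (alive x n) \<omega> \<le> indicator ?B \<omega> + 1 / (2 * a) * (indicator (alive x n) \<omega> * (x + walk X n \<omega>))"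
      proof (cases "\<omega> \<in> alive x n")
        case True
        have p: "0 \<le> x + walk X n \<omega>" using alive_nonneg[OF x True] .
        show ?thesis
        proof (cases "x + walk X n \<omega> \<le> 2 * a")
          case le: True
          have "\<omega> \<in> ?B" using True le p alive_antimono[of j n x] nj by auto
          then show ?thesis using p a True by simp
        next
          case False
          then have "1 \<le> 1 / (2 * a) * (x + walk X n \<omega>)" using a by (simp add: field_simps)
          then show ?thesis using True by (simp add: add_increasing)
        qed
      qed simp
    qed (simp add: less_top[symmetric])
    also have "\<dots> = prob ?B + 1 / (2 * a) * alive_mean (\<lambda>y. y) x n n"
      unfolding alive_mean_def using B integrable_alive[OF quad_growth_ident]
      by (subst Bochner_Integration.integral_add) (auto simp: less_top[symmetric])
    also have "\<dots> \<le> 1 / 4 * prob (alive x j) + 1 / (2 * a) * (L * (1 + x))"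
      using B_le mean_le[OF x, of n] a by (intro add_mono mult_left_mono) auto
    finally show ?thesis by (simp add: a_def j_def mult.assoc)
  qed
  define B where "B = max (sqrt (real n0 + 1)) (2 * L / \<theta>)"
  have B: "sqrt (real n0 + 1) \<le> B" "2 * L / \<theta> \<le> B" "0 < B"
    unfolding B_def using L \<theta> by (auto simp: less_max_iff_disj)
  have "prob (alive x n) \<le> B * (1 + x) / sqrt (real n + 1)" if x: "0 \<le> x" for x n
  proof (induction n rule: less_induct)
    case (less n)
    show ?case
    proof (cases "n < n0")
      case True
      have "prob (alive x n) * sqrt (real n + 1) \<le> 1 * sqrt (real n0 + 1)"
        using True by (intro mult_mono) auto
      also have "\<dots> \<le> B * 1" using B by simp
      also have "\<dots> \<le> B * (1 + x)" using B x by (intro mult_left_mono) auto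
      finally show ?thesis by (simp add: field_simps)
    next
      case False
      then have n: "n0 \<le> n" "1 \<le> n" by (auto simp: n0_def)
      let ?w = "(1 + x) / sqrt (real n + 1)"
      have "n div 2 < n" using n by auto
      note less[OF this]
      also have "B * (1 + x) / sqrt (real (n div 2) + 1) = (B * (1 + x)) * (1 / sqrt (real (n div 2) + 1))" by simp
      also have "\<dots> \<le> (B * (1 + x)) * (2 / sqrt (real n + 1))"
      proof (intro mult_left_mono inverse_sqrt_le)
        have "n + 1 \<le> 4 * (n div 2 + 1)" by presburger
        then have "real (n + 1) \<le> real (4 * (n div 2 + 1))" by (simp only: of_nat_le_iff)
        then show "real n + 1 \<le> 4 * (real (n div 2) + 1)" by simp
      qed (use B x in auto)
      finally have 1: "prob (alive x (n div 2)) \<le> 2 * (B * ?w)" by (simp add: field_simps)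
      have "L * (1 + x) / (2 * \<theta> * sqrt (real n)) = (L * (1 + x) / (2 * \<theta>)) * (1 / sqrt (real n))" by simp
      also have "\<dots> \<le> (L * (1 + x) / (2 * \<theta>)) * (2 / sqrt (real n + 1))"
        using L \<theta> x n by (intro mult_left_mono inverse_sqrt_le) auto
      also have "\<dots> = 2 * L / \<theta> / 2 * ?w" by simp
      also have "\<dots> \<le> B / 2 * ?w" using B(2) x by (intro mult_right_mono divide_right_mono) simp_all
      finally have 2: "L * (1 + x) / (2 * \<theta> * sqrt (real n)) \<le> B * ?w / 2" by simp
      have "p \<le> b" if "p \<le> 1 / 4 * q + r" "q \<le> 2 * b" "r \<le> b / 2" for p q r b :: real
        using that by linarith
      from this[OF rec[OF n(1) x] 1 2] have "prob (alive x n) \<le> B * ?w" .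
      then show ?thesis by simp
    qed
  qed
  with B show ?thesis by blast
qed

text \<open>
Late exits contribute little overshoot: after surviving \<open>k\<close> steps the expected overshoot is only of
the order of a power less than one of the position.
\<close>

lemma overshoot_tail:
  "\<exists>C>0. \<forall>x k n. 0 \<le> x \<longrightarrow> 1 \<le> k \<longrightarrow> k \<le> n \<longrightarrow> (\<Sum>j=k..<n. overshoot x j) \<le> C * (1 + x) * real k powr (- \<delta> / 4)"
proof -
  obtain C where C: "0 < C" and sums: "\<And>x k n. 0 \<le> x \<Longrightarrow> k \<le> n \<Longrightarrow>
      (\<Sum>j=k..<n. overshoot x j) \<le> C * alive_power x k"
    using overshoot_sums by blast
  obtain L where L: "0 < L" and mean_le: "\<And>x n. 0 \<le> x \<Longrightarrow> alive_mean (\<lambda>y. y) x n n \<le> L * (1 + x)"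
    using alive_mean_ident_le by blast
  obtain S where S: "0 < S" and surv: "\<And>x n. 0 \<le> x \<Longrightarrow> prob (alive x n) \<le> S * (1 + x) / sqrt (real n + 1)"
    using survival_bound by blast
  have "(\<Sum>j=k..<n. overshoot x j) \<le> (C * (1 + L + S)) * (1 + x) * real k powr (- \<delta> / 4)"
    if x: "0 \<le> x" and k: "1 \<le> k" "k \<le> n" for x k n
  proof -
    define A where "A = sqrt (real k)"
    define e where "e = \<delta> / 2"
    have A: "1 \<le> A" using k by (simp add: A_def)
    have e: "0 < e" "e < 1" using \<delta> by (auto simp: e_def)
    \<comment> \<open>The threshold \<open>A = sqrt k\<close> balances the mean of the surviving walk against the survival probability.\<close>
    have pointwise: "(1 + \<bar>y\<bar>) powr (1 - e) \<le> A powr (- e) * y + (A powr (- e) + A powr (1 - e))" if y: "0 \<le> y" for y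
    proof (cases "1 + y \<le> A")
      case True
      have "(1 + y) powr (1 - e) \<le> A powr (1 - e)" using True y e by (intro powr_mono2) auto
      moreover have "0 \<le> A powr (- e) * y" using y by simp
      ultimately show ?thesis using y by (simp add: add_increasing)
    next
      case False
      have "(1 + y) powr (1 - e) = (1 + y) * (1 + y) powr (- e)" using y by (simp add: powr_diff powr_minus_divide)
      also have "\<dots> \<le> (1 + y) * A powr (- e)"
        using False A e y by (intro mult_left_mono powr_mono2') auto
      also have "\<dots> = A powr (- e) * y + A powr (- e)" by (simp add: distrib_right mult.commute)
      also have "\<dots> \<le> A powr (- e) * y + (A powr (- e) + A powr (1 - e))" by simp
      finally show ?thesis using y by simp
    qed
    have q: "quad_growth (\<lambda>y. (1 + \<bar>y\<bar>) powr (1 - e))" using e by (intro quad_growth_powr) auto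
    have "(\<Sum>j=k..<n. overshoot x j) \<le> C * alive_mean (\<lambda>y. (1 + \<bar>y\<bar>) powr (1 - e)) x k k"
      unfolding e_def by (rule sums[OF x k(2)])
    also have "\<dots> \<le> C * alive_mean (\<lambda>y. A powr (- e) * y + (A powr (- e) + A powr (1 - e))) x k k"
      using C pointwise
      by (intro mult_left_mono alive_mean_mono_nonneg q quad_growth_add quad_growth_cmult quad_growth_ident quad_growth_const x) auto
    also have "\<dots> = C * (A powr (- e) * alive_mean (\<lambda>y. y) x k k + (A powr (- e) + A powr (1 - e)) * prob (alive x k))"
      by (subst alive_mean_add) (auto simp: alive_mean_cmult alive_mean_const intro: quad_growth_cmult quad_growth_ident quad_growth_const)
    also have "\<dots> \<le> C * (A powr (- e) * (L * (1 + x)) + (A powr (- e) * (1 + x) + A powr (- e) * (S * (1 + x))))"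
    proof (intro mult_left_mono add_mono mean_le x)
      have "A powr (1 - e) * prob (alive x k) \<le> A powr (1 - e) * (S * (1 + x) / A)"
      proof (intro mult_left_mono order_trans[OF surv[OF x]])
        show "S * (1 + x) / sqrt (real k + 1) \<le> S * (1 + x) / A"
          unfolding A_def using S x k by (intro divide_left_mono) auto
      qed simp
      also have "\<dots> = A powr (- e) * (S * (1 + x))"
        using A by (simp add: powr_diff powr_minus_divide)
      finally have "A powr (1 - e) * prob (alive x k) \<le> A powr (- e) * (S * (1 + x))" .
      moreover have "A powr (- e) * prob (alive x k) \<le> A powr (- e) * (1 + x)"
        using x by (intro mult_left_mono order_trans[OF prob_le_1]) auto
      ultimately show "(A powr (- e) + A powr (1 - e)) * prob (alive x k) \<le> A powr (- e) * (1 + x) + A powr (- e) * (S * (1 + x))"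
        by (simp add: distrib_right)
    qed (use C in auto)
    also have "\<dots> = (C * (1 + L + S)) * (1 + x) * A powr (- e)"
      by (simp add: algebra_simps)
    also have "A powr (- e) = real k powr (- \<delta> / 4)"
      using k by (simp add: A_def e_def powr_powr flip: powr_half_sqrt)
    finally show ?thesis .
  qed
  moreover have "0 < C * (1 + L + S)" using C L S by simp
  ultimately show ?thesis by blast
qed

lemma survival_tendsto_0:
  assumes "0 \<le> x" shows "(\<lambda>n. prob (alive x n)) \<longlonglongrightarrow> 0"
proof -
  obtain S where S: "0 < S" and surv: "\<And>x n. 0 \<le> x \<Longrightarrow> prob (alive x n) \<le> S * (1 + x) / sqrt (real n + 1)"
    using survival_bound by blast
  show ?thesis
  proof (rule tendsto_sandwich[OF _ _ tendsto_const])
    show "(\<lambda>n. S * (1 + x) / sqrt (real n + 1)) \<longlonglongrightarrow> 0"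
      by real_asymp
    show "\<forall>\<^sub>F n in sequentially. prob (alive x n) \<le> S * (1 + x) / sqrt (real n + 1)"
      using surv[OF assms] by simp
  qed simp
qed

lemma exit_prob_sums:
  assumes "0 \<le> x" shows "exit_mean (\<lambda>_. 1) x sums 1"
  using telescope_sums'[OF survival_tendsto_0[OF assms]]
  by (simp add: exit_mean_one[abs_def] alive_0 prob_space)

lemma summable_overshoot:
  assumes "0 \<le> x" shows "summable (overshoot x)"
proof -
  obtain C where "\<And>x n. 0 \<le> x \<Longrightarrow> (\<Sum>j<n. overshoot x j) \<le> C * (1 + x)"
    using overshoot_total by blast
  then show ?thesis
    using assms overshoot_nonneg by (intro summableI_nonneg_bounded[where x="C * (1 + x)"]) auto
qed

lemma exit_position_sums:
  assumes "\<omega> \<in> space M"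
  shows "(\<lambda>j. indicator (alive x j - alive x (Suc j)) \<omega> * walk X (Suc j) \<omega>) sums exit_position X x \<omega>"
proof (cases "exit_time X x \<omega>")
  case (enat k)
  have "enat 0 < exit_time X x \<omega>" by (simp add: exit_time_gt_iff)
  then have "k \<noteq> 0" unfolding enat by simp
  then obtain j where k: "k = Suc j" using not0_implies_Suc by blast
  have alive: "\<omega> \<in> alive x i \<longleftrightarrow> i < Suc j" for i
    using assms by (simp only: alive_eq enat k mem_Collect_eq enat_ord_simps simp_thms)
  have "indicator (alive x i - alive x (Suc i)) \<omega> * walk X (Suc i) \<omega> = (if i = j then walk X (Suc i) \<omega> else 0)" for i
    by (simp add: indicator_def alive)
  moreover have "exit_position X x \<omega> = walk X (Suc j) \<omega>" unfolding exit_position_def enat k by simp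
  ultimately show ?thesis using sums_single[of j "\<lambda>i. walk X (Suc i) \<omega>"] by (simp only:)
next
  case infinity
  have alive: "\<omega> \<in> alive x i" for i
    using assms by (simp add: alive_eq infinity)
  then show ?thesis by (simp add: exit_position_def infinity)
qed

lemma finite_exit_indices: "finite {j. \<omega> \<in> alive x j - alive x (Suc j)}"
proof (cases "\<exists>j. \<omega> \<notin> alive x j")
  case True
  then obtain k where k: "\<omega> \<notin> alive x k" by blast
  have "{j. \<omega> \<in> alive x j - alive x (Suc j)} \<subseteq> {..k}"
  proof
    fix j assume "j \<in> {j. \<omega> \<in> alive x j - alive x (Suc j)}"
    then have "\<omega> \<in> alive x j" by simp
    with k alive_antimono[of k j x] show "j \<in> {..k}" by (meson atMost_iff nat_le_linear subsetD)
  qed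
  then show ?thesis by (rule finite_subset) simp
qed simp

text \<open>
The walk exits almost surely, so \<open>V\<close> is the starting point plus the total expected overshoot.
\<close>

lemma harmonic_V_eq:
  assumes x: "0 \<le> x"
  shows "harmonic_V M X x = x + (\<Sum>j. overshoot x j)"
proof -
  let ?f = "\<lambda>j \<omega>. indicator (alive x j - alive x (Suc j)) \<omega> * walk X (Suc j) \<omega>"
  have q: "quad_growth (\<lambda>y. y - x)"
    by (intro quad_growth_diff quad_growth_ident quad_growth_const)
  have f_eq: "?f j \<omega> = indicator (alive x j - alive x (Suc j)) \<omega> * (x + walk X (Suc j) \<omega> - x)" for j \<omega>
    by simp
  have int: "integrable M (?f j)" for j
    unfolding f_eq by (rule integrable_exit[OF q])
  have mean_f: "(\<integral>\<omega>. ?f j \<omega> \<partial>M) = - (overshoot x j + x * exit_mean (\<lambda>_. 1) x j)" for j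
  proof -
    have "(\<integral>\<omega>. ?f j \<omega> \<partial>M) = exit_mean (\<lambda>y. y - x) x j" unfolding exit_mean_def f_eq ..
    also have "\<dots> = exit_mean (\<lambda>y. - 1 * \<bar>y\<bar> + (- x) * 1) x j" by (rule exit_mean_cong) simp
    also have "\<dots> = exit_mean (\<lambda>y. - 1 * \<bar>y\<bar>) x j + exit_mean (\<lambda>_. (- x) * 1) x j"
      by (rule exit_mean_add) (intro quad_growth_cmult quad_growth_abs_ident quad_growth_const)+
    also have "\<dots> = - (overshoot x j + x * exit_mean (\<lambda>_. 1) x j)"
      unfolding exit_mean_cmult overshoot_def by simp
    finally show ?thesis .
  qed
  have norm_f: "(\<integral>\<omega>. norm (?f j \<omega>) \<partial>M) \<le> overshoot x j + x * exit_mean (\<lambda>_. 1) x j" for j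
  proof -
    have "(\<integral>\<omega>. norm (?f j \<omega>) \<partial>M) = exit_mean (\<lambda>y. \<bar>y - x\<bar>) x j"
      unfolding exit_mean_def by (simp add: abs_mult)
    also have "\<dots> \<le> exit_mean (\<lambda>y. \<bar>y\<bar> + x * 1) x j"
      using x by (intro exit_mean_mono quad_growth_abs q quad_growth_add quad_growth_ident quad_growth_const) auto
    also have "\<dots> = overshoot x j + exit_mean (\<lambda>_. x * 1) x j"
      unfolding overshoot_def by (rule exit_mean_add[OF quad_growth_abs_ident quad_growth_const])
    also have "\<dots> = overshoot x j + x * exit_mean (\<lambda>_. 1) x j" unfolding exit_mean_cmult ..
    finally show ?thesis .
  qed
  \<comment> \<open>At the exit after step \<open>j\<close> the walk equals minus \<open>x\<close> minus the overshoot.\<close>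
  have S: "(\<lambda>j. overshoot x j + x * exit_mean (\<lambda>_. 1) x j) sums ((\<Sum>j. overshoot x j) + x * 1)"
    by (intro sums_add summable_sums summable_overshoot x sums_mult exit_prob_sums)
  have "(\<lambda>j. \<integral>\<omega>. ?f j \<omega> \<partial>M) sums (\<integral>\<omega>. (\<Sum>j. ?f j \<omega>) \<partial>M)"
  proof (rule sums_integral[where f="?f", OF int])
    show "AE \<omega> in M. summable (\<lambda>j. norm (?f j \<omega>))"
    proof (rule AE_I2)
      fix \<omega>
      show "summable (\<lambda>j. norm (?f j \<omega>))"
        by (rule summable_finite[OF finite_exit_indices[of \<omega> x]]) (simp add: indicator_def)
    qed
    show "summable (\<lambda>j. \<integral>\<omega>. norm (?f j \<omega>) \<partial>M)"
    proof (rule summable_comparison_test'[where N=0 and f="\<lambda>j. \<integral>\<omega>. norm (?f j \<omega>) \<partial>M", OF sums_summable[OF S]])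
      fix j
      have "0 \<le> (\<integral>\<omega>. norm (?f j \<omega>) \<partial>M)" by (intro integral_nonneg_AE) simp
      with norm_f[of j] show "norm (\<integral>\<omega>. norm (?f j \<omega>) \<partial>M) \<le> overshoot x j + x * exit_mean (\<lambda>_. 1) x j"
        by (simp only: real_norm_def abs_of_nonneg)
    qed
  qed
  also have "(\<integral>\<omega>. (\<Sum>j. ?f j \<omega>) \<partial>M) = (\<integral>\<omega>. exit_position X x \<omega> \<partial>M)"
  proof (rule Bochner_Integration.integral_cong[OF refl])
    fix \<omega> assume "\<omega> \<in> space M"
    from sums_unique[OF exit_position_sums[OF this]]
    show "(\<Sum>j. ?f j \<omega>) = exit_position X x \<omega>" by (rule sym)
  qed
  finally have "(\<lambda>j. - (overshoot x j + x * exit_mean (\<lambda>_. 1) x j)) sums (\<integral>\<omega>. exit_position X x \<omega> \<partial>M)"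
    unfolding mean_f .
  from sums_unique2[OF this sums_minus[OF S]]
  have "(\<integral>\<omega>. exit_position X x \<omega> \<partial>M) = - ((\<Sum>j. overshoot x j) + x * 1)" .
  then show ?thesis unfolding harmonic_V_def by simp
qed

lemma overshoot_remainder:
  "\<exists>C>0. \<forall>x n. 0 \<le> x \<longrightarrow> 1 \<le> n \<longrightarrow> 
     \<bar>harmonic_V M X x - x - (\<Sum>j<n. overshoot x j)\<bar> \<le> C * (1 + x) * real n powr (- \<delta> / 4)"
proof -
  obtain C where C: "0 < C" and tail: "\<And>x k n. 0 \<le> x \<Longrightarrow> 1 \<le> k \<Longrightarrow> k \<le> n \<Longrightarrow>
      (\<Sum>j=k..<n. overshoot x j) \<le> C * (1 + x) * real k powr (- \<delta> / 4)"
    using overshoot_tail by blast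
  have "\<bar>harmonic_V M X x - x - (\<Sum>j<n. overshoot x j)\<bar> \<le> C * (1 + x) * real n powr (- \<delta> / 4)"
    if x: "0 \<le> x" and n: "1 \<le> n" for x n
  proof -
    note sm = summable_overshoot[OF x]
    have eq: "harmonic_V M X x - x - (\<Sum>j<n. overshoot x j) = (\<Sum>j. overshoot x (j + n))"
      using harmonic_V_eq[OF x] suminf_minus_initial_segment[OF sm, of n] by simp
    have "(\<Sum>j. overshoot x (j + n)) \<le> C * (1 + x) * real n powr (- \<delta> / 4)"
    proof (rule suminf_le_const)
      show "summable (\<lambda>j. overshoot x (j + n))" using sm by (simp add: summable_iff_shift)
      fix m
      have "(\<Sum>j<m. overshoot x (j + n)) = (\<Sum>j=n..<n + m. overshoot x j)"
        using sum.shift_bounds_nat_ivl[of "overshoot x" 0 n m] by (simp add: atLeast0LessThan add.commute)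
      then show "(\<Sum>j<m. overshoot x (j + n)) \<le> C * (1 + x) * real n powr (- \<delta> / 4)"
        using tail[OF x n, of "n + m"] by simp
    qed
    moreover have "0 \<le> (\<Sum>j. overshoot x (j + n))"
      using sm by (intro suminf_nonneg overshoot_nonneg) (simp add: summable_iff_shift)
    ultimately show ?thesis unfolding eq by simp
  qed
  then show ?thesis using C by blast
qed

section \<open>Replacement up to the exit time\<close>

lemma strip_step:
  assumes "1 \<le> s"
  shows "\<bar>step (strip T s) y - strip T (s + v) y\<bar> \<le> 4 * heat_const * s powr (- 1 - \<delta> / 2)"
proof -
  have "step (strip T s) y = 2 * step (heat s) y - step (heat s) (y - T) - step (heat s) (y + T)"
    unfolding strip_def[abs_def]
    using step_shift[of "heat s" "- T" y] step_shift[of "heat s" T y]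
      quad_growth_heat_shift[of s "- T"] quad_growth_heat_shift[of s T]
    by (simp add: step_diff step_cmult quad_growth_diff quad_growth_cmult quad_growth_heat)
  then show ?thesis
    using heat_step[OF assms, of y] heat_step[OF assms, of "y - T"] heat_step[OF assms, of "y + T"]
    unfolding strip_def by linarith
qed

text \<open>
The strip function at the remaining time is a martingale along the walk up to the one-step errors; the
exit terms are what it loses when the walk leaves the half-line.
\<close>

lemma strip_telescope:
  fixes x h :: real and n :: nat
  assumes x: "0 \<le> x" and h: "1 \<le> h"
  defines "s \<equiv> \<lambda>j. h + real (n - j) * v"
  shows "\<bar>alive_mean (strip T h) x n n - strip T (h + real n * v) x + (\<Sum>j<n. exit_mean (strip T (s (Suc j))) x j)\<bar>
    \<le> (\<Sum>j<n. 4 * heat_const * s (Suc j) powr (- 1 - \<delta> / 2) * prob (alive x j))"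
proof -
  have "\<bar>alive_mean (strip T (s m)) x m m - strip T (h + real n * v) x + (\<Sum>j<m. exit_mean (strip T (s (Suc j))) x j)\<bar>
    \<le> (\<Sum>j<m. 4 * heat_const * s (Suc j) powr (- 1 - \<delta> / 2) * prob (alive x j))" if "m \<le> n" for m
    using that
  proof (induction m)
    case 0
    then show ?case by (simp add: alive_mean_0 s_def)
  next
    case (Suc m)
    let ?f = "strip T (s (Suc m))" and ?g = "strip T (s m)"
    let ?e = "4 * heat_const * s (Suc m) powr (- 1 - \<delta> / 2)"
    have "real (n - m) = real (n - Suc m) + 1" using Suc.prems by (simp add: of_nat_diff)
    then have sm: "s m = s (Suc m) + v" unfolding s_def by (simp add: algebra_simps)
    have s1: "1 \<le> s (Suc m)" unfolding s_def using h v_pos by (simp add: add_increasing2)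
    have "alive_mean ?f x m (Suc m) = alive_mean (step ?f) x m m"
      by (rule alive_mean_Suc[OF quad_growth_strip]) simp
    moreover have "alive_mean (\<lambda>y. step ?f y - ?g y) x m m = alive_mean (step ?f) x m m - alive_mean ?g x m m"
      using alive_mean_add[OF quad_growth_step quad_growth_cmult[of ?g "- 1"], of ?f x m m]
      by (simp add: quad_growth_strip alive_mean_cmult del: mult_minus_left mult_1 add: alive_mean_cmult[of "- 1", simplified])
    moreover have "\<bar>alive_mean (\<lambda>y. step ?f y - ?g y) x m m\<bar> \<le> ?e * prob (alive x m)"
      using strip_step[OF s1] unfolding sm
      by (intro alive_mean_abs_le quad_growth_diff quad_growth_step quad_growth_strip)
    moreover note alive_mean_split[OF quad_growth_strip, of T "s (Suc m)" x m]
    moreover note Suc.IH[OF Suc_leD[OF Suc.prems]]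
    ultimately show ?case unfolding sum.lessThan_Suc by linarith
  qed
  from this[of n] show ?thesis by (simp add: s_def)
qed

text \<open>
The smoothing time \<open>h\<close>: large enough for the replacement errors up to time \<open>n\<close> to be small, yet negligible
against \<open>n\<close>.
\<close>

definition horizon :: "nat \<Rightarrow> real" where
  "horizon n = real n powr (1 - \<delta> / 8)"

text \<open>
The order of all error terms but the one that is cubic in \<open>x\<close>.
\<close>

abbreviation rate :: "real \<Rightarrow> nat \<Rightarrow> real" where
  "rate x n \<equiv> (1 + x) / sqrt (real n) * real n powr (- \<delta> / 32)"

lemma horizon_bounds:
  assumes "1 \<le> n"
  shows "1 \<le> horizon n" "horizon n \<le> real n" "sqrt (real n) \<le> horizon n"
    and "sqrt (horizon n) = real n powr (1 / 2 - \<delta> / 16)"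
    and "horizon n powr (- \<delta> / 2) \<le> real n powr (- \<delta> / 32)"
    and "horizon n = real n * real n powr (- \<delta> / 8)"
proof -
  have n: "1 \<le> real n" using assms by simp
  show "1 \<le> horizon n" unfolding horizon_def using n \<delta> by (intro ge_one_powr_ge_zero) auto
  show "horizon n \<le> real n" unfolding horizon_def using n \<delta> powr_mono[of "1 - \<delta> / 8" 1 "real n"] by auto
  show "sqrt (real n) \<le> horizon n"
    unfolding horizon_def using n \<delta> powr_mono[of "1 / 2" "1 - \<delta> / 8" "real n"] by (auto simp: powr_half_sqrt)
  have "sqrt (horizon n) = (real n powr (1 - \<delta> / 8)) powr (1 / 2)"
    unfolding horizon_def by (simp add: powr_half_sqrt)
  also have "\<dots> = real n powr (1 / 2 - \<delta> / 16)"
    unfolding powr_powr by (simp add: algebra_simps diff_divide_distrib)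
  finally show "sqrt (horizon n) = real n powr (1 / 2 - \<delta> / 16)" .
  have "\<delta> / 32 \<le> (1 - \<delta> / 8) * (\<delta> / 2)"
    using mult_right_mono[of "1/16" "1 - \<delta> / 8" "\<delta> / 2"] \<delta> by simp
  then show "horizon n powr (- \<delta> / 2) \<le> real n powr (- \<delta> / 32)"
    unfolding horizon_def powr_powr using n by (intro powr_mono) auto
  show "horizon n = real n * real n powr (- \<delta> / 8)"
    unfolding horizon_def using n by (simp add: powr_diff powr_minus_divide)
qed

lemma taylor_error:
  "\<exists>C>0. \<forall>x n. 0 \<le> x \<longrightarrow> 1 \<le> n \<longrightarrow> 
     (\<Sum>j<n. 4 * heat_const * (horizon n + real (n - Suc j) * v) powr (- 1 - \<delta> / 2) * prob (alive x j))
     \<le> C * rate x n"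
proof -
  obtain S where S: "0 < S" and surv: "\<And>x n. 0 \<le> x \<Longrightarrow> prob (alive x n) \<le> S * (1 + x) / sqrt (real n + 1)"
    using survival_bound by blast
  have "0 < \<delta> / 2" using \<delta> by simp
  from sum_sqrt_powr_le[OF v_pos this] obtain C where C: "0 < C"
    and sum: "\<And>n h. 1 \<le> n \<Longrightarrow> 1 \<le> h \<Longrightarrow> h \<le> real n \<Longrightarrow>
      (\<Sum>j<n. 1 / sqrt (real (j + 1)) * (h + real (n - Suc j) * v) powr (- 1 - \<delta> / 2)) \<le> C / sqrt (real n) * h powr (- (\<delta> / 2))"
    by blast
  define K where "K = 4 * heat_const * S * C"
  have K: "0 < K" using heat_const_pos S C by (simp add: K_def)
  have "(\<Sum>j<n. 4 * heat_const * (horizon n + real (n - Suc j) * v) powr (- 1 - \<delta> / 2) * prob (alive x j))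
     \<le> K * rate x n" if x: "0 \<le> x" and n: "1 \<le> n" for x n
  proof -
    let ?s = "\<lambda>j. (horizon n + real (n - Suc j) * v) powr (- 1 - \<delta> / 2)"
    have "(\<Sum>j<n. 4 * heat_const * ?s j * prob (alive x j)) 
       \<le> (\<Sum>j<n. 4 * heat_const * ?s j * (S * (1 + x) / sqrt (real j + 1)))"
      using heat_const_pos by (intro sum_mono mult_left_mono surv x) auto
    also have "\<dots> = 4 * heat_const * S * (1 + x) * (\<Sum>j<n. 1 / sqrt (real (j + 1)) * ?s j)"
      unfolding sum_distrib_left by (intro sum.cong refl) (simp add: add.commute)
    also have "\<dots> \<le> 4 * heat_const * S * (1 + x) * (C / sqrt (real n) * horizon n powr (- (\<delta> / 2)))"
      using heat_const_pos S x horizon_bounds[OF n] by (intro mult_left_mono sum n) auto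
    also have "\<dots> \<le> 4 * heat_const * S * (1 + x) * (C / sqrt (real n) * real n powr (- \<delta> / 32))"
      using heat_const_pos S C x horizon_bounds(5)[OF n] by (intro mult_left_mono) auto
    also have "\<dots> = K * rate x n"
      by (simp add: K_def)
    finally show ?thesis .
  qed
  then show ?thesis using K by blast
qed

lemma exit_mean_strip_le:
  assumes "0 < s"
  shows "\<bar>exit_mean (strip T s) x j + d * overshoot x j\<bar>
    \<le> 8 * s powr (- ((1 + \<delta> / 2) / 2)) * overshoot_power x j
       + \<bar>strip_slope T s - d\<bar> * overshoot x j"
    and "\<bar>exit_mean (strip T s) x j\<bar> \<le> 4 / sqrt s * overshoot x j"
proof -
  have absle: "\<bar>exit_mean f x j\<bar> \<le> exit_mean g x j"
    if f: "quad_growth f" and g: "quad_growth g" and le: "\<And>y. y < 0 \<Longrightarrow> \<bar>f y\<bar> \<le> g y" for f g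
  proof -
    have "exit_mean f x j \<le> exit_mean g x j"
    proof (rule exit_mean_mono[OF f g])
      show "f y \<le> g y" if "y < 0" for y using le[OF that] by linarith
    qed
    moreover have "exit_mean (\<lambda>y. - 1 * f y) x j \<le> exit_mean g x j"
    proof (rule exit_mean_mono[OF quad_growth_cmult[OF f] g])
      show "- 1 * f y \<le> g y" if "y < 0" for y using le[OF that] by linarith
    qed
    ultimately show ?thesis unfolding exit_mean_cmult by simp
  qed
  have q': "quad_growth (\<lambda>y. \<bar>y\<bar> powr (1 + \<delta> / 2))" using \<delta> by (intro quad_growth_powr) auto
  let ?c = "8 * s powr (- ((1 + \<delta> / 2) / 2))"
  note q = quad_growth_strip[of T s] quad_growth_cmult[OF quad_growth_abs_ident, of d]
    quad_growth_cmult[OF q', of ?c] quad_growth_cmult[OF quad_growth_abs_ident, of "\<bar>strip_slope T s - d\<bar>"]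
  have eq: "exit_mean (strip T s) x j + d * overshoot x j = exit_mean (\<lambda>y. strip T s y + d * \<bar>y\<bar>) x j"
    unfolding overshoot_def exit_mean_add[OF q(1,2)] exit_mean_cmult ..
  have "\<bar>exit_mean (\<lambda>y. strip T s y + d * \<bar>y\<bar>) x j\<bar> \<le> exit_mean (\<lambda>y. ?c * \<bar>y\<bar> powr (1 + \<delta> / 2) + \<bar>strip_slope T s - d\<bar> * \<bar>y\<bar>) x j"
  proof (rule absle[OF quad_growth_add[OF q(1,2)] quad_growth_add[OF q(3,4)]])
    fix y :: real assume y: "y < 0"
    have "\<bar>strip T s y - y * strip_slope T s\<bar> \<le> 8 * \<bar>y\<bar> powr (1 + \<delta> / 2) * s powr (- ((1 + \<delta> / 2) / 2))"
      using \<delta> by (intro strip_linearization assms) auto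
    also have "\<dots> = ?c * \<bar>y\<bar> powr (1 + \<delta> / 2)" by simp
    finally have "\<bar>strip T s y - y * strip_slope T s\<bar> \<le> ?c * \<bar>y\<bar> powr (1 + \<delta> / 2)" .
    moreover have "strip T s y + d * \<bar>y\<bar> = (strip T s y - y * strip_slope T s) + (strip_slope T s - d) * y"
      using y by (simp add: algebra_simps)
    moreover have "\<bar>(strip_slope T s - d) * y\<bar> = \<bar>strip_slope T s - d\<bar> * \<bar>y\<bar>" by (rule abs_mult)
    ultimately show "\<bar>strip T s y + d * \<bar>y\<bar>\<bar> \<le> ?c * \<bar>y\<bar> powr (1 + \<delta> / 2) + \<bar>strip_slope T s - d\<bar> * \<bar>y\<bar>"
      by linarith
  qed
  then show "\<bar>exit_mean (strip T s) x j + d * overshoot x j\<bar>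
    \<le> ?c * overshoot_power x j + \<bar>strip_slope T s - d\<bar> * overshoot x j"
    unfolding eq unfolding exit_mean_add[OF q(3,4)] exit_mean_cmult overshoot_def .
  have "\<bar>exit_mean (strip T s) x j\<bar> \<le> exit_mean (\<lambda>y. 4 / sqrt s * \<bar>y\<bar>) x j"
  proof (rule absle[OF q(1) quad_growth_cmult[OF quad_growth_abs_ident]])
    show "\<bar>strip T s y\<bar> \<le> 4 / sqrt s * \<bar>y\<bar>" for y
      using strip_lipschitz[OF assms, of T y] by simp
  qed
  then show "\<bar>exit_mean (strip T s) x j\<bar> \<le> 4 / sqrt s * overshoot x j"
    unfolding overshoot_def by (simp only: exit_mean_cmult)
qed

text \<open>
The exit terms sum to minus the boundary slope times the expected overshoot.
\<close>

lemma exit_error: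
  "\<exists>C>0. \<forall>T x n. 0 \<le> x \<longrightarrow> 1 \<le> n \<longrightarrow>
     \<bar>(\<Sum>j<n. exit_mean (strip T (horizon n + real (n - Suc j) * v)) x j) + strip_slope T (v * real n) * (\<Sum>j<n. overshoot x j)\<bar>
     \<le> C * rate x n"
proof -
  obtain C where C: "0 < C" and tail: "\<And>x k n. 0 \<le> x \<Longrightarrow> 1 \<le> k \<Longrightarrow> k \<le> n \<Longrightarrow>
      (\<Sum>j=k..<n. overshoot x j) \<le> C * (1 + x) * real k powr (- \<delta> / 4)"
    using overshoot_tail by blast
  obtain L where L: "0 < L" and total: "\<And>x n. 0 \<le> x \<Longrightarrow> (\<Sum>j<n. overshoot x j) \<le> L * (1 + x)"
    and total': "\<And>x n. 0 \<le> x \<Longrightarrow> (\<Sum>j<n. overshoot_power x j) \<le> L * (1 + x)"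
    using overshoot_total by blast
  define c where "c = min 1 v / 2"
  have c: "0 < c" "c \<le> 1 / 2" "c \<le> v / 2" using v_pos by (auto simp: c_def)
  define K1 where "K1 = 8 * c powr (- ((1 + \<delta> / 2) / 2))"
  define K2 where "K2 = 3 * (1 + 2 * v) / (c * sqrt c)"
  define K3 where "K3 = 4 + 2 / sqrt v"
  have K: "0 < K1" "0 < K2" "0 < K3" unfolding K1_def K2_def K3_def using c v_pos by (auto intro!: divide_pos_pos add_pos_pos)
  let ?K = "(K1 + K2) * L + 2 * K3 * C"
  have "\<bar>(\<Sum>j<n. exit_mean (strip T (horizon n + real (n - Suc j) * v)) x j) + strip_slope T (v * real n) * (\<Sum>j<n. overshoot x j)\<bar>
     \<le> ?K * rate x n" if x: "0 \<le> x" and n: "1 \<le> n" for T x n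
  proof -
    define N where "N = real n"
    define s where "s j = horizon n + real (n - Suc j) * v" for j
    define d where "d = strip_slope T (v * N)"
    define E where "E = N powr (- \<delta> / 32) / sqrt N"
    \<comment> \<open>Exits with index below \<open>k\<close> happen while \<open>s j\<close> is still of order \<open>n\<close>; there the strip function is linearised. The remaining overshoot is small by its tail bound.\<close>
    define k where "k = nat \<lceil>sqrt N / 2\<rceil>"
    let ?ov' = "exit_mean (\<lambda>y. \<bar>y\<bar> powr (1 + \<delta> / 2)) x"
    have N: "1 \<le> N" using n by (simp add: N_def)
    have sqrtN: "1 \<le> sqrt N" "sqrt N \<le> N" using N by (auto simp: real_le_lsqrt power2_eq_square)
    have E: "0 \<le> E" using N by (simp add: E_def)
    note hor = horizon_bounds[OF n, folded N_def]
    have k_ge: "sqrt N / 2 \<le> real k" unfolding k_def by linarith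
    have k1: "1 \<le> k" unfolding k_def using sqrtN by linarith
    have k_lt: "real j < sqrt N / 2" if "j < k" for j
      using that unfolding k_def by (simp add: less_ceiling_iff zless_nat_eq_int_zless)
    have kn: "k \<le> n"
    proof -
      have "sqrt N / 2 \<le> real n" using sqrtN unfolding N_def by linarith
      then show ?thesis unfolding k_def by linarith
    qed
    have s_pos: "horizon n \<le> s j" "0 < s j" for j
      using hor v_pos unfolding s_def by (auto intro: add_pos_nonneg)
    have early: "\<bar>exit_mean (strip T (s j)) x j + d * overshoot x j\<bar> \<le> K1 * E * ?ov' j + K2 * E * overshoot x j" if j: "j < k" for j
    proof -
      have jn: "Suc j \<le> n" using j kn by simp
      define r where "r = real (n - Suc j)"
      have r: "r = N - real j - 1" unfolding r_def N_def using jn by (simp add: of_nat_diff)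
      have j2: "real j < sqrt N / 2" by (rule k_lt[OF j])
      have sj: "s j = horizon n + r * v" by (simp add: s_def r_def)
      have lower: "c * N \<le> s j"
      proof -
        have "(N - 1) / 2 \<le> r"
        proof -
          have "2 * j + 1 \<le> n"
          proof -
            have "2 * real j < real n" using j2 sqrtN unfolding N_def by linarith
            then show ?thesis by linarith
          qed
          then have "2 * real j + 1 \<le> N" unfolding N_def by linarith
          then show ?thesis unfolding r by (simp add: field_simps)
        qed
        then have "(N - 1) / 2 * v \<le> r * v" using v_pos by (intro mult_right_mono) auto
        moreover have "(N - 1) * c \<le> (N - 1) / 2 * v"
          using c N mult_left_mono[of c "v/2" "N - 1"] by simp
        moreover have "c * N = (N - 1) * c + c" by (simp add: algebra_simps)
        ultimately show ?thesis unfolding sj using hor(1) c by linarith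
      qed
      have cN: "0 < c * N" "c * N \<le> v * N" using c N v_pos by auto
      have diff: "\<bar>s j - v * N\<bar> \<le> (1 + 2 * v) * horizon n"
      proof -
        have "s j - v * N = horizon n - (real j + 1) * v" unfolding sj r by (simp add: algebra_simps)
        moreover have "(real j + 1) * v \<le> (2 * horizon n) * v"
          using j2 sqrtN hor(1,3) v_pos by (intro mult_right_mono) auto
        moreover have "0 \<le> (real j + 1) * v" using v_pos by simp
        ultimately have "\<bar>s j - v * N\<bar> \<le> horizon n + 2 * horizon n * v" using hor(1) by linarith
        then show ?thesis by (simp add: algebra_simps)
      qed
      have "\<bar>strip_slope T (s j) - d\<bar> \<le> 3 * \<bar>s j - v * N\<bar> / (c * N * sqrt (c * N))"
        unfolding d_def by (rule strip_slope_lipschitz[OF cN(1) lower cN(2)])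
      also have "\<dots> \<le> 3 * ((1 + 2 * v) * horizon n) / (c * N * sqrt (c * N))"
        using diff cN by (intro divide_right_mono mult_left_mono) auto
      also have "\<dots> = K2 * (N powr (- \<delta> / 8) / sqrt N)"
      proof -
        have "3 * ((1 + 2 * v) * horizon n) = N * (3 * (1 + 2 * v) * N powr (- \<delta> / 8))"
          by (subst hor(6)) (simp only: ac_simps)
        moreover have "c * N * sqrt (c * N) = N * (c * sqrt c * sqrt N)"
          by (simp only: real_sqrt_mult ac_simps)
        ultimately show ?thesis using N unfolding K2_def by simp
      qed
      also have "\<dots> \<le> K2 * E"
        unfolding E_def using K N \<delta> by (intro mult_left_mono divide_right_mono powr_mono) auto
      finally have slope: "\<bar>strip_slope T (s j) - d\<bar> \<le> K2 * E" .
      have "8 * s j powr (- ((1 + \<delta> / 2) / 2)) \<le> 8 * (c * N) powr (- ((1 + \<delta> / 2) / 2))"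
        using lower cN \<delta> by (intro mult_left_mono powr_mono2') auto
      also have "\<dots> = K1 * N powr (- (1 / 2) - \<delta> / 4)"
        unfolding K1_def using c N by (simp add: powr_mult add_divide_distrib)
      also have "\<dots> \<le> K1 * N powr (- (1 / 2) - \<delta> / 32)"
        using K N \<delta> by (intro mult_left_mono powr_mono) auto
      also have "\<dots> = K1 * E"
        unfolding E_def using N by (simp add: powr_diff powr_minus_divide powr_half_sqrt)
      finally have "8 * s j powr (- ((1 + \<delta> / 2) / 2)) \<le> K1 * E" .
      then have "8 * s j powr (- ((1 + \<delta> / 2) / 2)) * ?ov' j + \<bar>strip_slope T (s j) - d\<bar> * overshoot x j \<le> K1 * E * ?ov' j + K2 * E * overshoot x j"
        using slope by (intro add_mono mult_right_mono overshoot_nonneg exit_mean_nonneg) auto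
      then show ?thesis using exit_mean_strip_le(1)[OF s_pos(2), of T j x j d] by linarith
    qed
    have late: "\<bar>exit_mean (strip T (s j)) x j + d * overshoot x j\<bar> \<le> K3 / sqrt (horizon n) * overshoot x j" for j
    proof -
      have "\<bar>exit_mean (strip T (s j)) x j\<bar> \<le> 4 / sqrt (s j) * overshoot x j"
        by (rule exit_mean_strip_le(2)[OF s_pos(2)])
      also have "\<dots> \<le> 4 / sqrt (horizon n) * overshoot x j"
        using s_pos(1)[of j] hor(1) by (intro mult_right_mono divide_left_mono overshoot_nonneg) auto
      finally have 1: "\<bar>exit_mean (strip T (s j)) x j\<bar> \<le> 4 / sqrt (horizon n) * overshoot x j" .
      have vN: "0 < v * N" using v_pos N by simp
      have "d \<le> 2 / sqrt (v * N)" "0 \<le> d" unfolding d_def using strip_slope_bounds[OF vN] by auto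
      moreover have "2 / sqrt (v * N) \<le> 2 / sqrt v / sqrt (horizon n)"
      proof -
        have "sqrt v * sqrt (horizon n) \<le> sqrt (v * N)"
          unfolding real_sqrt_mult[symmetric] using hor(2) v_pos by (intro real_sqrt_le_mono mult_left_mono) auto
        then have "2 / sqrt (v * N) \<le> 2 / (sqrt v * sqrt (horizon n))"
          using v_pos hor(1) vN by (intro divide_left_mono) auto
        then show ?thesis by simp
      qed
      ultimately have "\<bar>d * overshoot x j\<bar> \<le> 2 / sqrt v / sqrt (horizon n) * overshoot x j"
        unfolding abs_mult using overshoot_nonneg[of x j] v_pos hor(1) by (intro mult_mono) auto
      then have "\<bar>exit_mean (strip T (s j)) x j + d * overshoot x j\<bar>
          \<le> 4 / sqrt (horizon n) * overshoot x j + 2 / sqrt v / sqrt (horizon n) * overshoot x j"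
        using 1 by linarith
      also have "\<dots> = K3 / sqrt (horizon n) * overshoot x j" by (simp add: K3_def add_divide_distrib algebra_simps)
      finally show ?thesis .
    qed
    have split: "(\<Sum>j<n. f j) = (\<Sum>j<k. f j) + (\<Sum>j=k..<n. f j)" for f :: "nat \<Rightarrow> real"
      using sum.atLeastLessThan_concat[OF le0 kn, of f] by (simp add: atLeast0LessThan)
    have "(\<Sum>j<k. \<bar>exit_mean (strip T (s j)) x j + d * overshoot x j\<bar>) \<le> (\<Sum>j<k. K1 * E * ?ov' j + K2 * E * overshoot x j)"
      by (intro sum_mono early) auto
    also have "\<dots> = K1 * E * (\<Sum>j<k. ?ov' j) + K2 * E * (\<Sum>j<k. overshoot x j)"
      by (simp only: sum.distrib sum_distrib_left)
    also have "\<dots> \<le> K1 * E * (L * (1 + x)) + K2 * E * (L * (1 + x))"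
      using K E by (intro add_mono mult_left_mono total total' x) auto
    finally have A: "(\<Sum>j<k. \<bar>exit_mean (strip T (s j)) x j + d * overshoot x j\<bar>) \<le> (K1 + K2) * L * ((1 + x) * E)"
      by (simp add: algebra_simps)
    have "(\<Sum>j=k..<n. \<bar>exit_mean (strip T (s j)) x j + d * overshoot x j\<bar>) \<le> (\<Sum>j=k..<n. K3 / sqrt (horizon n) * overshoot x j)"
      by (intro sum_mono late)
    also have "\<dots> = K3 / sqrt (horizon n) * (\<Sum>j=k..<n. overshoot x j)" by (rule sum_distrib_left[symmetric])
    also have "\<dots> \<le> K3 / sqrt (horizon n) * (C * (1 + x) * real k powr (- \<delta> / 4))"
      using K hor(1) by (intro mult_left_mono tail x k1 kn) auto
    also have "\<dots> \<le> K3 / sqrt (horizon n) * (C * (1 + x) * (2 * N powr (- \<delta> / 8)))"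
    proof (intro mult_left_mono)
      have "real k powr (- \<delta> / 4) \<le> (sqrt N / 2) powr (- \<delta> / 4)"
        using k_ge sqrtN \<delta> by (intro powr_mono2') auto
      also have "\<dots> = 2 powr (\<delta> / 4) * N powr (- \<delta> / 8)"
        using N by (simp add: powr_divide powr_minus_divide powr_powr flip: powr_half_sqrt)
      also have "\<dots> \<le> 2 powr 1 * N powr (- \<delta> / 8)" using \<delta> by (intro mult_right_mono powr_mono) auto
      finally show "real k powr (- \<delta> / 4) \<le> 2 * N powr (- \<delta> / 8)" by simp
    qed (use K hor(1) C x in auto)
    also have "\<dots> = 2 * K3 * C * ((1 + x) * (N powr (- \<delta> / 16) / sqrt N))"
    proof -
      have "N powr (- \<delta> / 8) / sqrt (horizon n) = N powr (- \<delta> / 8 - (1 / 2 - \<delta> / 16))"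
        unfolding hor(4) using N by (simp only: powr_diff)
      also have "- \<delta> / 8 - (1 / 2 - \<delta> / 16) = - \<delta> / 16 - 1 / 2" by simp
      also have "N powr (- \<delta> / 16 - 1 / 2) = N powr (- \<delta> / 16) / sqrt N"
        using N by (simp add: powr_diff powr_half_sqrt)
      finally have "N powr (- \<delta> / 8) / sqrt (horizon n) = N powr (- \<delta> / 16) / sqrt N" .
      moreover have "k / u * (C * P * (2 * p)) = 2 * k * C * (P * q)" if "p / u = q" for k u P p q :: real
        by (simp flip: that)
      ultimately show ?thesis by blast
    qed
    also have "\<dots> \<le> 2 * K3 * C * ((1 + x) * E)"
      unfolding E_def using K C x N \<delta> by (intro mult_left_mono divide_right_mono powr_mono) auto
    finally have B: "(\<Sum>j=k..<n. \<bar>exit_mean (strip T (s j)) x j + d * overshoot x j\<bar>) \<le> 2 * K3 * C * ((1 + x) * E)" .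
    have "(\<Sum>j<n. exit_mean (strip T (s j)) x j) + d * (\<Sum>j<n. overshoot x j) = (\<Sum>j<n. exit_mean (strip T (s j)) x j + d * overshoot x j)"
      by (simp only: sum.distrib sum_distrib_left)
    also have "\<bar>\<dots>\<bar> \<le> (\<Sum>j<n. \<bar>exit_mean (strip T (s j)) x j + d * overshoot x j\<bar>)" by (rule sum_abs)
    also have "\<dots> \<le> ?K * ((1 + x) * E)"
      unfolding split using A B by (simp only: distrib_right)
    also have "(1 + x) * E = rate x n"
      by (simp add: E_def N_def)
    finally show ?thesis unfolding s_def d_def N_def .
  qed
  moreover have "0 < ?K" using K C L by (intro add_pos_pos mult_pos_pos) auto
  ultimately show ?thesis by blast
qed

lemma smoothed_estimate:
  "\<exists>C>0. \<forall>T x n. 0 \<le> x \<longrightarrow> 1 \<le> n \<longrightarrow>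
     \<bar>alive_mean (strip T (horizon n)) x n n - harmonic_V M X x * strip_slope T (v * real n)\<bar>
     \<le> C * (rate x n + (x / sqrt (real n)) ^ 3)"
proof -
  obtain C1 where C1: "0 < C1" and E1: "\<And>x n. 0 \<le> x \<Longrightarrow> 1 \<le> n \<Longrightarrow>
     (\<Sum>j<n. 4 * heat_const * (horizon n + real (n - Suc j) * v) powr (- 1 - \<delta> / 2) * prob (alive x j))
     \<le> C1 * rate x n"
    using taylor_error by blast
  obtain C2 where C2: "0 < C2" and E2: "\<And>T x n. 0 \<le> x \<Longrightarrow> 1 \<le> n \<Longrightarrow>
     \<bar>(\<Sum>j<n. exit_mean (strip T (horizon n + real (n - Suc j) * v)) x j) + strip_slope T (v * real n) * (\<Sum>j<n. overshoot x j)\<bar>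
     \<le> C2 * rate x n"
    using exit_error by blast
  obtain C3 where C3: "0 < C3" and E3: "\<And>x n. 0 \<le> x \<Longrightarrow> 1 \<le> n \<Longrightarrow>
     \<bar>harmonic_V M X x - x - (\<Sum>j<n. overshoot x j)\<bar> \<le> C3 * (1 + x) * real n powr (- \<delta> / 4)"
    using overshoot_remainder by blast
  define C4 where "C4 = 8 / sqrt v ^ 3"
  define C5 where "C5 = 3 / (v * sqrt v)"
  define C6 where "C6 = 2 * C3 / sqrt v"
  have C: "0 < C4" "0 < C5" "0 < C6" using v_pos C3 by (auto simp: C4_def C5_def C6_def)
  let ?C = "C1 + C2 + C4 + C5 + C6"
  have "\<bar>alive_mean (strip T (horizon n)) x n n - harmonic_V M X x * strip_slope T (v * real n)\<bar>
     \<le> ?C * (rate x n + (x / sqrt (real n)) ^ 3)"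
    if x: "0 \<le> x" and n: "1 \<le> n" for T x n
  proof -
    define N where "N = real n"
    define A where "A = alive_mean (strip T (horizon n)) x n n"
    define s where "s = horizon n + N * v"
    define U where "U = strip T s x"
    define G where "G = (\<Sum>j<n. exit_mean (strip T (horizon n + real (n - Suc j) * v)) x j)"
    define Q where "Q = (\<Sum>j<n. overshoot x j)"
    define d where "d = strip_slope T (v * N)"
    define V where "V = harmonic_V M X x"
    define E where "E = (1 + x) / sqrt N * N powr (- \<delta> / 32)"
    define F where "F = (x / sqrt N) ^ 3"
    have N: "1 \<le> N" using n by (simp add: N_def)
    have EF: "0 \<le> E" "0 \<le> F" using x N by (auto simp: E_def F_def)
    note hor = horizon_bounds[OF n, folded N_def]
    have vN: "0 < v * N" using v_pos N by simp
    have s: "v * N \<le> s" "0 < s" using hor(1) vN unfolding s_def by (auto simp: mult.commute intro: add_pos_pos)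
    have d: "0 \<le> d" "d \<le> 2 / sqrt v / sqrt N"
      unfolding d_def using strip_slope_bounds[OF vN, of T] by (auto simp: real_sqrt_mult)
    \<comment> \<open>\<open>A\<close> is the smoothed probability, \<open>U\<close> the initial value, \<open>G\<close> the sum of the exit terms, and \<open>d\<close> the slope of the strip function at the boundary at time \<open>v n\<close>.\<close>
    have 1: "\<bar>A - U + G\<bar> \<le> C1 * E"
      using strip_telescope[OF x hor(1), of T n] E1[OF x n]
      unfolding A_def U_def G_def s_def E_def N_def by linarith
    have 2: "\<bar>G + d * Q\<bar> \<le> C2 * E"
      using E2[OF x n, of T] unfolding G_def d_def Q_def E_def N_def .
    have 3: "\<bar>d * (V - x - Q)\<bar> \<le> C6 * E"
    proof -
      have "\<bar>d * (V - x - Q)\<bar> \<le> (2 / sqrt v / sqrt N) * (C3 * (1 + x) * N powr (- \<delta> / 4))"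
        unfolding abs_mult V_def Q_def N_def using d[unfolded N_def] v_pos by (intro mult_mono E3 x n) auto
      also have "\<dots> = C6 * ((1 + x) / sqrt N) * N powr (- \<delta> / 4)"
        by (simp add: C6_def)
      also have "\<dots> \<le> C6 * ((1 + x) / sqrt N) * N powr (- \<delta> / 32)"
        using C x N \<delta> by (intro mult_left_mono powr_mono) auto
      finally show ?thesis by (simp add: E_def)
    qed
    have 4: "\<bar>U - x * strip_slope T s\<bar> \<le> C4 * F"
    proof -
      have "\<bar>U - x * strip_slope T s\<bar> \<le> 8 * (\<bar>x\<bar> / sqrt s) ^ 3"
        unfolding U_def by (rule strip_cubic[OF s(2)])
      also have "\<dots> \<le> 8 * (x / sqrt (v * N)) ^ 3"
        using s vN x by (intro mult_left_mono power_mono frac_le) auto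
      also have "\<dots> = C4 * F"
        by (simp add: C4_def F_def real_sqrt_mult power_divide power_mult_distrib)
      finally show ?thesis .
    qed
    have 5: "\<bar>x * (strip_slope T s - d)\<bar> \<le> C5 * E"
    proof -
      have "\<bar>strip_slope T s - d\<bar> \<le> 3 * \<bar>s - v * N\<bar> / (v * N * sqrt (v * N))"
        unfolding d_def by (rule strip_slope_lipschitz[OF vN s(1)]) simp
      also have "\<bar>s - v * N\<bar> = N * N powr (- \<delta> / 8)"
        unfolding s_def hor(6)[symmetric] using hor(1) by simp
      also have "3 * (N * N powr (- \<delta> / 8)) / (v * N * sqrt (v * N)) = C5 * (N powr (- \<delta> / 8) / sqrt N)"
      proof -
        have "3 * (N * N powr (- \<delta> / 8)) = N * (3 * N powr (- \<delta> / 8))"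
          "v * N * sqrt (v * N) = N * (v * sqrt v * sqrt N)"
          by (simp_all only: real_sqrt_mult ac_simps)
        then show ?thesis using N unfolding C5_def by simp
      qed
      also have "\<dots> \<le> C5 * (N powr (- \<delta> / 32) / sqrt N)"
        using C N \<delta> by (intro mult_left_mono divide_right_mono powr_mono) auto
      finally have "\<bar>x\<bar> * \<bar>strip_slope T s - d\<bar> \<le> (1 + x) * (C5 * (N powr (- \<delta> / 32) / sqrt N))"
        using x by (intro mult_mono) auto
      also have "\<dots> = C5 * E" by (simp add: E_def)
      finally show ?thesis by (simp add: abs_mult)
    qed
    have "A - V * d = (A - U + G) - (G + d * Q) - d * (V - x - Q) + (U - x * strip_slope T s) + x * (strip_slope T s - d)"
      by (simp add: algebra_simps)
    then have "\<bar>A - V * d\<bar> \<le> C1 * E + C2 * E + C6 * E + C4 * F + C5 * E"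
      using 1 2 3 4 5 by linarith
    also have "\<dots> \<le> ?C * (E + F)"
    proof -
      have "0 \<le> C4 * E" "0 \<le> (C1 + C2 + C5 + C6) * F" using C C1 C2 EF by auto
      then show ?thesis by (simp add: algebra_simps)
    qed
    finally show ?thesis unfolding A_def V_def d_def E_def F_def N_def .
  qed
  moreover have "0 < ?C" using C C1 C2 by simp
  ultimately show ?thesis by blast
qed

section \<open>Removing the smoothing\<close>

text \<open>
The half-width of the neighbourhoods of \<open>0\<close> and \<open>T\<close> outside which the smoothed indicator is close to the
indicator; it lies between \<open>sqrt (horizon n)\<close> and \<open>sqrt n\<close>.
\<close>

definition window :: "nat \<Rightarrow> real" where
  "window n = real n powr (1 / 2 - \<delta> / 32)"

lemma window_estimate:
  "\<exists>C>0. \<forall>z x n. 0 \<le> x \<longrightarrow> 1 \<le> n \<longrightarrow>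
     prob (alive_near x n n z (window n)) \<le> C * rate x n"
proof -
  obtain C where C: "0 < C" and conc: "\<And>a z x j m. 1 \<le> a \<Longrightarrow> 1 \<le> m \<Longrightarrow>
     prob (alive_near x j (j + m) z a) \<le> C * (a / sqrt (real m) + a powr (- \<delta>)) * prob (alive x j)"
    using concentration by blast
  obtain S where S: "0 < S" and surv: "\<And>x n. 0 \<le> x \<Longrightarrow> prob (alive x n) \<le> S * (1 + x) / sqrt (real n + 1)"
    using survival_bound by blast
  have "prob (alive_near x n n z (window n)) \<le> (C * 3 * (2 * S)) * rate x n"
    if x: "0 \<le> x" and n: "1 \<le> n" for z x n
  proof -
    define N where "N = real n"
    define a where "a = window n"
    define j where "j = n div 2"
    define m where "m = n - j"
    have nj: "n = j + m" unfolding j_def m_def by simp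
    have m: "1 \<le> m" and mn: "n \<le> 4 * m" and jn: "n \<le> 4 * (j + 1)"
      using n unfolding j_def m_def by presburger+
    have N: "1 \<le> N" using n by (simp add: N_def)
    have a: "1 \<le> a" "a = N powr (1 / 2 - \<delta> / 32)"
      unfolding a_def window_def N_def using n \<delta> by (auto intro!: ge_one_powr_ge_zero)
    have "N \<le> 4 * real m" using mn unfolding N_def by (metis of_nat_le_iff of_nat_mult of_nat_numeral)
    then have "a * (1 / sqrt (real m)) \<le> a * (2 / sqrt N)"
      using a m N by (intro mult_left_mono inverse_sqrt_le) auto
    also have "\<dots> = 2 * N powr (- \<delta> / 32)"
      unfolding a(2) using N by (simp add: powr_diff powr_half_sqrt powr_minus_divide)
    finally have 1: "a / sqrt (real m) \<le> 2 * N powr (- \<delta> / 32)" by simp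
    have 2: "a powr (- \<delta>) \<le> N powr (- \<delta> / 32)"
    proof -
      have "\<delta> / 32 \<le> (1 / 2 - \<delta> / 32) * \<delta>"
        using mult_right_mono[of "1/32" "1 / 2 - \<delta> / 32" \<delta>] \<delta> by simp
      then show ?thesis unfolding a(2) powr_powr using N by (intro powr_mono) auto
    qed
    have "N \<le> 4 * real (j + 1)" using jn unfolding N_def by (metis of_nat_le_iff of_nat_mult of_nat_numeral)
    then have "S * (1 + x) * (1 / sqrt (real (j + 1))) \<le> S * (1 + x) * (2 / sqrt N)"
      using S x N by (intro mult_left_mono inverse_sqrt_le) auto
    also have "\<dots> = 2 * S * ((1 + x) / sqrt N)" by simp
    finally have 3: "prob (alive x j) \<le> 2 * S * ((1 + x) / sqrt N)"
      using surv[OF x, of j] by (simp add: add.commute)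
    have "prob (alive_near x n n z a) \<le> prob (alive_near x j (j + m) z a)"
    proof (rule finite_measure_mono)
      show "alive_near x n n z a \<subseteq> alive_near x j (j + m) z a"
        using alive_antimono[of j n x] nj by auto
      show "alive_near x j (j + m) z a \<in> sets M"
        using sets.sets_into_space[OF sets_alive] by measurable
    qed
    also have "\<dots> \<le> C * (a / sqrt (real m) + a powr (- \<delta>)) * prob (alive x j)"
      by (rule conc[OF a(1) m])
    also have "\<dots> \<le> C * (3 * N powr (- \<delta> / 32)) * (2 * S * ((1 + x) / sqrt N))"
      using C S x N 1 2 3 by (intro mult_mono mult_left_mono) auto
    also have "\<dots> = (C * 3 * (2 * S)) * ((1 + x) / sqrt N * N powr (- \<delta> / 32))" by simp
    finally show ?thesis unfolding a_def N_def .
  qed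
  moreover have "0 < C * 3 * (2 * S)" using C S by simp
  ultimately show ?thesis by blast
qed

lemma smoothing_error:
  "\<exists>C>0. \<forall>T x n. 0 \<le> T \<longrightarrow> 0 \<le> x \<longrightarrow> 1 \<le> n \<longrightarrow>
     \<bar>alive_mean (strip T (horizon n)) x n n - prob {\<omega> \<in> alive x n. x + walk X n \<omega> \<le> T}\<bar>
     \<le> C * rate x n"
proof -
  obtain C where C: "0 < C" and win: "\<And>z x n. 0 \<le> x \<Longrightarrow> 1 \<le> n \<Longrightarrow>
     prob (alive_near x n n z (window n)) \<le> C * rate x n"
    using window_estimate by blast
  obtain S where S: "0 < S" and surv: "\<And>x n. 0 \<le> x \<Longrightarrow> prob (alive x n) \<le> S * (1 + x) / sqrt (real n + 1)"
    using survival_bound by blast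
  let ?K = "8 * S + 6 * C"
  have "\<bar>alive_mean (strip T (horizon n)) x n n - prob {\<omega> \<in> alive x n. x + walk X n \<omega> \<le> T}\<bar>
     \<le> ?K * rate x n" if T: "0 \<le> T" and x: "0 \<le> x" and n: "1 \<le> n" for T x n
  proof -
    define N where "N = real n"
    define a where "a = window n"
    define h where "h = horizon n"
    define E where "E = (1 + x) / sqrt N * N powr (- \<delta> / 32)"
    have N: "1 \<le> N" using n by (simp add: N_def)
    have a: "1 \<le> a" "a = N powr (1 / 2 - \<delta> / 32)"
      unfolding a_def window_def N_def using n \<delta> by (auto intro!: ge_one_powr_ge_zero)
    have h: "0 < h" "sqrt h = N powr (1 / 2 - \<delta> / 16)"
      unfolding h_def N_def using horizon_bounds[OF n] by auto
    have ratio: "sqrt h / a = N powr (- \<delta> / 32)"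
      unfolding h(2) a(2) using N by (simp flip: powr_diff)
    define f :: "real \<Rightarrow> real" where "f = indicator {..T}"
    define w :: "real \<Rightarrow> real \<Rightarrow> real" where "w z = indicator {y. \<bar>y - z\<bar> \<le> a}" for z
    define g where "g y = 8 * sqrt h / a + (3 * w 0 y + 3 * w T y)" for y
    have wq: "quad_growth (w z)" for z
      unfolding w_def by (rule quad_growth_bounded[where C=1]) (auto simp: indicator_def)
    have fq: "quad_growth f"
      unfolding f_def by (rule quad_growth_bounded[where C=1]) (auto simp: indicator_def)
    have wq2: "quad_growth (\<lambda>y. 3 * w 0 y + 3 * w T y)"
      by (rule quad_growth_add[OF quad_growth_cmult[OF wq] quad_growth_cmult[OF wq]])
    have gq: "quad_growth g"
      unfolding g_def[abs_def] by (rule quad_growth_add[OF quad_growth_const wq2])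
    have pointwise: "\<bar>strip T h y - f y\<bar> \<le> g y" if y: "0 \<le> y" for y
    proof (cases "a \<le> y \<and> a \<le> \<bar>y - T\<bar>")
      case True
      then have "\<bar>strip T h y - f y\<bar> \<le> 8 * sqrt h / a"
        unfolding f_def using T a h by (intro strip_near_indicator) auto
      also have "\<dots> \<le> g y" unfolding g_def w_def by (simp add: indicator_def)
      finally show ?thesis .
    next
      case False
      then have "1 \<le> w 0 y + w T y" using y unfolding w_def by (auto simp: indicator_def)
      moreover have "\<bar>strip T h y - f y\<bar> \<le> 3"
        using strip_abs_le[of T h y] unfolding f_def by (auto simp: indicator_def)
      moreover have "0 \<le> 8 * sqrt h / a" using a h by simp
      ultimately show ?thesis unfolding g_def by linarith
    qed
    have mean_w: "alive_mean (w z) x n n \<le> C * E" for z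
    proof -
      have "{y. \<bar>y - z\<bar> \<le> a} \<in> sets borel" by measurable
      from alive_mean_indicator[OF this, of x n n] win[OF x n, of z]
      show ?thesis unfolding w_def E_def a_def N_def by simp
    qed
    have mean_g: "alive_mean g x n n \<le> ?K * E"
    proof -
      have "alive_mean g x n n = 8 * sqrt h / a * prob (alive x n) + (3 * alive_mean (w 0) x n n + 3 * alive_mean (w T) x n n)"
        unfolding g_def[abs_def]
        by (simp only: alive_mean_add[OF quad_growth_const wq2] alive_mean_const
            alive_mean_add[OF quad_growth_cmult[OF wq] quad_growth_cmult[OF wq]] alive_mean_cmult)
      moreover have "8 * sqrt h / a * prob (alive x n) \<le> 8 * S * E"
      proof -
        have "prob (alive x n) \<le> S * (1 + x) / sqrt N"
          unfolding N_def using S x n by (intro order_trans[OF surv[OF x]] divide_left_mono) auto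
        then have "8 * N powr (- \<delta> / 32) * prob (alive x n) \<le> 8 * N powr (- \<delta> / 32) * (S * (1 + x) / sqrt N)"
          by (intro mult_left_mono) auto
        also have "\<dots> = 8 * S * E" by (simp add: E_def)
        finally show ?thesis using ratio by (simp flip: times_divide_eq_right)
      qed
      moreover have "?K * E = 8 * S * E + (3 * (C * E) + 3 * (C * E))" by (simp add: algebra_simps)
      ultimately show ?thesis using mean_w[of 0] mean_w[of T] by linarith
    qed
    have "alive_mean (strip T h) x n n \<le> alive_mean (\<lambda>y. f y + g y) x n n"
    proof (rule alive_mean_mono_nonneg[OF quad_growth_strip quad_growth_add[OF fq gq] x])
      show "strip T h y \<le> f y + g y" if "0 \<le> y" for y using pointwise[OF that] by linarith
    qed
    moreover have "alive_mean f x n n \<le> alive_mean (\<lambda>y. strip T h y + g y) x n n"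
    proof (rule alive_mean_mono_nonneg[OF fq quad_growth_add[OF quad_growth_strip gq] x])
      show "f y \<le> strip T h y + g y" if "0 \<le> y" for y using pointwise[OF that] by linarith
    qed
    ultimately have "\<bar>alive_mean (strip T h) x n n - alive_mean f x n n\<bar> \<le> ?K * E"
      unfolding alive_mean_add[OF fq gq] alive_mean_add[OF quad_growth_strip gq]
      using mean_g by linarith
    moreover have "alive_mean f x n n = prob {\<omega> \<in> alive x n. x + walk X n \<omega> \<le> T}"
      unfolding f_def by (subst alive_mean_indicator) auto
    ultimately show ?thesis unfolding h_def E_def N_def by simp
  qed
  moreover have "0 < ?K" using C S by simp
  ultimately show ?thesis by blast
qed

text \<open>
The limit theorem for all starting points; the cubic term matters only when \<open>x\<close> is close to \<open>sqrt n\<close>.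
\<close>

lemma conditioned_limit:
  "\<exists>C>0. \<forall>T x n. 0 \<le> T \<longrightarrow> 0 \<le> x \<longrightarrow> 1 \<le> n \<longrightarrow>
     \<bar>prob {\<omega> \<in> alive x n. x + walk X n \<omega> \<le> T} - harmonic_V M X x * strip_slope T (v * real n)\<bar>
     \<le> C * (rate x n + (x / sqrt (real n)) ^ 3)"
proof -
  obtain C where C: "0 < C" and 1: "\<And>T x n. 0 \<le> x \<Longrightarrow> 1 \<le> n \<Longrightarrow>
     \<bar>alive_mean (strip T (horizon n)) x n n - harmonic_V M X x * strip_slope T (v * real n)\<bar>
     \<le> C * (rate x n + (x / sqrt (real n)) ^ 3)"
    using smoothed_estimate by blast
  obtain D where D: "0 < D" and 2: "\<And>T x n. 0 \<le> T \<Longrightarrow> 0 \<le> x \<Longrightarrow> 1 \<le> n \<Longrightarrow>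
     \<bar>alive_mean (strip T (horizon n)) x n n - prob {\<omega> \<in> alive x n. x + walk X n \<omega> \<le> T}\<bar>
     \<le> D * rate x n"
    using smoothing_error by blast
  have "\<bar>prob {\<omega> \<in> alive x n. x + walk X n \<omega> \<le> T} - harmonic_V M X x * strip_slope T (v * real n)\<bar>
     \<le> (C + D) * (rate x n + (x / sqrt (real n)) ^ 3)"
    if "0 \<le> T" "0 \<le> x" "1 \<le> n" for T x n
  proof -
    have "0 \<le> D * (x / sqrt (real n)) ^ 3" using D that by simp
    then show ?thesis using 1[OF that(2,3), of T] 2[OF that] unfolding distrib_left distrib_right by linarith
  qed
  moreover have "0 < C + D" using C D by simp
  ultimately show ?thesis by blast
qed

end

section \<open>The conditioned limit theorem\<close>

theorem theorem2p7:
  fixes M :: "'a measure" and X :: "nat \<Rightarrow> 'a \<Rightarrow> real" and \<sigma> \<delta> :: real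
  assumes "prob_space M"
    and "prob_space.indep_vars M (\<lambda>_. borel) X {1..}"
    and "\<And>i. i \<ge> 1 \<Longrightarrow> distr M borel (X i) = distr M borel (X 1)"
    and "integrable M (X 1)" and "(\<integral>\<omega>. X 1 \<omega> \<partial>M) = 0"
    and "integrable M (\<lambda>\<omega>. (X 1 \<omega>)\<^sup>2)" and "(\<integral>\<omega>. (X 1 \<omega>)\<^sup>2 \<partial>M) = \<sigma>\<^sup>2" and "\<sigma> > 0"
    and "\<delta> > 0" and "integrable M (\<lambda>\<omega>. \<bar>X 1 \<omega>\<bar> powr (2 + \<delta>))"
  shows "(\<exists>\<epsilon>\<^sub>0>0. \<forall>\<epsilon>. 0 < \<epsilon> \<and> \<epsilon> < \<epsilon>\<^sub>0 \<longrightarrow> (\<exists>c\<^sub>\<epsilon>>0.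
            (\<forall>n::nat. \<forall>t::real. \<forall>x::real.
               n \<ge> 1 \<and> t \<ge> 0 \<and> 0 \<le> x \<and> x \<le> real n powr (1 / 2 - \<epsilon>) \<longrightarrow>
               \<bar>measure M {\<omega> \<in> space M. (x + walk X n \<omega>) / (\<sigma> * sqrt (real n)) \<le> t
                                          \<and> exit_time X x \<omega> > enat n}
                 - 2 * harmonic_V M X x / (\<sigma> * sqrt (2 * pi * real n)) * rayleigh_cdf t\<bar>
               \<le> c\<^sub>\<epsilon> * ((1 + x) / real n powr (1 / 2 + \<epsilon>)))
          \<and> (\<forall>n::nat. \<forall>x::real.
               n \<ge> 1 \<and> 0 \<le> x \<and> x \<le> real n powr (1 / 2 - \<epsilon>) \<longrightarrow>
               \<bar>measure M {\<omega> \<in> space M. exit_time X x \<omega> > enat n}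
                 - 2 * harmonic_V M X x / (\<sigma> * sqrt (2 * pi * real n))\<bar>
               \<le> c\<^sub>\<epsilon> * ((1 + x) / real n powr (1 / 2 + \<epsilon>)))))
       \<and> (\<exists>c::real. \<forall>n::nat. \<forall>x::real. n \<ge> 1 \<and> x \<ge> 0 \<longrightarrow>
            measure M {\<omega> \<in> space M. exit_time X x \<omega> > enat n} \<le> c * ((1 + x) / sqrt (real n)))"
proof -
  \<comment> \<open>A moment of order \<open>2 + \<delta>\<close> gives one of order \<open>2 + d\<close>; the Taylor estimates need \<open>d \<le> 1\<close>.\<close>
  define d where "d = min \<delta> 1"
  interpret prob_space M by fact
  interpret random_walk M X "\<sigma>\<^sup>2" d
  proof
    show "integrable M (\<lambda>\<omega>. \<bar>X 1 \<omega>\<bar> powr (2 + d))"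
    proof (rule Bochner_Integration.integrable_bound)
      show "integrable M (\<lambda>\<omega>. 1 + \<bar>X 1 \<omega>\<bar> powr (2 + \<delta>))"
        using assms(10) by simp
      have [measurable]: "X 1 \<in> borel_measurable M" using assms(4) by simp
      show "(\<lambda>\<omega>. \<bar>X 1 \<omega>\<bar> powr (2 + d)) \<in> borel_measurable M" by measurable
      show "AE \<omega> in M. norm (\<bar>X 1 \<omega>\<bar> powr (2 + d)) \<le> norm (1 + \<bar>X 1 \<omega>\<bar> powr (2 + \<delta>))"
      proof (intro AE_I2)
        fix \<omega>
        show "norm (\<bar>X 1 \<omega>\<bar> powr (2 + d)) \<le> norm (1 + \<bar>X 1 \<omega>\<bar> powr (2 + \<delta>))"
        proof (cases "\<bar>X 1 \<omega>\<bar> \<le> 1")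
          case True
          have "\<bar>X 1 \<omega>\<bar> powr (2 + d) \<le> 1 powr (2 + d)"
            using True \<open>\<delta> > 0\<close> by (intro powr_mono2) (auto simp: d_def)
          also have "\<dots> \<le> 1 + \<bar>X 1 \<omega>\<bar> powr (2 + \<delta>)" by simp
          finally show ?thesis by simp
        next
          case False
          have "\<bar>X 1 \<omega>\<bar> powr (2 + d) \<le> \<bar>X 1 \<omega>\<bar> powr (2 + \<delta>)"
            using False by (intro powr_mono) (auto simp: d_def)
          then show ?thesis by simp
        qed
      qed
    qed
    show "distr M borel (X i) = distr M borel (X 1)" if "i \<ge> 1" for i by (rule assms(3)[OF that])
    show "0 < \<sigma>\<^sup>2" "0 < d" "d \<le> 1" using \<open>\<sigma> > 0\<close> \<open>\<delta> > 0\<close> by (auto simp: d_def)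
  qed fact+
  obtain C where C: "0 < C" and main: "\<And>T x n. 0 \<le> T \<Longrightarrow> 0 \<le> x \<Longrightarrow> 1 \<le> n \<Longrightarrow>
     \<bar>prob {\<omega> \<in> alive x n. x + walk X n \<omega> \<le> T} - harmonic_V M X x * strip_slope T (\<sigma>\<^sup>2 * real n)\<bar>
     \<le> C * ((1 + x) / sqrt (real n) * real n powr (- d / 32) + (x / sqrt (real n)) ^ 3)"
    using conditioned_limit by blast
  obtain S where S: "0 < S" and surv: "\<And>x n. 0 \<le> x \<Longrightarrow> prob (alive x n) \<le> S * (1 + x) / sqrt (real n + 1)"
    using survival_bound by blast
  define \<epsilon>0 where "\<epsilon>0 = d / 32"
  have \<epsilon>0: "\<epsilon>0 > 0" using \<open>\<delta> > 0\<close> by (simp add: \<epsilon>0_def d_def)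
  have scale: "{\<omega> \<in> space M. (x + walk X n \<omega>) / (\<sigma> * sqrt (real n)) \<le> t \<and> exit_time X x \<omega> > enat n}
      = {\<omega> \<in> alive x n. x + walk X n \<omega> \<le> t * (\<sigma> * sqrt (real n))}" if "1 \<le> n" for x t n
    using that \<open>\<sigma> > 0\<close> by (auto simp: alive_eq pos_divide_le_eq)
  \<comment> \<open>The restriction \<open>x \<le> n powr (1 / 2 - \<epsilon>)\<close> serves only to absorb the cubic error term.\<close>
  have bound: "C * ((1 + x) / sqrt (real n) * real n powr (- d / 32) + (x / sqrt (real n)) ^ 3)
      \<le> 2 * C * ((1 + x) / real n powr (1 / 2 + \<epsilon>))"
    if \<epsilon>: "0 < \<epsilon>" "\<epsilon> < \<epsilon>0" and n: "1 \<le> n" and x: "0 \<le> x" "x \<le> real n powr (1 / 2 - \<epsilon>)" for \<epsilon> x n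
  proof -
    define N where "N = real n"
    have N: "1 \<le> N" using n by (simp add: N_def)
    have goal: "(1 + x) / N powr (1 / 2 + \<epsilon>) = (1 + x) / sqrt N * N powr (- \<epsilon>)"
      using N by (simp add: powr_add powr_half_sqrt powr_minus_divide)
    have "(1 + x) / sqrt N * N powr (- d / 32) \<le> (1 + x) / sqrt N * N powr (- \<epsilon>)"
      using x N \<epsilon> by (intro mult_left_mono powr_mono) (auto simp: \<epsilon>0_def)
    moreover have "(x / sqrt N) ^ 3 \<le> (1 + x) / sqrt N * N powr (- \<epsilon>)"
    proof -
      have "x / sqrt N \<le> N powr (1 / 2 - \<epsilon>) / sqrt N"
        using x N unfolding N_def by (intro divide_right_mono) auto
      also have "\<dots> = N powr (- \<epsilon>)" using N by (simp add: powr_diff powr_half_sqrt powr_minus_divide)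
      finally have r: "x / sqrt N \<le> N powr (- \<epsilon>)" .
      have le1: "N powr (- \<epsilon>) \<le> 1" using N \<epsilon> powr_mono[of "- \<epsilon>" 0 N] by simp
      have r1: "x / sqrt N \<le> 1" using r le1 by linarith
      have "(x / sqrt N) ^ 3 = (x / sqrt N) * ((x / sqrt N) * (x / sqrt N))"
        by (simp only: power3_eq_cube mult.assoc)
      also have "\<dots> \<le> ((1 + x) / sqrt N) * (N powr (- \<epsilon>) * 1)"
        using x N r r1 by (intro mult_mono divide_right_mono) auto
      finally show ?thesis by simp
    qed
    ultimately have "(1 + x) / sqrt N * N powr (- d / 32) + (x / sqrt N) ^ 3 \<le> 2 * ((1 + x) / sqrt N * N powr (- \<epsilon>))"
      unfolding mult_2 by (rule add_mono)
    then have "C * ((1 + x) / sqrt N * N powr (- d / 32) + (x / sqrt N) ^ 3) \<le> C * (2 * ((1 + x) / sqrt N * N powr (- \<epsilon>)))"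
      using C by (intro mult_left_mono) auto
    then show ?thesis unfolding N_def[symmetric] goal by (simp only: mult.assoc mult.left_commute)
  qed
  have first: "\<bar>prob {\<omega> \<in> space M. (x + walk X n \<omega>) / (\<sigma> * sqrt (real n)) \<le> t \<and> exit_time X x \<omega> > enat n}
       - 2 * harmonic_V M X x / (\<sigma> * sqrt (2 * pi * real n)) * rayleigh_cdf t\<bar>
       \<le> 2 * C * ((1 + x) / real n powr (1 / 2 + \<epsilon>))"
    if \<epsilon>: "0 < \<epsilon>" "\<epsilon> < \<epsilon>0" and n: "1 \<le> n" and t: "0 \<le> t" and x: "0 \<le> x" "x \<le> real n powr (1 / 2 - \<epsilon>)" for \<epsilon> t x n
  proof -
    let ?T = "t * (\<sigma> * sqrt (real n))"
    have T: "0 \<le> ?T" using t \<open>\<sigma> > 0\<close> by simp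
    have "2 * harmonic_V M X x / (\<sigma> * sqrt (2 * pi * real n)) * rayleigh_cdf t = harmonic_V M X x * strip_slope ?T (\<sigma>\<^sup>2 * real n)"
      unfolding strip_slope_rayleigh[OF \<open>\<sigma> > 0\<close> t n] by simp
    then show ?thesis
      using main[OF T x(1) n] bound[OF \<epsilon> n x] unfolding scale[OF n] by linarith
  qed
  \<comment> \<open>The unrestricted survival probability is the limit as \<open>t\<close> tends to infinity through the integers.\<close>
  have second: "\<bar>prob {\<omega> \<in> space M. exit_time X x \<omega> > enat n} - 2 * harmonic_V M X x / (\<sigma> * sqrt (2 * pi * real n))\<bar>
       \<le> 2 * C * ((1 + x) / real n powr (1 / 2 + \<epsilon>))"
    if \<epsilon>: "0 < \<epsilon>" "\<epsilon> < \<epsilon>0" and n: "1 \<le> n" and x: "0 \<le> x" "x \<le> real n powr (1 / 2 - \<epsilon>)" for \<epsilon> x n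
  proof -
    define c where "c = \<sigma> * sqrt (real n)"
    have c: "0 < c" using \<open>\<sigma> > 0\<close> n by (simp add: c_def)
    let ?A = "\<lambda>k::nat. {\<omega> \<in> alive x n. x + walk X n \<omega> \<le> real k * c}"
    let ?b = "2 * harmonic_V M X x / (\<sigma> * sqrt (2 * pi * real n))"
    have "(\<lambda>k. prob (?A k)) \<longlonglongrightarrow> prob (\<Union>k. ?A k)"
    proof (rule finite_Lim_measure_incseq)
      have "?A k \<in> sets M" for k using sets.sets_into_space[OF sets_alive] by measurable
      then show "range ?A \<subseteq> sets M" by blast
      show "incseq ?A"
      proof (rule incseq_SucI)
        fix k
        have "real k * c \<le> real (Suc k) * c" using c by simp
        then show "?A k \<subseteq> ?A (Suc k)" by fastforce
      qed
    qed
    moreover have "(\<Union>k. ?A k) = alive x n"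
    proof -
      have "\<exists>k. x + walk X n \<omega> \<le> real k * c" for \<omega>
        using reals_Archimedean3[OF c, rule_format, of "x + walk X n \<omega>"] by (auto intro: less_imp_le)
      then show ?thesis by auto
    qed
    ultimately have "(\<lambda>k. prob (?A k)) \<longlonglongrightarrow> prob (alive x n)" by simp
    moreover have "(\<lambda>k. rayleigh_cdf (real k)) \<longlonglongrightarrow> 1"
      unfolding rayleigh_cdf_def by simp real_asymp
    ultimately have lim: "(\<lambda>k. \<bar>prob (?A k) - ?b * rayleigh_cdf (real k)\<bar>) \<longlonglongrightarrow> \<bar>prob (alive x n) - ?b * 1\<bar>"
      by (intro tendsto_intros)
    have "\<bar>prob (alive x n) - ?b * 1\<bar> \<le> 2 * C * ((1 + x) / real n powr (1 / 2 + \<epsilon>))"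
    proof (rule LIMSEQ_le_const2[OF lim], intro exI allI impI)
      fix k :: nat
      show "\<bar>prob (?A k) - ?b * rayleigh_cdf (real k)\<bar> \<le> 2 * C * ((1 + x) / real n powr (1 / 2 + \<epsilon>))"
        using first[OF \<epsilon> n _ x, of "real k"] unfolding scale[OF n] c_def by simp
    qed
    then show ?thesis by (simp add: alive_eq)
  qed
  have third: "prob {\<omega> \<in> space M. exit_time X x \<omega> > enat n} \<le> S * ((1 + x) / sqrt (real n))"
    if "1 \<le> n" "0 \<le> x" for x n
  proof -
    have "prob (alive x n) \<le> S * (1 + x) / sqrt (real n + 1)" by (rule surv[OF that(2)])
    also have "\<dots> \<le> S * (1 + x) / sqrt (real n)" using S that by (intro divide_left_mono) auto
    finally show ?thesis by (simp add: alive_eq)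
  qed
  show ?thesis
  proof (rule conjI[OF exI[of _ \<epsilon>0] exI[of _ S]]; intro conjI allI impI exI[of _ "2 * C"]; (elim conjE)?)
    show "0 < \<epsilon>0" by (rule \<epsilon>0)
    show "0 < 2 * C" using C by simp
  qed (rule first second third; assumption)+
qed

end
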